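(* Let $\omega\subset\mathbb{T}$ be a nonempty open set and let $a$ be a smooth, nonnegative function on $\mathbb{T}$ with $a(x)>0$ on $\omega$. Consider the damped BBM equation $u_t-u_{xxt}+u_x+uu_x+a(x)u=0$ ($x\in\mathbb{T}$, $t\ge 0$), $u(x,0)=u_0(x)$ ($x\in\mathbb{T}$), in its integral form $$u(t)=u_0-\int_0^t(1-\partial_x^2)^{-1}\Big[a(x)u+\Big(u+\frac{u^2}{2}\Big)_x\Big](\tau)\,d\tau. \qquad (\ast)$$ (i) Let $s\ge 0$ be given. For any $u_0\in H^s(\mathbb{T})$, there exist $T>0$ and a unique solution $u$ of $(\ast)$ in $C([0,T],H^s(\mathbb{T}))$. Moreover, the correspondence $u_0\in H^s(\mathbb{T})\mapsto u\in C([0,T],H^s(\mathbb{T}))$ is Lipschitz continuous. (ii) If $s=1$, the solution exists for every $T>0$, and the energy $\|u(t)\|_1^2$ is nonincreasing. (iii) Finally (for $s=1$), if $v_0$ denotes any weak limit in $H^1(\mathbb{T})$ of a sequence $u(t_n)$ with $t_n\nearrow+\infty$, then the solution $v$ of the undamped BBM equation $v_t-v_{xxt}+v_x+vv_x=0$ on $\mathbb{T}$ with $v(x,0)=v_0(x)$ satisfies $v(x,t)=0$ for all $(x,t)\in\omega\times(0,T)$, for some time $T>0$. (iv) In particular, if the UCP Conjecture (stated in the context) holds, then $v_0=0$, so that $u(t)\to 0$ weakly in $H^1(\mathbb{T})$ as $t\to+\infty$, hence strongly in $H^s(\mathbb{T})$ for all $s<1$.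
   Context: $\mathbb{T}=\mathbb{R}/(2\pi\mathbb{Z})$; functions are real-valued. The norm of $H^s(\mathbb{T})$ is $\|\sum_{n\in\mathbb{Z}}c_ne^{inx}\|_s^2=\sum_{n\in\mathbb{Z}}|c_n|^2(1+|n|^2)^s$. For $f\in L^2(\mathbb{T})$, $(1-\partial_x^2)^{-1}f$ denotes the unique $v\in H^2(\mathbb{T})$ with $(1-\partial_x^2)v=f$ (extended to other Sobolev spaces as the Fourier multiplier $(1+n^2)^{-1}$). The solution of the undamped BBM equation is understood in the same integral sense, i.e. $(\ast)$ with $a=0$. UCP Conjecture (Unique Continuation Property; open, used only as a hypothesis in (iv)): there exists some number $\delta>0$ such that for any $v_0\in H^1(\mathbb{T})$ with $\|v_0\|_{H^1(\mathbb{T})}<\delta$, if the solution $v=v(x,t)$ of $v_t-v_{xxt}+v_x+vv_x=0$ ($x\in\mathbb{T}$), $v(x,0)=v_0(x)$, satisfies $v(x,t)=0$ for all $(x,t)\in\omega'\times(0,T)$ for some nonempty open set $\omega'\subset\mathbb{T}$ and some time $T>0$, then $v_0=0$ (and hence $v\equiv 0$). *)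

theory Defs
  imports "HOL-Analysis.Analysis"
begin

text \<open>
  Functions on the torus are 2 pi-periodic functions on the reals. Elements of \<open>L\<^sup>2\<close> are
  represented by Borel functions, so equality in \<open>L\<^sup>2\<close> (and in the Sobolev spaces) is equality
  almost everywhere. Time-dependent functions are written \<open>u t x\<close>, time first.
\<close>

definition torus_periodic :: "(real \<Rightarrow> 'a) \<Rightarrow> bool" where
  "torus_periodic f \<longleftrightarrow> (\<forall>x. f (x + 2 * pi) = f x)"

text \<open>An open subset of the torus is identified with its preimage in the reals.\<close>

definition torus_open :: "real set \<Rightarrow> bool" where
  "torus_open W \<longleftrightarrow> open W \<and> torus_periodic (\<lambda>x. x \<in> W)"

definition torus_smooth :: "(real \<Rightarrow> real) \<Rightarrow> bool" where
  "torus_smooth f \<longleftrightarrow>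
     torus_periodic f \<and> (\<forall>k x. (deriv ^^ k) f field_differentiable (at x))"

definition L2_torus :: "(real \<Rightarrow> real) set" where
  "L2_torus = {f. torus_periodic f \<and> f \<in> borel_measurable borel \<and>
                  set_integrable lborel {0..2 * pi} (\<lambda>x. (f x)\<^sup>2)}"

definition fourier_coeff :: "(real \<Rightarrow> real) \<Rightarrow> int \<Rightarrow> complex" where
  "fourier_coeff f n =
     (LINT x:{0..2 * pi}|lborel. of_real (f x) * cis (- (of_int n * x))) / of_real (2 * pi)"

definition sobolev_norm :: "real \<Rightarrow> (real \<Rightarrow> real) \<Rightarrow> real" where
  "sobolev_norm s f =
     sqrt (\<Sum>\<^sub>\<infinity>n::int. (cmod (fourier_coeff f n))\<^sup>2 * (1 + (real_of_int n)\<^sup>2) powr s)"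

text \<open>For \<open>s \<ge> 0\<close> this is the whole Sobolev space; for \<open>s < 0\<close> only its \<open>L\<^sup>2\<close> elements.\<close>

definition sobolev :: "real \<Rightarrow> (real \<Rightarrow> real) set" where
  "sobolev s = {f \<in> L2_torus.
     (\<lambda>n::int. (cmod (fourier_coeff f n))\<^sup>2 * (1 + (real_of_int n)\<^sup>2) powr s) summable_on UNIV}"

definition sobolev_dist :: "real \<Rightarrow> (real \<Rightarrow> real) \<Rightarrow> (real \<Rightarrow> real) \<Rightarrow> real" where
  "sobolev_dist s f g = sobolev_norm s (\<lambda>x. f x - g x)"

text \<open>
  Periodic distributions (such as the \<open>x\<close>-derivative of an \<open>L\<^sup>1\<close> function) are represented by
  their Fourier coefficients.
\<close>

definition dx_coeff :: "(int \<Rightarrow> complex) \<Rightarrow> int \<Rightarrow> complex" where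
  "dx_coeff c n = \<i> * of_int n * c n"

text \<open>
  The operator \<open>(1 - \<partial>\<^sub>x\<^sup>2)\<^sup>-\<^sup>1\<close> as the Fourier multiplier \<open>1 / (1 + n\<^sup>2)\<close>. The result is
  determined up to equality almost everywhere; it exists whenever the coefficients
  \<open>c n / (1 + n\<^sup>2)\<close> are square summable and \<open>c (- n)\<close> is the conjugate of \<open>c n\<close>.
\<close>

definition helmholtz_inv :: "(int \<Rightarrow> complex) \<Rightarrow> real \<Rightarrow> real" where
  "helmholtz_inv c =
     (SOME v. v \<in> L2_torus \<and> (\<forall>n. fourier_coeff v n = c n / (1 + (of_int n)\<^sup>2)))"

definition bbm_rhs :: "(real \<Rightarrow> real) \<Rightarrow> (real \<Rightarrow> real) \<Rightarrow> real \<Rightarrow> real" where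
  "bbm_rhs a f = helmholtz_inv (\<lambda>n.
     fourier_coeff (\<lambda>x. a x * f x) n +
     dx_coeff (fourier_coeff (\<lambda>x. f x + (f x)\<^sup>2 / 2)) n)"

definition sobolev_cont :: "real \<Rightarrow> real \<Rightarrow> (real \<Rightarrow> real \<Rightarrow> real) \<Rightarrow> bool" where
  "sobolev_cont s T u \<longleftrightarrow>
     (\<forall>t\<in>{0..T}. u t \<in> sobolev s) \<and>
     (\<forall>t\<in>{0..T}. ((\<lambda>\<tau>. sobolev_dist s (u \<tau>) (u t)) \<longlongrightarrow> 0) (at t within {0..T}))"

text \<open>
  The Riemann integral over \<open>{0..t}\<close> of a function of time with values in the Sobolev space:
  the limit, in the Sobolev norm, of Riemann sums as the mesh tends to 0.
\<close>

definition has_sobolev_integral ::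
  "real \<Rightarrow> (real \<Rightarrow> real \<Rightarrow> real) \<Rightarrow> (real \<Rightarrow> real) \<Rightarrow> real \<Rightarrow> bool" where
  "has_sobolev_integral s g I t \<longleftrightarrow>
     (\<forall>\<tau>\<in>{0..t}. g \<tau> \<in> sobolev s) \<and> I \<in> sobolev s \<and>
     (\<forall>e>0. \<exists>d>0. \<forall>p. p tagged_division_of {0..t} \<and> (\<lambda>\<tau>. ball \<tau> d) fine p \<longrightarrow>
        sobolev_dist s (\<lambda>x. \<Sum>(\<tau>, K)\<in>p. measure lborel K * g \<tau> x) I < e)"

text \<open>
  Solutions in \<open>C([0,T], H\<^sup>s)\<close> of the integral form of the BBM equation with damping
  coefficient \<open>a\<close>; the undamped equation is the case \<open>a = 0\<close>.
\<close>

definition bbm_solution ::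
  "(real \<Rightarrow> real) \<Rightarrow> real \<Rightarrow> real \<Rightarrow> (real \<Rightarrow> real) \<Rightarrow> (real \<Rightarrow> real \<Rightarrow> real) \<Rightarrow> bool" where
  "bbm_solution a s T u0 u \<longleftrightarrow>
     sobolev_cont s T u \<and>
     (\<forall>t\<in>{0..T}. \<exists>I. has_sobolev_integral s (\<lambda>\<tau>. bbm_rhs a (u \<tau>)) I t \<and>
        (AE x in lborel. u t x = u0 x - I x))"

definition unique_bbm_solution ::
  "(real \<Rightarrow> real) \<Rightarrow> real \<Rightarrow> real \<Rightarrow> (real \<Rightarrow> real) \<Rightarrow> (real \<Rightarrow> real \<Rightarrow> real) \<Rightarrow> bool" where
  "unique_bbm_solution a s T u0 u \<longleftrightarrow>
     bbm_solution a s T u0 u \<and>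
     (\<forall>w. bbm_solution a s T u0 w \<longrightarrow> (\<forall>t\<in>{0..T}. AE x in lborel. w t x = u t x))"

text \<open>
  Continuous linear functionals on the Sobolev space. Boundedness forces them to respect
  equality almost everywhere.
\<close>

definition sobolev_functional :: "real \<Rightarrow> ((real \<Rightarrow> real) \<Rightarrow> real) \<Rightarrow> bool" where
  "sobolev_functional s l \<longleftrightarrow>
     (\<forall>f\<in>sobolev s. \<forall>g\<in>sobolev s. \<forall>c d.
        l (\<lambda>x. c * f x + d * g x) = c * l f + d * l g) \<and>
     (\<exists>C. \<forall>f\<in>sobolev s. \<bar>l f\<bar> \<le> C * sobolev_norm s f)"

definition sobolev_weak_limit ::
  "real \<Rightarrow> ('i \<Rightarrow> real \<Rightarrow> real) \<Rightarrow> (real \<Rightarrow> real) \<Rightarrow> 'i filter \<Rightarrow> bool" where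
  "sobolev_weak_limit s f f0 F \<longleftrightarrow>
     f0 \<in> sobolev s \<and> (\<forall>l. sobolev_functional s l \<longrightarrow> ((\<lambda>i. l (f i)) \<longlongrightarrow> l f0) F)"

text \<open>
  Pointwise values of (classes of) \<open>H\<^sup>1\<close> functions are those of the unique continuous
  representative, which exists by the Sobolev embedding.
\<close>

definition cont_rep :: "(real \<Rightarrow> real) \<Rightarrow> real \<Rightarrow> real" where
  "cont_rep f = (THE g. continuous_on UNIV g \<and> (AE x in lborel. g x = f x))"

definition vanishes_on :: "real set \<Rightarrow> real \<Rightarrow> (real \<Rightarrow> real \<Rightarrow> real) \<Rightarrow> bool" where
  "vanishes_on W T v \<longleftrightarrow> (\<forall>x\<in>W. \<forall>t\<in>{0<..<T}. cont_rep (v t) x = 0)"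

definition UCP_conjecture :: bool where
  "UCP_conjecture \<longleftrightarrow>
     (\<exists>\<delta>>0. \<forall>v0\<in>sobolev 1. sobolev_norm 1 v0 < \<delta> \<longrightarrow>
        (\<forall>v. (\<forall>T>0. bbm_solution (\<lambda>_. 0) 1 T v0 v) \<longrightarrow>
           (\<exists>W T. torus_open W \<and> W \<noteq> {} \<and> T > 0 \<and> vanishes_on W T v) \<longrightarrow>
           (AE x in lborel. v0 x = 0)))"

end

theory Submission
  imports Defs
begin

text \<open>Taking Fourier coefficients, multiplied by the weights \<open>(1 + n\<^sup>2) powr (s/2)\<close>, identifies the Sobolev
space \<open>H\<^sup>s\<close> isometrically with one fixed real Hilbert space \<open>hl2\<close>, the Hermitian square summable sequences.
The operator \<open>(1 - \<partial>\<^sub>x\<^sup>2)\<^sup>-\<^sup>1 \<partial>\<^sub>x\<close> gains one derivative, so the equation loses none, and the right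
side becomes a vector field on \<open>hl2\<close>. It is locally Lipschitz for every \<open>s \<ge> 0\<close> because of the bilinear estimate
\<open>norm_wconv_le\<close>: the weight is quasi-subadditive, and half of the inverse Helmholtz operator already supplies the
square summable factor \<open>(1 + n\<^sup>2) powr (- 1/2)\<close>. The integral equation then says exactly that the curve in \<open>hl2\<close> is an integral
curve of this field (\<open>bbm_solution_iff\<close>); Picard iteration and a Gronwall argument give (i).

For \<open>s = 1\<close> the pairing of \<open>u\<close> with the right side kills the transport term and the cubic term and leaves
\<open>- \<integral> a u\<^sup>2\<close> up to a constant (\<open>energy_identity\<close>). The norm cannot grow, so a field cut off outside a
ball never sees its cutoff, and solutions are global. This is (ii).

For (iii), a weak \<open>H\<^sup>1\<close> limit \<open>v0\<close> of \<open>u (t\<^sub>n)\<close> is a strong \<open>L\<^sup>2\<close> limit, and the equation is well posed in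
\<open>L\<^sup>2\<close>. Hence the solutions started from \<open>u (t\<^sub>n)\<close> converge in \<open>L\<^sup>2\<close>, uniformly on bounded time intervals,
to the damped solution \<open>v\<close> started from \<open>v0\<close>. The energy that \<open>u\<close> dissipates over \<open>[t\<^sub>n, t\<^sub>n + T]\<close>
tends to zero, so \<open>v\<close> dissipates nothing, that is \<open>a v = 0\<close> for all times
(\<open>omega_limit_dissip\<close>). So \<open>v\<close> solves the undamped equation and vanishes on \<open>\<omega>\<close>.

For (iv), \<open>v\<close> vanishes on \<open>\<omega>\<close> for \<^emph>\<open>all\<close> \<open>t \<ge> 0\<close>, and this forces \<open>v0 = 0\<close> (\<open>unique_continuation\<close>).
Put \<open>g = (1 - \<partial>\<^sub>x\<^sup>2)\<^sup>-\<^sup>1 (v + v\<^sup>2/2)\<close>, so that \<open>v\<^sub>t = - g\<^sub>x\<close>. On \<open>\<omega>\<close> both \<open>g\<close> and \<open>g\<^sub>x\<close> vanish. The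
conservation law \<open>\<partial>\<^sub>t (v\<^sup>2/2 + v\<^sup>3/6) = \<partial>\<^sub>x (g\<^sub>x\<^sup>2 - g\<^sup>2) / 2\<close> is integrated against
\<open>exp (- 4 x)\<close> over a period that begins and ends in \<open>\<omega>\<close>: there are no boundary terms, and a Hardy inequality
bounds the derivative of the weighted integral below by a multiple of \<open>\<integral> g\<^sup>2\<close>. The weighted integral is bounded,
hence \<open>g\<close> comes arbitrarily close to \<open>0\<close> in \<open>L\<^sup>2\<close> along some \<open>s\<^sub>n \<rightarrow> \<infinity>\<close>. A weak limit \<open>w\<close> of
\<open>v (s\<^sub>n)\<close> satisfies \<open>w + w\<^sup>2/2 = 0\<close>; being continuous and zero at a point, \<open>w\<close> is zero, and the convergence is
uniform. The unweighted integral of \<open>v\<^sup>2/2 + v\<^sup>3/6\<close> is conserved, so it is zero; since it controls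
\<open>\<integral> v\<^sup>2\<close> as soon as \<open>\<bar>v\<bar> \<le> 1\<close>, some \<open>v (s\<^sub>n)\<close> is zero, and \<open>v0 = 0\<close> because the \<open>H\<^sup>1\<close> norm is
conserved. Every weak limit point of the bounded trajectory being zero, the trajectory tends weakly to zero, and strongly
in \<open>H\<^sup>s\<close> for \<open>s < 1\<close> by compactness of the embedding.\<close>

section \<open>Fourier coefficients of square integrable functions\<close>

abbreviation circ :: "real measure" where
  "circ \<equiv> restrict_space lborel {0..2 * pi}"

lemma circ_integral:
  fixes f :: "real \<Rightarrow> 'b::{banach, second_countable_topology}"
  shows "(LINT x:{0..2 * pi}|lborel. f x) = integral\<^sup>L circ f"
  by (simp add: integral_restrict_space set_lebesgue_integral_def)

lemma circ_integrable:
  fixes f :: "real \<Rightarrow> 'b::{banach, second_countable_topology}"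
  shows "set_integrable lborel {0..2 * pi} f \<longleftrightarrow> integrable circ f"
  by (simp add: integrable_restrict_space set_integrable_def)

interpretation circ: finite_measure circ
  by (rule finite_measureI) (simp add: emeasure_restrict_space space_restrict_space)

lemma circ_measurable: "f \<in> borel_measurable borel \<Longrightarrow> f \<in> borel_measurable circ"
  by (simp add: measurable_restrict_space1)

lemma cis_measurable [measurable]: "(\<lambda>x. cis (c * x)) \<in> borel_measurable borel"
  by (intro borel_measurable_continuous_onI continuous_intros)

lemma torus_periodic_int:
  assumes "torus_periodic f" shows "f (x + of_int k * (2 * pi)) = f x"
proof (induction k rule: int_induct[where k=0])
  case base show ?case by simp
next
  case (step1 i)
  then show ?case using assms[unfolded torus_periodic_def, rule_format, of "x + of_int i * (2*pi)"] by (simp add: algebra_simps)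
next
  case (step2 i)
  then show ?case using assms[unfolded torus_periodic_def, rule_format, of "x + of_int (i-1) * (2*pi)"] by (simp add: algebra_simps)
qed

lemma reduce_to_period:
  obtains k :: int where "x - of_int k * (2 * pi) \<in> {0..2 * pi}"
proof -
  define k where "k = \<lfloor>x / (2*pi)\<rfloor>"
  have "of_int k \<le> x / (2*pi)" "x / (2*pi) < of_int k + 1" unfolding k_def by linarith+
  then have "x - of_int k * (2 * pi) \<in> {0..2*pi}" by (auto simp: field_simps)
  then show thesis by (rule that)
qed

lemma cis_full_turns: "cis (- (of_int n * (2 * pi))) = 1"
  using cis_multiple_2pi[of "- of_int n"] by (simp add: mult_ac)

text \<open>The exceptional set on the line is covered by countably many translates of the exceptional set in one period.\<close>

lemma circ_AE_periodic:
  assumes "AE x in circ. P x" and P: "\<And>x. P (x + 2 * pi) \<longleftrightarrow> P x"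
  shows "AE x in lborel. P x"
proof -
  have "AE x in lborel. x \<in> {0..2 * pi} \<longrightarrow> P x"
    using assms(1) by (subst (asm) AE_restrict_space_iff) auto
  then obtain N where N: "N \<in> null_sets lborel" "\<And>x. x \<notin> N \<Longrightarrow> x \<in> {0..2 * pi} \<longrightarrow> P x"
    by (elim AE_E3) auto
  have "torus_periodic P" by (simp add: torus_periodic_def P)
  note Pk = torus_periodic_int[OF this]
  define N' where "N' = (\<Union>k::int. (\<lambda>x. x + of_int k * (2 * pi)) ` N)"
  have "N' \<in> null_sets lborel"
    unfolding N'_def
  proof (rule null_sets_UN')
    fix k :: int
    have "(\<lambda>x. x + of_int k * (2 * pi)) ` N = {x. x - of_int k * (2 * pi) \<in> N}"
      by force
    then show "(\<lambda>x. x + of_int k * (2 * pi)) ` N \<in> null_sets lborel"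
      using null_sets_translation[OF N(1), of "of_int k * (2*pi)"] by simp
  qed auto
  moreover have "{x. \<not> P x} \<subseteq> N'"
  proof
    fix x assume x: "x \<in> {x. \<not> P x}"
    obtain k :: int where k: "x - of_int k * (2 * pi) \<in> {0..2 * pi}" by (rule reduce_to_period)
    define y where "y = x - of_int k * (2*pi)"
    have "y \<in> {0..2*pi}" unfolding y_def by (rule k)
    moreover have "\<not> P y" using x Pk[of y k] unfolding y_def by simp
    ultimately have "y \<in> N" using N by auto
    then show "x \<in> N'" unfolding N'_def y_def by (force simp: image_iff)
  qed
  ultimately show ?thesis by (auto intro: AE_I')
qed

lemma L2_torusD:
  assumes "f \<in> L2_torus"
  shows "torus_periodic f" "f \<in> borel_measurable borel" "f \<in> borel_measurable circ"
    "integrable circ (\<lambda>x. (f x)\<^sup>2)"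
  using assms by (auto simp: L2_torus_def circ_integrable circ_measurable)

lemma L2_torus_iff:
  "f \<in> L2_torus \<longleftrightarrow> torus_periodic f \<and> f \<in> borel_measurable borel \<and> integrable circ (\<lambda>x. (f x)\<^sup>2)"
  by (auto simp: L2_torus_def circ_integrable)

lemma L2_mult_integrable:
  assumes "f \<in> L2_torus" "g \<in> L2_torus"
  shows "integrable circ (\<lambda>x. f x * g x)"
proof (rule Bochner_Integration.integrable_bound)
  show "integrable circ (\<lambda>x. (f x)\<^sup>2 + (g x)\<^sup>2)"
    using assms by (intro Bochner_Integration.integrable_add L2_torusD)
  show "(\<lambda>x. f x * g x) \<in> borel_measurable circ"
    using L2_torusD[OF assms(1)] L2_torusD[OF assms(2)] by measurable
  have "\<bar>a * b\<bar> \<le> a\<^sup>2 + b\<^sup>2" for a b :: real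
  proof -
    have "2 * (\<bar>a\<bar> * \<bar>b\<bar>) \<le> a\<^sup>2 + b\<^sup>2"
      using sum_squares_bound[of "\<bar>a\<bar>" "\<bar>b\<bar>"] by simp
    moreover have "0 \<le> \<bar>a\<bar> * \<bar>b\<bar>" by simp
    ultimately show ?thesis unfolding abs_mult by linarith
  qed
  then show "AE x in circ. norm (f x * g x) \<le> norm ((f x)\<^sup>2 + (g x)\<^sup>2)"
    by (auto intro!: AE_I2)
qed

lemma const_L2 [simp]: "(\<lambda>_. c) \<in> L2_torus"
  by (simp add: L2_torus_iff torus_periodic_def)

lemma L2_integrable: "f \<in> L2_torus \<Longrightarrow> integrable circ f"
  using L2_mult_integrable[of f "\<lambda>_. 1"] by simp

lemma L2_lincomb:
  assumes "f \<in> L2_torus" "g \<in> L2_torus"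
  shows "(\<lambda>x. c * f x + d * g x) \<in> L2_torus"
proof -
  note f = L2_torusD[OF assms(1)] and g = L2_torusD[OF assms(2)]
  have "integrable circ (\<lambda>x. c\<^sup>2 * (f x)\<^sup>2 + d\<^sup>2 * (g x)\<^sup>2 + (2 * c * d) * (f x * g x))"
    using f g L2_mult_integrable[OF assms] by auto
  moreover have "(\<lambda>x. c\<^sup>2 * (f x)\<^sup>2 + d\<^sup>2 * (g x)\<^sup>2 + (2 * c * d) * (f x * g x)) = (\<lambda>x. (c * f x + d * g x)\<^sup>2)"
    by (rule ext) (simp add: power2_eq_square algebra_simps)
  ultimately have "integrable circ (\<lambda>x. (c * f x + d * g x)\<^sup>2)" by simp
  moreover have "(\<lambda>x. c * f x + d * g x) \<in> borel_measurable borel"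
    using f(2) g(2) by measurable
  ultimately show ?thesis using f(1) g(1) by (simp add: L2_torus_iff torus_periodic_def)
qed

lemma L2_diff: "f \<in> L2_torus \<Longrightarrow> g \<in> L2_torus \<Longrightarrow> (\<lambda>x. f x - g x) \<in> L2_torus"
  using L2_lincomb[of f g 1 "-1"] by simp

lemma bounded_mult_L2:
  assumes f: "f \<in> L2_torus" and a: "torus_periodic a" "a \<in> borel_measurable borel" "\<And>x. \<bar>a x\<bar> \<le> A"
  shows "(\<lambda>x. a x * f x) \<in> L2_torus"
proof -
  note f' = L2_torusD[OF f]
  have "integrable circ (\<lambda>x. (a x * f x)\<^sup>2)"
  proof (rule Bochner_Integration.integrable_bound)
    show "integrable circ (\<lambda>x. A\<^sup>2 * (f x)\<^sup>2)" using f' by simp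
    show "(\<lambda>x. (a x * f x)\<^sup>2) \<in> borel_measurable circ"
      using f'(3) circ_measurable[OF a(2)] by measurable
    show "AE x in circ. norm ((a x * f x)\<^sup>2) \<le> norm (A\<^sup>2 * (f x)\<^sup>2)"
      using a(3) by (intro AE_I2) (auto simp: power_mult_distrib intro!: mult_right_mono, metis abs_le_square_iff abs_of_nonneg abs_ge_zero order_trans)
  qed
  moreover have "(\<lambda>x. a x * f x) \<in> borel_measurable borel" using f'(2) a(2) by measurable
  ultimately show ?thesis using f'(1) a(1) by (simp add: L2_torus_iff torus_periodic_def)
qed

lemma fourier_coeff_circ:
  "fourier_coeff f n = (\<integral>x. of_real (f x) * cis (- (of_int n * x)) \<partial>circ) / of_real (2 * pi)"
  by (simp add: fourier_coeff_def circ_integral)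

lemma mult_cis_integrable:
  fixes f :: "real \<Rightarrow> complex"
  assumes "integrable circ f"
  shows "integrable circ (\<lambda>x. f x * cis (of_int n * x))" "integrable circ (\<lambda>x. f x * cis (- (of_int n * x)))"
proof -
  have [measurable]: "f \<in> borel_measurable circ" using assms by auto
  have [measurable]: "(\<lambda>x. cis (of_int n * x)) \<in> borel_measurable circ" "(\<lambda>x. cis (- (of_int n * x))) \<in> borel_measurable circ"
    using cis_measurable[of "of_int n"] cis_measurable[of "- of_int n"] by (auto intro: circ_measurable)
  show "integrable circ (\<lambda>x. f x * cis (of_int n * x))" "integrable circ (\<lambda>x. f x * cis (- (of_int n * x)))"
    by (rule Bochner_Integration.integrable_bound[OF assms]; force simp: norm_mult)+
qed

lemma fourier_coeff_lincomb:
  assumes "integrable circ f" "integrable circ g"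
  shows "fourier_coeff (\<lambda>x. c * f x + d * g x) n = of_real c * fourier_coeff f n + of_real d * fourier_coeff g n"
proof -
  have "(\<integral>x. of_real (c * f x + d * g x) * cis (- (of_int n * x)) \<partial>circ)
     = (\<integral>x. of_real c * (of_real (f x) * cis (- (of_int n * x))) + of_real d * (of_real (g x) * cis (- (of_int n * x))) \<partial>circ)"
    by (simp add: algebra_simps)
  also have "\<dots> = of_real c * (\<integral>x. of_real (f x) * cis (- (of_int n * x)) \<partial>circ) + of_real d * (\<integral>x. of_real (g x) * cis (- (of_int n * x)) \<partial>circ)"
    using assms mult_cis_integrable(2)[of "\<lambda>x. of_real (f x)"] mult_cis_integrable(2)[of "\<lambda>x. of_real (g x)"]
    by (subst Bochner_Integration.integral_add) auto
  finally show ?thesis by (simp add: fourier_coeff_circ field_simps)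
qed

lemma fourier_coeff_minus_index: "fourier_coeff f (- n) = cnj (fourier_coeff f n)"
proof -
  have "cnj (\<integral>x. of_real (f x) * cis (- (of_int n * x)) \<partial>circ) = (\<integral>x. cnj (of_real (f x) * cis (- (of_int n * x))) \<partial>circ)"
    by (rule Bochner_Integration.integral_cnj[symmetric])
  then show ?thesis by (simp add: fourier_coeff_circ cis_cnj)
qed

lemma fourier_coeff_cong_AE:
  assumes "AE x in lborel. f x = g x" "f \<in> borel_measurable borel" "g \<in> borel_measurable borel"
  shows "fourier_coeff f n = fourier_coeff g n"
proof -
  have "AE x in circ. f x = g x" using assms(1) by (subst AE_restrict_space_iff) auto
  have [measurable]: "(\<lambda>x. cis (- (of_int n * x))) \<in> borel_measurable circ"
    using cis_measurable[of "- of_int n"] by (auto intro: circ_measurable)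
  have [measurable]: "f \<in> borel_measurable circ" "g \<in> borel_measurable circ"
    using assms by (auto intro: circ_measurable)
  have "(\<integral>x. of_real (f x) * cis (- (of_int n * x)) \<partial>circ) = (\<integral>x. of_real (g x) * cis (- (of_int n * x)) \<partial>circ)"
    by (rule integral_cong_AE) (use \<open>AE x in circ. f x = g x\<close> in auto)
  then show ?thesis by (simp add: fourier_coeff_circ)
qed

lemma cis_integral: "(\<integral>x. cis (of_int n * x) \<partial>circ) = (if n = 0 then of_real (2 * pi) else 0)"
proof (cases "n = 0")
  case True
  then show ?thesis by (simp add: measure_restrict_space space_restrict_space scaleR_conv_of_real)
next
  case False
  define F where "F x = cis (of_int n * x) / (\<i> * of_int n)" for x
  have "(\<integral>x. cis (of_int n * x) \<partial>circ) = (LBINT x:{0..2*pi}. cis (of_int n * x))"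
    by (simp add: circ_integral)
  also have "\<dots> = F (2*pi) - F 0"
    unfolding set_lebesgue_integral_def
  proof (rule integral_FTC_atLeastAtMost)
    show "continuous_on {0..2*pi} (\<lambda>x. cis (of_int n * x))" by (intro continuous_intros)
    fix x :: real
    have [simp]: "- (\<i> * (E * \<i>)) = E" for E :: complex
      by (simp add: mult.commute[of E \<i>])
    have "((\<lambda>x. exp (\<i> * of_real (of_int n * x)) / (\<i> * of_int n)) has_vector_derivative exp (\<i> * of_real (of_int n * x))) (at x within {0..2*pi})"
      using False by (auto intro!: derivative_eq_intros has_vector_derivative_real_field)
    then show "(F has_vector_derivative cis (of_int n * x)) (at x within {0..2*pi})"
      unfolding F_def by (simp add: cis_conv_exp)
  qed simp
  also have "\<dots> = 0"
    unfolding F_def using cis_multiple_2pi[of "of_int n"] by (simp add: mult.commute mult.left_commute)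
  finally show ?thesis using False by simp
qed

section \<open>Uniqueness of Fourier coefficients\<close>

text \<open>Asking for orthogonality to all modulations of \<open>\<phi>\<close>, and not to \<open>\<phi>\<close> alone, makes the predicate stable
  under multiplication of \<open>\<phi>\<close> by trigonometric polynomials. The induction over polynomials below needs this in its
  multiplicative step.\<close>

definition annihilates :: "(real \<Rightarrow> real) \<Rightarrow> (real \<Rightarrow> complex) \<Rightarrow> bool" where
  "annihilates f \<phi> \<longleftrightarrow> \<phi> \<in> borel_measurable circ \<and> (\<exists>B. \<forall>x. cmod (\<phi> x) \<le> B) \<and>
     (\<forall>k::int. (\<integral>x. of_real (f x) * (\<phi> x * cis (of_int k * x)) \<partial>circ) = 0)"

lemma integrable_mult_bounded:
  fixes f g :: "'a \<Rightarrow> complex"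
  assumes "integrable M f" "g \<in> borel_measurable M" "\<And>x. cmod (g x) \<le> B"
  shows "integrable M (\<lambda>x. f x * g x)"
proof (rule Bochner_Integration.integrable_bound)
  show "integrable M (\<lambda>x. f x * of_real B)" using assms by auto
  have [measurable]: "f \<in> borel_measurable M" using assms by auto
  show "(\<lambda>x. f x * g x) \<in> borel_measurable M" using assms(2) by measurable
  have "0 \<le> B" using assms(3) norm_ge_zero order_trans by blast
  then show "AE x in M. norm (f x * g x) \<le> norm (f x * of_real B)"
    using assms(3) by (intro AE_I2) (simp add: norm_mult mult_left_mono)
qed

lemma annihil_cis: 
  assumes "annihilates f \<phi>" shows "annihilates f (\<lambda>x. cis (of_int n * x) * \<phi> x)"
  unfolding annihilates_def
proof (intro conjI allI)
  show "(\<lambda>x. cis (of_int n * x) * \<phi> x) \<in> borel_measurable circ"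
    using assms circ_measurable[OF cis_measurable[of "of_int n"]] unfolding annihilates_def by auto
  show "\<exists>B. \<forall>x. cmod (cis (of_int n * x) * \<phi> x) \<le> B"
    using assms by (simp add: annihilates_def norm_mult)
  fix k :: int
  have "(\<integral>x. of_real (f x) * (\<phi> x * cis (of_int (n + k) * x)) \<partial>circ) = 0"
    using assms unfolding annihilates_def by blast
  moreover have "of_real (f x) * (\<phi> x * cis (of_int (n + k) * x)) = of_real (f x) * (cis (of_int n * x) * \<phi> x * cis (of_int k * x))" for x
  proof -
    have "cis (of_int (n + k) * x) = cis (of_int n * x) * cis (of_int k * x)"
      by (simp add: cis_mult distrib_right)
    then show ?thesis by (simp only: mult_ac)
  qed
  ultimately show "(\<integral>x. of_real (f x) * (cis (of_int n * x) * \<phi> x * cis (of_int k * x)) \<partial>circ) = 0"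
    by (simp only:)
qed

lemma annihil_lincomb: 
  assumes f: "integrable circ f" and "annihilates f \<phi>" "annihilates f \<psi>"
  shows "annihilates f (\<lambda>x. c * \<phi> x + d * \<psi> x)"
  unfolding annihilates_def
proof (intro conjI allI)
  obtain B1 B2 where B: "\<And>x. cmod (\<phi> x) \<le> B1" "\<And>x. cmod (\<psi> x) \<le> B2"
    using assms unfolding annihilates_def by blast
  have m[measurable]: "\<phi> \<in> borel_measurable circ" "\<psi> \<in> borel_measurable circ"
    using assms unfolding annihilates_def by auto
  show "(\<lambda>x. c * \<phi> x + d * \<psi> x) \<in> borel_measurable circ" by measurable
  have "cmod (c * \<phi> x + d * \<psi> x) \<le> cmod c * B1 + cmod d * B2" for x
    using B[of x] by (intro order_trans[OF norm_triangle_ineq] add_mono) (auto simp: norm_mult intro: mult_left_mono)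
  then show "\<exists>B. \<forall>x. cmod (c * \<phi> x + d * \<psi> x) \<le> B" by blast
  fix k :: int
  have fc: "integrable circ (\<lambda>x. complex_of_real (f x))" using f by simp
  have ck[measurable]: "(\<lambda>x. cis (of_int k * x)) \<in> borel_measurable circ"
    by (rule circ_measurable[OF cis_measurable])
  have i1: "integrable circ (\<lambda>x. of_real (f x) * (\<phi> x * cis (of_int k * x)))"
    by (rule integrable_mult_bounded[OF fc, of _ B1]) (use B in \<open>auto simp: norm_mult\<close>)
  have i2: "integrable circ (\<lambda>x. of_real (f x) * (\<psi> x * cis (of_int k * x)))"
    by (rule integrable_mult_bounded[OF fc, of _ B2]) (use B in \<open>auto simp: norm_mult\<close>)
  have "(\<integral>x. of_real (f x) * ((c * \<phi> x + d * \<psi> x) * cis (of_int k * x)) \<partial>circ)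
      = (\<integral>x. c * (of_real (f x) * (\<phi> x * cis (of_int k * x))) + d * (of_real (f x) * (\<psi> x * cis (of_int k * x))) \<partial>circ)"
    by (simp add: algebra_simps)
  also have "\<dots> = c * (\<integral>x. (of_real (f x) * (\<phi> x * cis (of_int k * x))) \<partial>circ) + d * (\<integral>x. (of_real (f x) * (\<psi> x * cis (of_int k * x))) \<partial>circ)"
    using i1 i2 by (subst Bochner_Integration.integral_add) auto
  also have "\<dots> = 0" using assms unfolding annihilates_def by simp
  finally show "(\<integral>x. of_real (f x) * ((c * \<phi> x + d * \<psi> x) * cis (of_int k * x)) \<partial>circ) = 0" .
qed

text \<open>A linear form on the plane restricts to the circle as a combination of \<open>cis x\<close> and \<open>cis (- x)\<close>, which
  preserve annihilation. Leaving \<open>\<phi>\<close> arbitrary turns the product of two polynomials into two successive applications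
  of the induction hypothesis.\<close>

lemma annihil_polynomial:
  assumes f: "integrable circ f" and "real_polynomial_function p" and "annihilates f \<phi>"
  shows "annihilates f (\<lambda>x. of_real (p (cis x)) * \<phi> x)"
  using assms(2,3)
proof (induction arbitrary: \<phi> rule: real_polynomial_function.induct)
  case (linear p)
  then interpret p: bounded_linear p by simp
  have "p (cis x) = cos x * p 1 + sin x * p \<i>" for x
  proof -
    have "cis x = cos x *\<^sub>R 1 + sin x *\<^sub>R \<i>" by (simp add: complex_eq_iff)
    then show ?thesis by (simp add: p.add p.scaleR)
  qed
  then have pc: "of_real (p (cis x)) = of_real (cos x) * of_real (p 1) + complex_of_real (sin x) * of_real (p \<i>)" for x
    by simp
  have cs: "of_real (cos x) = (cis x + cis (- x)) / 2" "of_real (sin x) = (cis x - cis (- x)) / (2 * \<i>)" for x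
    by (auto simp: complex_eq_iff)
  have eq: "of_real (p (cis x)) * \<phi> x = 
      (of_real (p 1) / 2 + of_real (p \<i>) / (2 * \<i>)) * (cis (of_int 1 * x) * \<phi> x) +
      (of_real (p 1) / 2 - of_real (p \<i>) / (2 * \<i>)) * (cis (of_int (-1) * x) * \<phi> x)" for x
    unfolding pc cs by (simp add: algebra_simps diff_divide_distrib add_divide_distrib)
  show ?case unfolding eq by (intro annihil_lincomb[OF f] annihil_cis linear)
next
  case (const c)
  then show ?case using annihil_lincomb[OF f const const, of "of_real c" 0] by simp
next
  case (add p q)
  have eq: "of_real (p (cis x) + q (cis x)) * \<phi> x = 1 * (of_real (p (cis x)) * \<phi> x) + 1 * (of_real (q (cis x)) * \<phi> x)" for x
    by (simp add: algebra_simps)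
  show ?case unfolding eq by (intro annihil_lincomb[OF f] add)
next
  case (mult p q)
  have eq: "of_real (p (cis x) * q (cis x)) * \<phi> x = of_real (p (cis x)) * (of_real (q (cis x)) * \<phi> x)" for x
    by simp
  show ?case unfolding eq by (intro mult)
qed

text \<open>Stone--Weierstrass on the circle: polynomials in \<open>cis x\<close> approximate \<open>\<Psi>\<close>
  uniformly, and \<open>f\<close> annihilates each of them.\<close>

lemma fourier_zero_imp_continuous_zero:
  assumes f: "integrable circ f" and z: "\<And>n. fourier_coeff f n = 0"
    and \<Psi>: "continuous_on (sphere 0 1) \<Psi>" and \<Psi>m: "(\<lambda>x. \<Psi> (cis x)) \<in> borel_measurable circ"
  shows "(\<integral>x. f x * \<Psi> (cis x) \<partial>circ) = 0"
proof -
  have "annihilates f (\<lambda>_. 1)"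
    unfolding annihilates_def
  proof (intro conjI allI)
    fix k :: int
    show "(\<integral>x. of_real (f x) * (1 * cis (of_int k * x)) \<partial>circ) = 0"
      using z[of "-k"] by (simp add: fourier_coeff_circ)
  qed auto
  note p = annihil_polynomial[OF f _ this]
  define I where "I = (\<integral>x. \<bar>f x\<bar> \<partial>circ)"
  have "\<bar>\<integral>x. f x * \<Psi> (cis x) \<partial>circ\<bar> \<le> e" if e: "e > 0" for e
  proof -
    have I0: "0 \<le> I" unfolding I_def by simp
    define d where "d = e / (I + 1)"
    have d: "d > 0" using e I0 unfolding d_def by simp
    obtain q where q: "real_polynomial_function q" "\<And>z. z \<in> sphere 0 1 \<Longrightarrow> \<bar>\<Psi> z - q z\<bar> < d"
      using Stone_Weierstrass_real_polynomial_function[OF compact_sphere \<Psi> d] by blast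
    have ann: "annihilates f (\<lambda>x. of_real (q (cis x)) * 1)" by (rule p[OF q(1)])
    have qm[measurable]: "(\<lambda>x. q (cis x)) \<in> borel_measurable circ"
      by (intro circ_measurable borel_measurable_continuous_onI continuous_on_compose2[OF continuous_on_polymonial_function[of q UNIV]])
         (use q(1) in \<open>auto simp: real_polynomial_function_eq intro!: continuous_intros\<close>)
    obtain B where B: "\<And>x. cmod (of_real (q (cis x)) * 1) \<le> B" using ann unfolding annihilates_def by blast
    have iq: "integrable circ (\<lambda>x. f x * q (cis x))"
    proof -
      have "integrable circ (\<lambda>x. complex_of_real (f x) * of_real (q (cis x)))"
        by (rule integrable_mult_bounded[where B=B]) (use B f in auto)
      then have "integrable circ (\<lambda>x. complex_of_real (f x * q (cis x)))" by simp
      then show ?thesis using complex_of_real_integrable_eq by blast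
    qed
    have bd: "\<bar>\<Psi> (cis x) - q (cis x)\<bar> \<le> d" for x using q(2)[of "cis x"] by (simp add: less_imp_le)
    have fm[measurable]: "f \<in> borel_measurable circ" using f by auto
    note [measurable] = \<Psi>m
    have id: "integrable circ (\<lambda>x. f x * (\<Psi> (cis x) - q (cis x)))"
    proof (rule Bochner_Integration.integrable_bound)
      show "integrable circ (\<lambda>x. \<bar>f x\<bar> * d)" using f by auto
      show "AE x in circ. norm (f x * (\<Psi> (cis x) - q (cis x))) \<le> norm (\<bar>f x\<bar> * d)"
        using bd d by (intro AE_I2) (auto simp: abs_mult intro: mult_left_mono)
    qed measurable
    have "of_real (\<integral>x. f x * q (cis x) \<partial>circ) = (\<integral>x. complex_of_real (f x * q (cis x)) \<partial>circ)"
      by (rule integral_complex_of_real[symmetric])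
    also have "\<dots> = (\<integral>x. of_real (f x) * (of_real (q (cis x)) * 1 * cis (of_int 0 * x)) \<partial>circ)"
      by simp
    also have "\<dots> = 0" using ann unfolding annihilates_def by blast
    finally have q0: "(\<integral>x. f x * q (cis x) \<partial>circ) = 0" by simp
    have "(\<integral>x. f x * \<Psi> (cis x) \<partial>circ) = (\<integral>x. f x * (\<Psi> (cis x) - q (cis x)) + f x * q (cis x) \<partial>circ)"
      by (simp add: algebra_simps)
    also have "\<dots> = (\<integral>x. f x * (\<Psi> (cis x) - q (cis x)) \<partial>circ)"
      using id iq q0 by (subst Bochner_Integration.integral_add) auto
    finally have "\<bar>\<integral>x. f x * \<Psi> (cis x) \<partial>circ\<bar> = \<bar>\<integral>x. f x * (\<Psi> (cis x) - q (cis x)) \<partial>circ\<bar>" by simp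
    also have "\<dots> \<le> (\<integral>x. \<bar>f x * (\<Psi> (cis x) - q (cis x))\<bar> \<partial>circ)"
      by (rule integral_abs_bound)
    also have "\<dots> \<le> (\<integral>x. \<bar>f x\<bar> * d \<partial>circ)"
    proof (rule integral_mono)
      show "integrable circ (\<lambda>x. \<bar>f x * (\<Psi> (cis x) - q (cis x))\<bar>)" using id by (rule integrable_abs)
      show "integrable circ (\<lambda>x. \<bar>f x\<bar> * d)" using f by auto
      show "\<bar>f x * (\<Psi> (cis x) - q (cis x))\<bar> \<le> \<bar>f x\<bar> * d" for x
        unfolding abs_mult using bd by (intro mult_left_mono) auto
    qed
    also have "\<dots> = I * d" unfolding I_def by simp
    also have "\<dots> \<le> e" using I0 e unfolding d_def by (simp add: field_simps)
    finally show ?thesis .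
  qed
  then have "\<bar>\<integral>x. f x * \<Psi> (cis x) \<partial>circ\<bar> \<le> 0 + e" if "e > 0" for e
    using that by (simp only: add_0)
  then have "\<bar>\<integral>x. f x * \<Psi> (cis x) \<partial>circ\<bar> \<le> 0"
    by (rule field_le_epsilon)
  then show ?thesis by simp
qed

lemma cis_inj_circ:
  assumes "0 < x" "x < 2 * pi" "0 \<le> y" "y \<le> 2 * pi" "cis x = cis y"
  shows "x = y"
proof -
  have "cos x = cos y" "sin x = sin y" using assms(5) by (auto simp: complex_eq_iff)
  then have "cos (x - y) = 1" using sin_cos_squared_add3[of y] by (simp add: cos_diff)
  then obtain n :: int where n: "x - y = of_int n * 2 * pi" by (auto simp: cos_one_2pi_int)
  have "\<bar>x - y\<bar> < 2 * pi" using assms by auto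
  then have "\<bar>real_of_int n\<bar> * (2 * pi) < 1 * (2 * pi)" unfolding n by (simp add: abs_mult)
  then have "\<bar>real_of_int n\<bar> < 1" by (simp add: mult_less_cancel_right)
  then have "n = 0" by linarith
  then show ?thesis using n by simp
qed

text \<open>The indicator function of the closed arc \<open>cis ` {a..2 * pi}\<close> is a bounded pointwise
  limit of continuous functions of the distance to the arc. The arc and the interval differ only through the identification
  of \<open>0\<close> with \<open>2 * pi\<close>, which is a null set.\<close>

lemma fourier_zero_imp_tail_integral_zero:
  assumes f: "integrable circ f" and z: "\<And>n. fourier_coeff f n = 0" and a: "0 \<le> a" "a \<le> 2 * pi"
  shows "(\<integral>x. f x * indicator {a..2*pi} x \<partial>circ) = 0"
proof -
  define C where "C = cis ` {a..2*pi}"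
  have C: "compact C" "C \<noteq> {}"
    unfolding C_def using a by (auto intro!: compact_continuous_image continuous_intros)
  define \<Psi> where "\<Psi> k z = max 0 (1 - real k * infdist z C)" for k z
  have \<Psi>c: "continuous_on A (\<Psi> k)" for k A
    unfolding \<Psi>_def by (intro continuous_intros)
  have \<Psi>m[measurable]: "(\<lambda>x. \<Psi> k (cis x)) \<in> borel_measurable circ" for k
    by (intro circ_measurable borel_measurable_continuous_onI continuous_on_compose2[OF \<Psi>c[of UNIV]] continuous_intros) auto
  have fm[measurable]: "f \<in> borel_measurable circ" using f by auto
  have "(\<lambda>k. \<integral>x. f x * \<Psi> k (cis x) \<partial>circ) \<longlonglongrightarrow> (\<integral>x. f x * indicator C (cis x) \<partial>circ)"
  proof (rule integral_dominated_convergence[where w="\<lambda>x. \<bar>f x\<bar>"])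
    show "(\<lambda>x. f x * indicator C (cis x)) \<in> borel_measurable circ"
    proof -
      have [measurable]: "C \<in> sets borel" using C(1) by (simp add: borel_compact)
      have [measurable]: "cis \<in> borel_measurable circ"
        using circ_measurable[OF cis_measurable[of 1]] by simp
      show ?thesis by measurable
    qed
    show "AE x in circ. (\<lambda>k. f x * \<Psi> k (cis x)) \<longlonglongrightarrow> f x * indicator C (cis x)"
    proof (intro AE_I2 tendsto_mult_left)
      fix x
      show "(\<lambda>k. \<Psi> k (cis x)) \<longlonglongrightarrow> indicator C (cis x)"
      proof (cases "cis x \<in> C")
        case True
        then show ?thesis unfolding \<Psi>_def by simp
      next
        case False
        then have pos: "infdist (cis x) C > 0"
          using C compact_imp_closed infdist_pos_not_in_closed by blast
        obtain N where N: "real N * infdist (cis x) C > 1" using reals_Archimedean3[OF pos] by blast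
        have "\<forall>\<^sub>F k in sequentially. \<Psi> k (cis x) = 0"
          using eventually_ge_at_top[of N]
        proof eventually_elim
          case (elim k)
          have "1 < real k * infdist (cis x) C"
            using N mult_right_mono[of "real N" "real k" "infdist (cis x) C"] elim pos by linarith
          then show ?case unfolding \<Psi>_def by simp
        qed
        then show ?thesis using False by (simp add: tendsto_eventually)
      qed
    qed
    show "AE x in circ. norm (f x * \<Psi> k (cis x)) \<le> \<bar>f x\<bar>" for k
      by (intro AE_I2) (auto simp: \<Psi>_def abs_mult infdist_nonneg intro!: mult_left_le)
  qed (use f in auto)
  moreover have "(\<integral>x. f x * \<Psi> k (cis x) \<partial>circ) = 0" for k
    by (rule fourier_zero_imp_continuous_zero[OF f z \<Psi>c \<Psi>m])
  ultimately have 0: "(\<integral>x. f x * indicator C (cis x) \<partial>circ) = 0"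
    by (simp add: LIMSEQ_const_iff)
  have "AE x in lborel. x \<noteq> 0 \<and> x \<noteq> 2*pi"
    using AE_lborel_singleton[of 0] AE_lborel_singleton[of "2*pi::real"] by auto
  then have "AE x in circ. x \<noteq> 0 \<and> x \<noteq> 2*pi"
    by (subst AE_restrict_space_iff) auto
  moreover have "AE x in circ. x \<in> {0..2*pi}"
    using AE_space[of circ] by (simp add: space_restrict_space)
  ultimately have "AE x in circ. f x * indicator C (cis x) = f x * indicator {a..2*pi} x"
  proof eventually_elim
    case (elim x)
    have "cis x \<in> C \<longleftrightarrow> x \<in> {a..2*pi}"
    proof
      assume "cis x \<in> C"
      then obtain y where "y \<in> {a..2*pi}" "cis x = cis y" unfolding C_def by blast
      then show "x \<in> {a..2*pi}" using cis_inj_circ[of x y] elim a by auto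
    qed (simp add: C_def)
    then show ?case by (simp add: indicator_def)
  qed
  then have "(\<integral>x. f x * indicator C (cis x) \<partial>circ) = (\<integral>x. f x * indicator {a..2*pi} x \<partial>circ)"
  proof (rule integral_cong_AE[rotated 2])
    have [measurable]: "C \<in> sets borel" using C(1) by (simp add: borel_compact)
    have [measurable]: "cis \<in> borel_measurable circ"
      using circ_measurable[OF cis_measurable[of 1]] by simp
    show "(\<lambda>x. f x * indicator C (cis x)) \<in> borel_measurable circ" by measurable
    have [measurable]: "(\<lambda>x. indicator {a..2*pi} x :: real) \<in> borel_measurable circ" 
      by (intro circ_measurable) measurable
    show "(\<lambda>x. f x * indicator {a..2*pi} x) \<in> borel_measurable circ"
      by measurable
  qed
  from this[symmetric] 0 show ?thesis by (rule trans)
qed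

text \<open>The vanishing tail integrals say that the measures with densities \<open>max 0 f\<close> and
  \<open>max 0 (- f)\<close> agree on all half lines. Half lines determine a finite measure, and a measure determines its density
  almost everywhere.\<close>

lemma fourier_zero_imp_AE_zero_circ:
  assumes fb: "f \<in> borel_measurable borel" and f: "integrable circ f" and z: "\<And>n. fourier_coeff f n = 0"
  shows "AE x in circ. f x = 0"
proof -
  note [measurable] = fb
  define g where "g x = indicator {0..2*pi} x * f x" for x
  have gi: "integrable lborel g" using f by (simp add: integrable_restrict_space g_def[abs_def])
  have gm[measurable]: "g \<in> borel_measurable borel" unfolding g_def by measurable
  have gp: "integrable lborel (\<lambda>x. max 0 (g x))" "integrable lborel (\<lambda>x. max 0 (- g x))"
    using gi by auto
  define M where "M = density lborel (\<lambda>x. ennreal (max 0 (g x)))"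
  define N where "N = density lborel (\<lambda>x. ennreal (max 0 (- g x)))"
  have e: "emeasure (density lborel (\<lambda>x. ennreal (h x))) {a<..} = ennreal (\<integral>x. h x * indicator {a<..} x \<partial>lborel)"
    if "integrable lborel h" "\<And>x. 0 \<le> h x" "h \<in> borel_measurable borel" for h and a :: real
  proof -
    note [measurable] = that(3)
    have i: "integrable lborel (\<lambda>x. h x * indicator {a<..} x)"
      using integrable_mult_indicator[of "{a<..}" lborel h] that(1) by (simp add: mult.commute)
    have "emeasure (density lborel (\<lambda>x. ennreal (h x))) {a<..} = (\<integral>\<^sup>+x. ennreal (h x) * indicator {a<..} x \<partial>lborel)"
      by (subst emeasure_density) auto
    also have "\<dots> = (\<integral>\<^sup>+x. ennreal (h x * indicator {a<..} x) \<partial>lborel)"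
      by (intro nn_integral_cong) (auto simp: indicator_def)
    also have "\<dots> = ennreal (\<integral>x. h x * indicator {a<..} x \<partial>lborel)"
      using i that(2) by (intro nn_integral_eq_integral) auto
    finally show ?thesis .
  qed
  have tail: "(\<integral>x. g x * indicator {a<..} x \<partial>lborel) = 0" for a
  proof -
    define b where "b = min (2*pi) (max 0 a)"
    have "(\<integral>x. g x * indicator {a<..} x \<partial>lborel) = (\<integral>x. indicator {0..2*pi} x *\<^sub>R (f x * indicator {b..2*pi} x) \<partial>lborel)"
    proof (rule integral_cong_AE)
      show "AE x in lborel. g x * indicator {a<..} x = indicator {0..2*pi} x *\<^sub>R (f x * indicator {b..2*pi} x)"
        using AE_lborel_singleton[of a] AE_lborel_singleton[of b]
        by eventually_elim (auto simp: g_def b_def indicator_def)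
    qed measurable
    also have "\<dots> = (\<integral>x. f x * indicator {b..2*pi} x \<partial>circ)" by (simp add: integral_restrict_space)
    also have "\<dots> = 0" by (rule fourier_zero_imp_tail_integral_zero[OF f z]) (auto simp: b_def)
    finally show ?thesis .
  qed
  have "(\<integral>x. max 0 (g x) * indicator {a<..} x \<partial>lborel) = (\<integral>x. max 0 (- g x) * indicator {a<..} x \<partial>lborel)" for a
  proof -
    have i: "integrable lborel (\<lambda>x. max 0 (g x) * indicator {a<..} x)" "integrable lborel (\<lambda>x. max 0 (- g x) * indicator {a<..} x)"
      using integrable_mult_indicator[of "{a<..}" lborel "\<lambda>x. max 0 (g x)"]
        integrable_mult_indicator[of "{a<..}" lborel "\<lambda>x. max 0 (- g x)"] gp
      by (simp_all add: mult.commute)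
    have "(\<integral>x. g x * indicator {a<..} x \<partial>lborel) = (\<integral>x. max 0 (g x) * indicator {a<..} x - max 0 (- g x) * indicator {a<..} x \<partial>lborel)"
      by (intro Bochner_Integration.integral_cong) (auto simp: max_def)
    also have "\<dots> = (\<integral>x. max 0 (g x) * indicator {a<..} x \<partial>lborel) - (\<integral>x. max 0 (- g x) * indicator {a<..} x \<partial>lborel)"
      using i by (rule Bochner_Integration.integral_diff)
    finally show ?thesis using tail by simp
  qed
  then have "M = N"
    unfolding M_def N_def
    by (intro measure_eqI_lessThan) (simp_all add: e[OF gp(1)] e[OF gp(2)])
  then have "AE x in lborel. ennreal (max 0 (g x)) = ennreal (max 0 (- g x))"
    unfolding M_def N_def by (subst (asm) sigma_finite_measure.density_unique_iff[OF sigma_finite_lborel]) auto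
  then have "AE x in lborel. g x = 0"
    by eventually_elim (auto simp: max_def split: if_splits)
  then have "AE x in lborel. x \<in> {0..2*pi} \<longrightarrow> f x = 0"
    by eventually_elim (auto simp: g_def)
  then show ?thesis
    by (simp add: AE_restrict_space_iff)
qed

theorem fourier_unique:
  assumes f: "f \<in> L2_torus" and g: "g \<in> L2_torus" and eq: "\<And>n. fourier_coeff f n = fourier_coeff g n"
  shows "AE x in lborel. f x = g x"
proof -
  have d: "(\<lambda>x. f x - g x) \<in> L2_torus" by (rule L2_diff[OF f g])
  have "fourier_coeff (\<lambda>x. f x - g x) n = 0" for n
    using fourier_coeff_lincomb[OF L2_integrable[OF f] L2_integrable[OF g], of 1 "-1" n] eq by simp
  then have "AE x in circ. f x - g x = 0"
    using fourier_zero_imp_AE_zero_circ[of "\<lambda>x. f x - g x"] L2_torusD[OF d] L2_integrable[OF d] by blast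
  then have "AE x in circ. f x = g x" by eventually_elim simp
  show ?thesis
  proof (rule circ_AE_periodic)
    have "f (x + 2 * pi) = f x" "g (x + 2 * pi) = g x" for x
      using L2_torusD(1)[OF f] L2_torusD(1)[OF g] unfolding torus_periodic_def by blast+
    then show "f (x + 2 * pi) = g (x + 2 * pi) \<longleftrightarrow> f x = g x" for x by presburger
  qed fact
qed

section \<open>The Riesz--Fischer theorem and products\<close>

definition hermitian :: "(int \<Rightarrow> complex) \<Rightarrow> bool" where
  "hermitian c \<longleftrightarrow> (\<forall>n. c (- n) = cnj (c n))"

lemma hermitianD: "hermitian c \<Longrightarrow> c (- n) = cnj (c n)"
  by (simp add: hermitian_def)

lemma hermitian_fourier_coeff: "hermitian (fourier_coeff f)"
  by (simp add: hermitian_def fourier_coeff_minus_index)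

text \<open>Cauchy--Schwarz by the discriminant of the quadratic polynomial \<open>t \<mapsto> \<integral> (f + t g)\<^sup>2\<close>.\<close>

lemma L2_CS:
  assumes f: "f \<in> L2_torus" and g: "g \<in> L2_torus"
  shows "(\<integral>x. f x * g x \<partial>circ)\<^sup>2 \<le> (\<integral>x. (f x)\<^sup>2 \<partial>circ) * (\<integral>x. (g x)\<^sup>2 \<partial>circ)"
proof -
  define A B C where "A = (\<integral>x. (f x)\<^sup>2 \<partial>circ)" and "B = (\<integral>x. f x * g x \<partial>circ)" and "C = (\<integral>x. (g x)\<^sup>2 \<partial>circ)"
  have q: "0 \<le> A + 2 * t * B + t\<^sup>2 * C" for t
  proof -
    have "0 \<le> (\<integral>x. (f x + t * g x)\<^sup>2 \<partial>circ)" by simp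
    also have "\<dots> = (\<integral>x. (f x)\<^sup>2 + ((2 * t) * (f x * g x) + t\<^sup>2 * (g x)\<^sup>2) \<partial>circ)"
      by (intro Bochner_Integration.integral_cong) (auto simp: power2_eq_square algebra_simps)
    also have "\<dots> = A + (2 * t * B + t\<^sup>2 * C)"
      using L2_torusD(4)[OF f] L2_torusD(4)[OF g] L2_mult_integrable[OF f g]
      unfolding A_def B_def C_def by (subst Bochner_Integration.integral_add, simp, simp, subst Bochner_Integration.integral_add) auto
    finally show ?thesis by simp
  qed
  have C0: "0 \<le> C" unfolding C_def by simp
  have "B\<^sup>2 \<le> A * C"
  proof (cases "C = 0")
    case True
    \<comment> \<open>The polynomial is linear in \<open>t\<close>, so its slope must vanish.\<close>
    have "B = 0"
    proof (rule ccontr)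
      assume "B \<noteq> 0"
      then show False using q[of "- (A + 1) / (2 * B)"] True by (simp add: field_simps)
    qed
    then show ?thesis using True by simp
  next
    case False
    \<comment> \<open>\<open>t = - B / C\<close> is the minimum of the polynomial.\<close>
    then show ?thesis using q[of "- B / C"] C0 by (simp add: field_simps power2_eq_square)
  qed
  then show ?thesis unfolding A_def B_def C_def .
qed

lemma abs_L2: "f \<in> L2_torus \<Longrightarrow> (\<lambda>x. \<bar>f x\<bar>) \<in> L2_torus"
  by (auto simp: L2_torus_iff torus_periodic_def)

lemma L2_abs_integral:
  assumes f: "f \<in> L2_torus" and g: "g \<in> L2_torus"
  shows "(\<integral>x. \<bar>f x * g x\<bar> \<partial>circ) \<le> sqrt (\<integral>x. (f x)\<^sup>2 \<partial>circ) * sqrt (\<integral>x. (g x)\<^sup>2 \<partial>circ)"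
proof -
  have "(\<integral>x. \<bar>f x * g x\<bar> \<partial>circ)\<^sup>2 \<le> (\<integral>x. (f x)\<^sup>2 \<partial>circ) * (\<integral>x. (g x)\<^sup>2 \<partial>circ)"
    using L2_CS[OF abs_L2[OF f] abs_L2[OF g]] by (simp add: abs_mult)
  from real_le_rsqrt[OF this] show ?thesis by (simp only: real_sqrt_mult)
qed

lemma fourier_coeff_mult_bound:
  assumes f: "f \<in> L2_torus" and g: "g \<in> L2_torus"
  shows "cmod (fourier_coeff (\<lambda>x. f x * g x) n) \<le> sqrt (\<integral>x. (f x)\<^sup>2 \<partial>circ) * sqrt (\<integral>x. (g x)\<^sup>2 \<partial>circ) / (2 * pi)"
proof -
  have "cmod (\<integral>x. of_real (f x * g x) * cis (- (of_int n * x)) \<partial>circ) \<le> (\<integral>x. cmod (of_real (f x * g x) * cis (- (of_int n * x))) \<partial>circ)"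
    by (rule integral_norm_bound)
  also have "\<dots> = (\<integral>x. \<bar>f x * g x\<bar> \<partial>circ)" by (simp add: norm_mult abs_mult)
  also note L2_abs_integral[OF f g]
  finally show ?thesis by (simp add: fourier_coeff_circ norm_divide divide_right_mono)
qed

definition trigsum :: "(int \<Rightarrow> complex) \<Rightarrow> nat \<Rightarrow> real \<Rightarrow> real" where
  "trigsum c N x = Re (\<Sum>n\<in>{- int N..int N}. c n * cis (of_int n * x))"

text \<open>Hermitian symmetry makes the symmetric partial sums real, so that taking the real part in the definition loses
  nothing.\<close>

lemma trigsum_complex:
  assumes "hermitian c"
  shows "complex_of_real (trigsum c N x) = (\<Sum>n\<in>{- int N..int N}. c n * cis (of_int n * x))"
proof -
  let ?S = "\<Sum>n\<in>{- int N..int N}. c n * cis (of_int n * x)"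
  have "cnj ?S = (\<Sum>n\<in>{- int N..int N}. c (- n) * cis (of_int (- n) * x))"
    by (simp add: hermitianD[OF assms] cis_cnj)
  also have "\<dots> = ?S"
    by (rule sum.reindex_bij_witness[where i=uminus and j=uminus]) auto
  finally show ?thesis unfolding trigsum_def by (metis Reals_cnj_iff of_real_Re)
qed

lemma trigsum_L2 [simp]: "trigsum c N \<in> L2_torus"
proof -
  have p: "torus_periodic (trigsum c N)"
  proof -
    have "cis (of_int n * (x + 2 * pi)) = cis (of_int n * x)" for n :: int and x
      using cis_multiple_2pi[of "of_int n"] by (simp add: distrib_left mult_ac flip: cis_mult)
    then show ?thesis by (simp add: torus_periodic_def trigsum_def)
  qed
  have c: "continuous_on UNIV (trigsum c N)"
    unfolding trigsum_def by (intro continuous_intros)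
  have m: "trigsum c N \<in> borel_measurable borel" by (rule borel_measurable_continuous_onI[OF c])
  have "\<bar>trigsum c N x\<bar> \<le> (\<Sum>n\<in>{- int N..int N}. cmod (c n))" for x
    unfolding trigsum_def by (rule order_trans[OF abs_Re_le_cmod order_trans[OF norm_sum]]) (simp add: norm_mult)
  then have "(\<lambda>x. trigsum c N x * 1) \<in> L2_torus"
    by (intro bounded_mult_L2[OF const_L2 p m])
  then show ?thesis by simp
qed

lemma integral_mult_trigsum:
  assumes g: "integrable circ g" and c: "hermitian c"
  shows "fourier_coeff (\<lambda>x. g x * trigsum c N x) m = (\<Sum>n\<in>{- int N..int N}. c n * fourier_coeff g (m - n))"
proof -
  have i: "integrable circ (\<lambda>x. complex_of_real (g x) * cis (- (of_int k * x)))" for k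
    using mult_cis_integrable(2)[of "\<lambda>x. of_real (g x)"] g by auto
  have e: "complex_of_real (g x * trigsum c N x) * cis (- (of_int m * x)) = 
      (\<Sum>n\<in>{- int N..int N}. c n * (of_real (g x) * cis (- (of_int (m - n) * x))))" for x
  proof -
    have "cis (- (of_int (m - n) * x)) = cis (of_int n * x) * cis (- (of_int m * x))" for n
      by (simp add: cis_mult algebra_simps)
    then show ?thesis
      by (simp only: of_real_mult trigsum_complex[OF c] sum_distrib_left sum_distrib_right mult_ac)
  qed
  have "(\<integral>x. complex_of_real (g x * trigsum c N x) * cis (- (of_int m * x)) \<partial>circ)
     = (\<Sum>n\<in>{- int N..int N}. c n * (\<integral>x. of_real (g x) * cis (- (of_int (m - n) * x)) \<partial>circ))"
  proof -
    have "integrable circ (\<lambda>x. c n * (of_real (g x) * cis (- (of_int (m - n) * x))))" for n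
      by (intro Bochner_Integration.integrable_mult_right i)
    then show ?thesis
      unfolding e by (simp add: Bochner_Integration.integral_sum del: of_int_diff)
  qed
  then show ?thesis by (simp only: fourier_coeff_circ sum_divide_distrib times_divide_eq_right)
qed

lemma fourier_coeff_const: "fourier_coeff (\<lambda>_. 1) n = (if n = 0 then 1 else 0)"
  using cis_integral[of "- n"] by (simp add: fourier_coeff_circ)

lemma fourier_coeff_trigsum:
  assumes c: "hermitian c"
  shows "fourier_coeff (trigsum c N) m = (if \<bar>m\<bar> \<le> int N then c m else 0)"
proof -
  have "fourier_coeff (\<lambda>x. 1 * trigsum c N x) m = (\<Sum>n\<in>{- int N..int N}. c n * fourier_coeff (\<lambda>_. 1) (m - n))"
    by (rule integral_mult_trigsum[OF _ c]) (simp add: L2_integrable)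
  also have "\<dots> = (\<Sum>n\<in>{- int N..int N}. if m = n then c n else 0)"
    by (intro sum.cong) (auto simp: fourier_coeff_const)
  also have "\<dots> = (if \<bar>m\<bar> \<le> int N then c m else 0)" by auto
  finally show ?thesis by simp
qed

lemma fourier_coeff_zero: "of_real (\<integral>x. f x \<partial>circ) = of_real (2 * pi) * fourier_coeff f 0"
  by (simp add: fourier_coeff_circ)

lemma integral_mult_trigsum_0:
  assumes g: "integrable circ g" and c: "hermitian c"
  shows "complex_of_real (\<integral>x. g x * trigsum c N x \<partial>circ) = of_real (2 * pi) * (\<Sum>n\<in>{- int N..int N}. c n * cnj (fourier_coeff g n))"
  using integral_mult_trigsum[OF assms, of N 0] by (simp add: fourier_coeff_zero fourier_coeff_minus_index)

definition psum2 :: "(int \<Rightarrow> complex) \<Rightarrow> nat \<Rightarrow> real" where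
  "psum2 c N = (\<Sum>n\<in>{- int N..int N}. (cmod (c n))\<^sup>2)"

lemma psum2_mono: "M \<le> N \<Longrightarrow> psum2 c M \<le> psum2 c N"
  unfolding psum2_def by (intro sum_mono2) auto

lemma trigsum_inner:
  assumes c: "hermitian c" and "M \<le> N"
  shows "(\<integral>x. trigsum c N x * trigsum c M x \<partial>circ) = 2 * pi * psum2 c M"
proof -
  have "complex_of_real (\<integral>x. trigsum c N x * trigsum c M x \<partial>circ)
     = of_real (2 * pi) * (\<Sum>n\<in>{- int M..int M}. c n * cnj (fourier_coeff (trigsum c N) n))"
    by (rule integral_mult_trigsum_0[OF _ c]) (simp add: L2_integrable)
  also have "(\<Sum>n\<in>{- int M..int M}. c n * cnj (fourier_coeff (trigsum c N) n)) = (\<Sum>n\<in>{- int M..int M}. of_real ((cmod (c n))\<^sup>2))"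
    using \<open>M \<le> N\<close> by (intro sum.cong) (auto simp: fourier_coeff_trigsum[OF c] complex_norm_square simp del: of_real_power)
  finally show ?thesis unfolding psum2_def by (simp only: of_real_sum[symmetric] of_real_mult[symmetric] of_real_eq_iff)
qed

lemma trigsum_diff:
  assumes c: "hermitian c" and "M \<le> N"
  shows "(\<integral>x. (trigsum c N x - trigsum c M x)\<^sup>2 \<partial>circ) = 2 * pi * (psum2 c N - psum2 c M)"
proof -
  have "(\<integral>x. (trigsum c N x - trigsum c M x)\<^sup>2 \<partial>circ) = (\<integral>x. trigsum c N x * trigsum c N x + (trigsum c M x * trigsum c M x - 2 * (trigsum c N x * trigsum c M x)) \<partial>circ)"
    by (intro Bochner_Integration.integral_cong) (auto simp: power2_eq_square algebra_simps)
  also have "\<dots> = (\<integral>x. trigsum c N x * trigsum c N x \<partial>circ) + ((\<integral>x. trigsum c M x * trigsum c M x \<partial>circ) - 2 * (\<integral>x. trigsum c N x * trigsum c M x \<partial>circ))"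
    by (subst Bochner_Integration.integral_add Bochner_Integration.integral_diff; (intro Bochner_Integration.integrable_diff)?; simp add: L2_mult_integrable)+
  also have "\<dots> = 2 * pi * (psum2 c N - psum2 c M)"
    using trigsum_inner[OF c] \<open>M \<le> N\<close> by (simp add: algebra_simps)
  finally show ?thesis .
qed

lemma filterlim_sym_interval:
  "filterlim (\<lambda>N. {- int N..int N}) (finite_subsets_at_top UNIV) sequentially"
  unfolding filterlim_finite_subsets_at_top
proof (intro allI impI)
  fix X :: "int set" assume X: "finite X \<and> X \<subseteq> UNIV"
  define N where "N = nat (Max (abs ` (insert 0 X)))"
  have "\<bar>x\<bar> \<le> int N" if "x \<in> X" for x
    unfolding N_def using X that by (auto simp: Max_ge_iff intro!: disjI2 bexI[of _ x])
  then have "X \<subseteq> {- int N..int N}" by fastforce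
  moreover have "{- int N..int N} \<subseteq> {- int M..int M}" if "N \<le> M" for M using that by auto
  ultimately have "X \<subseteq> {- int M..int M}" if "N \<le> M" for M using that by blast
  then show "\<forall>\<^sub>F N in sequentially. finite {- int N..int N} \<and> X \<subseteq> {- int N..int N} \<and> {- int N..int N} \<subseteq> UNIV"
    by (auto simp: eventually_sequentially)
qed

lemma has_sum_sym_limit:
  assumes "(f has_sum S) (UNIV::int set)"
  shows "(\<lambda>N. \<Sum>n\<in>{- int N..int N}. f n) \<longlonglongrightarrow> S"
  using filterlim_compose[OF assms[unfolded has_sum_def] filterlim_sym_interval] .

lemma summable_on_sym_bounded:
  fixes f :: "int \<Rightarrow> real"
  assumes "\<And>n. 0 \<le> f n" "\<And>N. (\<Sum>n\<in>{- int N..int N}. f n) \<le> B"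
  shows "f summable_on UNIV"
proof (rule nonneg_bdd_above_summable_on)
  show "bdd_above (sum f ` {F. F \<subseteq> UNIV \<and> finite F})"
  proof (rule bdd_aboveI2)
    fix F :: "int set" assume F: "F \<in> {F. F \<subseteq> UNIV \<and> finite F}"
    then have "\<forall>\<^sub>F N in sequentially. F \<subseteq> {- int N..int N}"
      using filterlim_sym_interval unfolding filterlim_finite_subsets_at_top
      by (auto elim: eventually_mono)
    then obtain N where N: "F \<subseteq> {- int N..int N}" unfolding eventually_sequentially by blast
    show "sum f F \<le> B"
      by (rule order_trans[OF sum_mono2[OF _ N] assms(2)]) (use assms(1) in auto)
  qed
qed (use assms in auto)

text \<open>The partial sums are Cauchy in \<open>L\<^sup>1\<close>, so a subsequence converges almost everywhere. Fatou's lemma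
  transfers the \<open>L\<^sup>2\<close> distances between partial sums to the limit, which gives both membership in \<open>L\<^sup>2\<close> and the
  rate of convergence.\<close>

theorem riesz_fischer:
  assumes c: "hermitian c" and s: "(\<lambda>n. (cmod (c n))\<^sup>2) summable_on UNIV"
  obtains f where "f \<in> L2_torus" "fourier_coeff f = c"
    "(\<lambda>N. \<integral>x. (f x - trigsum c N x)\<^sup>2 \<partial>circ) \<longlonglongrightarrow> 0"
proof -
  define A where "A = (\<Sum>\<^sub>\<infinity>n. (cmod (c n))\<^sup>2)"
  have lim: "psum2 c \<longlonglongrightarrow> A"
    using has_sum_sym_limit[OF has_sum_infsum[OF s]] unfolding psum2_def A_def by simp
  have leA: "psum2 c N \<le> A" for N
    using incseq_le[OF _ lim] psum2_mono[of _ _ c] by (simp add: incseq_def)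
  let ?s = "trigsum c"
  have sd: "(\<integral>x. (?s i x - ?s j x)\<^sup>2 \<partial>circ) = 2 * pi * \<bar>psum2 c i - psum2 c j\<bar>" for i j
  proof (cases "j \<le> i")
    case True then show ?thesis using trigsum_diff[OF c True] psum2_mono[OF True] by simp
  next
    case False
    then have "i \<le> j" by simp
    then show ?thesis using trigsum_diff[OF c \<open>i \<le> j\<close>] psum2_mono[OF \<open>i \<le> j\<close>, of c] by (simp add: power2_commute)
  qed
  have L1: "(\<integral>x. norm (?s i x - ?s j x) \<partial>circ) \<le> 2 * pi * sqrt \<bar>psum2 c i - psum2 c j\<bar>" for i j
  proof -
    have "(\<integral>x. norm (?s i x - ?s j x) \<partial>circ) \<le> sqrt (\<integral>x. (?s i x - ?s j x)\<^sup>2 \<partial>circ) * sqrt (\<integral>x. 1\<^sup>2 \<partial>circ)"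
      using L2_abs_integral[OF L2_diff[of "?s i" "?s j"] const_L2[of 1]] by simp
    also have "(\<integral>x. 1\<^sup>2 \<partial>circ) = 2 * pi" by (simp add: measure_restrict_space space_restrict_space)
    also have "sqrt (\<integral>x. (?s i x - ?s j x)\<^sup>2 \<partial>circ) * sqrt (2 * pi) = 2 * pi * sqrt \<bar>psum2 c i - psum2 c j\<bar>"
    proof -
      have "sqrt (2 * pi * y) * sqrt (2 * pi) = (sqrt (2 * pi) * sqrt (2 * pi)) * sqrt y" for y
        by (simp only: real_sqrt_mult mult_ac)
      then show ?thesis unfolding sd by (simp only: real_sqrt_mult_self) simp
    qed
    finally show ?thesis .
  qed
  have cau: "\<exists>N. \<forall>i\<ge>N. \<forall>j\<ge>N. (\<integral>x. norm (?s i x - ?s j x) \<partial>circ) < e" if e: "e > 0" for e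
  proof -
    have "Cauchy (psum2 c)" using lim by (simp add: LIMSEQ_imp_Cauchy)
    moreover have "0 < (e / (2*pi))\<^sup>2" using e by simp
    ultimately obtain N where N: "\<And>i j. i \<ge> N \<Longrightarrow> j \<ge> N \<Longrightarrow> \<bar>psum2 c i - psum2 c j\<bar> < (e / (2*pi))\<^sup>2"
      unfolding Cauchy_def dist_real_def by blast
    have "(\<integral>x. norm (?s i x - ?s j x) \<partial>circ) < e" if "i \<ge> N" "j \<ge> N" for i j
    proof -
      have "sqrt \<bar>psum2 c i - psum2 c j\<bar> < e / (2*pi)"
        using N[OF that] e by (intro real_less_lsqrt) auto
      then have "2 * pi * sqrt \<bar>psum2 c i - psum2 c j\<bar> < e" by (simp add: field_simps)
      with L1[of i j] show ?thesis by linarith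
    qed
    then show ?thesis by blast
  qed
  obtain r where r: "strict_mono r" and ae: "AE x in circ. Cauchy (\<lambda>i. ?s (r i) x)"
    using cauchy_L1_AE_cauchy_subseq[of circ ?s, OF L2_integrable[OF trigsum_L2] cau] by blast
  define f where "f x = lim (\<lambda>k. ?s (r k) x)" for x
  have sm[measurable]: "?s N \<in> borel_measurable borel" for N using L2_torusD(2)[OF trigsum_L2] .
  have fm[measurable]: "f \<in> borel_measurable borel" unfolding f_def by measurable
  have fp: "torus_periodic f"
    using L2_torusD(1)[OF trigsum_L2[of c]] unfolding f_def torus_periodic_def by simp
  have aef: "AE x in circ. (\<lambda>k. ?s (r k) x) \<longlonglongrightarrow> f x"
    using ae by eventually_elim (simp add: f_def convergent_LIMSEQ_iff[symmetric] Cauchy_convergent_iff)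
  have smc[measurable]: "?s N \<in> borel_measurable circ" for N by (intro circ_measurable sm)
  have fmc[measurable]: "f \<in> borel_measurable circ" by (intro circ_measurable fm)
  have fatou: "(\<integral>\<^sup>+x. ennreal ((f x - ?s j x)\<^sup>2) \<partial>circ) \<le> ennreal (2 * pi * (A - psum2 c j))" for j
  proof -
    have "(\<integral>\<^sup>+x. ennreal ((f x - ?s j x)\<^sup>2) \<partial>circ) = (\<integral>\<^sup>+x. liminf (\<lambda>k. ennreal ((?s (r k) x - ?s j x)\<^sup>2)) \<partial>circ)"
    proof (rule nn_integral_cong_AE, use aef in eventually_elim)
      case (elim x)
      have "(\<lambda>k. ennreal ((?s (r k) x - ?s j x)\<^sup>2)) \<longlonglongrightarrow> ennreal ((f x - ?s j x)\<^sup>2)"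
        by (intro tendsto_intros elim)
      then show ?case using lim_imp_Liminf sequentially_bot by metis
    qed
    also have "\<dots> \<le> liminf (\<lambda>k. (\<integral>\<^sup>+x. ennreal ((?s (r k) x - ?s j x)\<^sup>2) \<partial>circ))"
      by (rule nn_integral_liminf) measurable
    also have "\<dots> \<le> limsup (\<lambda>k. (\<integral>\<^sup>+x. ennreal ((?s (r k) x - ?s j x)\<^sup>2) \<partial>circ))"
      by (rule Liminf_le_Limsup) simp
    also have "\<dots> \<le> ennreal (2 * pi * (A - psum2 c j))"
    proof (rule Limsup_bounded)
      show "\<forall>\<^sub>F k in sequentially. (\<integral>\<^sup>+x. ennreal ((?s (r k) x - ?s j x)\<^sup>2) \<partial>circ) \<le> ennreal (2 * pi * (A - psum2 c j))"
        using eventually_ge_at_top[of j]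
      proof eventually_elim
        case (elim k)
        have "j \<le> r k" using seq_suble[OF r, of k] elim by simp
        have "(\<integral>\<^sup>+x. ennreal ((?s (r k) x - ?s j x)\<^sup>2) \<partial>circ) = ennreal (\<integral>x. (?s (r k) x - ?s j x)\<^sup>2 \<partial>circ)"
          using L2_torusD(4)[OF L2_diff[OF trigsum_L2 trigsum_L2]] by (intro nn_integral_eq_integral) auto
        also have "\<dots> \<le> ennreal (2 * pi * (A - psum2 c j))"
          unfolding sd using psum2_mono[OF \<open>j \<le> r k\<close>, of c] leA[of "r k"] by (intro ennreal_leI) simp
        finally show ?case .
      qed
    qed
    finally show ?thesis .
  qed
  have dL2: "(\<lambda>x. f x - ?s j x) \<in> L2_torus" for j
  proof -
    have "integrable circ (\<lambda>x. (f x - ?s j x)\<^sup>2)"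
      by (rule integrableI_bounded) (use fatou[of j] in \<open>auto simp: less_top[symmetric] top_unique\<close>)
    then show ?thesis
      using fp L2_torusD(1)[OF trigsum_L2[of c j]] by (simp add: L2_torus_iff torus_periodic_def)
  qed
  have bd: "(\<integral>x. (f x - ?s j x)\<^sup>2 \<partial>circ) \<le> 2 * pi * (A - psum2 c j)" for j
  proof -
    have "ennreal (\<integral>x. (f x - ?s j x)\<^sup>2 \<partial>circ) \<le> ennreal (2 * pi * (A - psum2 c j))"
      using fatou[of j] L2_torusD(4)[OF dL2[of j]] by (subst nn_integral_eq_integral[symmetric]) auto
    then show ?thesis using leA[of j] by (subst (asm) ennreal_le_iff) auto
  qed
  have fL2: "f \<in> L2_torus" using L2_lincomb[OF dL2[of 0] trigsum_L2[of c 0], of 1 1] by simp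
  have conv: "(\<lambda>N. \<integral>x. (f x - ?s N x)\<^sup>2 \<partial>circ) \<longlonglongrightarrow> 0"
  proof (rule tendsto_sandwich[OF _ _ tendsto_const])
    show "\<forall>\<^sub>F N in sequentially. (\<integral>x. (f x - ?s N x)\<^sup>2 \<partial>circ) \<le> 2 * pi * (A - psum2 c N)" using bd by simp
    have "(\<lambda>N. 2 * pi * (A - psum2 c N)) \<longlonglongrightarrow> 2 * pi * (A - A)" by (intro tendsto_intros lim)
    then show "(\<lambda>N. 2 * pi * (A - psum2 c N)) \<longlonglongrightarrow> 0" by simp
  qed simp
  have "fourier_coeff f n = c n" for n
  proof -
    have "(\<lambda>N. sqrt (\<integral>x. (f x - ?s N x)\<^sup>2 \<partial>circ) * sqrt (\<integral>x. 1\<^sup>2 \<partial>circ) / (2 * pi)) \<longlonglongrightarrow> sqrt 0 * sqrt (\<integral>x. 1\<^sup>2 \<partial>circ) / (2 * pi)"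
      by (intro tendsto_intros conv) simp
    then have z: "(\<lambda>N. sqrt (\<integral>x. (f x - ?s N x)\<^sup>2 \<partial>circ) * sqrt (\<integral>x. 1\<^sup>2 \<partial>circ) / (2 * pi)) \<longlonglongrightarrow> 0" by simp
    have "(\<lambda>N. fourier_coeff (\<lambda>x. f x - ?s N x) n) \<longlonglongrightarrow> 0"
      by (rule Lim_null_comparison[OF _ z], rule always_eventually, rule allI)
         (use fourier_coeff_mult_bound[OF dL2 const_L2[of 1]] in simp)
    moreover have "fourier_coeff (\<lambda>x. f x - ?s N x) n = fourier_coeff f n - fourier_coeff (?s N) n" for N
      using fourier_coeff_lincomb[OF L2_integrable[OF fL2] L2_integrable[OF trigsum_L2[of c N]], of 1 "-1" n] by simp
    ultimately have "(\<lambda>N. fourier_coeff f n - fourier_coeff (?s N) n) \<longlonglongrightarrow> 0" by simp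
    moreover have "\<forall>\<^sub>F N in sequentially. fourier_coeff f n - fourier_coeff (?s N) n = fourier_coeff f n - c n"
      using eventually_ge_at_top[of "nat \<bar>n\<bar>"] by eventually_elim (auto simp: fourier_coeff_trigsum[OF c])
    ultimately have "(\<lambda>N. fourier_coeff f n - c n) \<longlonglongrightarrow> 0"
      using tendsto_cong by fast
    then show ?thesis by (simp add: LIMSEQ_const_iff)
  qed
  then show thesis using that[OF fL2 _ conv] by blast
qed

text \<open>Cauchy--Schwarz for \<open>f\<close> and its own partial sum: both \<open>\<integral> f S\<close> and \<open>\<integral> S\<^sup>2\<close> equal
  \<open>2 pi\<close> times the sum of the squared coefficients.\<close>

lemma bessel:
  assumes f: "f \<in> L2_torus"
  shows "(\<lambda>n. (cmod (fourier_coeff f n))\<^sup>2) summable_on UNIV"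
proof (rule summable_on_sym_bounded)
  fix N
  let ?c = "fourier_coeff f"
  have h: "hermitian ?c" by (rule hermitian_fourier_coeff)
  let ?s = "trigsum ?c N"
  have "complex_of_real (\<integral>x. f x * ?s x \<partial>circ) = of_real (2 * pi) * (\<Sum>n\<in>{- int N..int N}. ?c n * cnj (?c n))"
    by (rule integral_mult_trigsum_0[OF L2_integrable[OF f] h])
  also have "\<dots> = of_real (2 * pi * psum2 ?c N)"
    by (simp add: psum2_def complex_norm_square[symmetric])
  finally have 1: "(\<integral>x. f x * ?s x \<partial>circ) = 2 * pi * psum2 ?c N" by (simp only: of_real_eq_iff)
  have 2: "(\<integral>x. (?s x)\<^sup>2 \<partial>circ) = 2 * pi * psum2 ?c N"
    using trigsum_inner[OF h, of N N] by (simp add: power2_eq_square)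
  have "(2 * pi * psum2 ?c N)\<^sup>2 \<le> (\<integral>x. (f x)\<^sup>2 \<partial>circ) * (2 * pi * psum2 ?c N)"
    using L2_CS[OF f trigsum_L2[of ?c N]] unfolding 1 2 .
  moreover have "0 \<le> psum2 ?c N" unfolding psum2_def by (intro sum_nonneg) simp
  moreover have "0 \<le> (\<integral>x. (f x)\<^sup>2 \<partial>circ)" by simp
  ultimately have "2 * pi * psum2 ?c N \<le> (\<integral>x. (f x)\<^sup>2 \<partial>circ)"
  proof (cases "psum2 ?c N = 0")
    case False
    with \<open>0 \<le> psum2 ?c N\<close> have "0 < 2 * pi * psum2 ?c N" by simp
    then show ?thesis
      using \<open>(2 * pi * psum2 ?c N)\<^sup>2 \<le> _\<close> unfolding power2_eq_square[of "2 * pi * psum2 ?c N"]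
      by (rule mult_right_le_imp_le[rotated])
  qed simp
  note le = this
  have "2 * pi * p \<le> I \<Longrightarrow> p \<le> I / (2 * pi)" for p I :: real by (simp add: field_simps)
  from this[OF le] have "psum2 ?c N \<le> (\<integral>x. (f x)\<^sup>2 \<partial>circ) / (2 * pi)" .
  then show "(\<Sum>n\<in>{- int N..int N}. (cmod (?c n))\<^sup>2) \<le> (\<integral>x. (f x)\<^sup>2 \<partial>circ) / (2 * pi)"
    unfolding psum2_def .
qed simp

text \<open>By Riesz--Fischer the partial sums converge to some function with the same coefficients, which is
  \<open>f\<close> by uniqueness.\<close>

lemma trigsum_tendsto:
  assumes f: "f \<in> L2_torus"
  shows "(\<lambda>N. \<integral>x. (f x - trigsum (fourier_coeff f) N x)\<^sup>2 \<partial>circ) \<longlonglongrightarrow> 0"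
proof -
  let ?c = "fourier_coeff f"
  obtain g where g: "g \<in> L2_torus" "fourier_coeff g = ?c"
    "(\<lambda>N. \<integral>x. (g x - trigsum ?c N x)\<^sup>2 \<partial>circ) \<longlonglongrightarrow> 0"
    by (rule riesz_fischer[OF hermitian_fourier_coeff bessel[OF f]])
  have "AE x in lborel. g x = f x" by (rule fourier_unique[OF g(1) f]) (simp add: g(2))
  then have ae: "AE x in circ. g x = f x" by (subst AE_restrict_space_iff) (auto elim: eventually_mono)
  note [measurable] = L2_torusD(3)[OF f] L2_torusD(3)[OF g(1)] L2_torusD(3)[OF trigsum_L2]
  have "(\<integral>x. (g x - trigsum ?c N x)\<^sup>2 \<partial>circ) = (\<integral>x. (f x - trigsum ?c N x)\<^sup>2 \<partial>circ)" for N
    by (rule integral_cong_AE) (use ae in \<open>measurable, auto\<close>)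
  then show ?thesis using g(3) by simp
qed

lemma summable_on_mult_l2:
  fixes c d :: "int \<Rightarrow> complex"
  assumes "(\<lambda>n. (cmod (c n))\<^sup>2) summable_on UNIV" "(\<lambda>n. (cmod (d n))\<^sup>2) summable_on UNIV"
  shows "(\<lambda>k. cmod (c k) * cmod (d (n - k))) summable_on UNIV"
proof (rule summable_on_comparison_test[where f="\<lambda>k. (cmod (c k))\<^sup>2 + (cmod (d (n - k)))\<^sup>2"])
  have "(\<lambda>k. (cmod (d (n - k)))\<^sup>2) summable_on UNIV"
    using summable_on_reindex_bij_betw[of "\<lambda>k. n - k" UNIV UNIV "\<lambda>n. (cmod (d n))\<^sup>2"] assms(2)
    by (simp add: bij_betw_byWitness[where f'="\<lambda>k. n - k"])
  then show "(\<lambda>k. (cmod (c k))\<^sup>2 + (cmod (d (n - k)))\<^sup>2) summable_on UNIV"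
    using assms(1) by (intro summable_on_add)
  fix k
  show "cmod (c k) * cmod (d (n - k)) \<le> (cmod (c k))\<^sup>2 + (cmod (d (n - k)))\<^sup>2"
    using sum_squares_bound[of "cmod (c k)" "cmod (d (n - k))"] mult_nonneg_nonneg[OF norm_ge_zero[of "c k"] norm_ge_zero[of "d (n - k)"]] by linarith
qed simp

text \<open>For a trigonometric polynomial in place of \<open>f\<close> the convolution formula is a finite computation. Both
  sides pass to the limit: the left by \<open>L\<^sup>2\<close> convergence of the partial sums, the right by absolute summability.\<close>

theorem fourier_coeff_mult:
  assumes f: "f \<in> L2_torus" and g: "g \<in> L2_torus"
  shows "fourier_coeff (\<lambda>x. f x * g x) n = (\<Sum>\<^sub>\<infinity>k. fourier_coeff f k * fourier_coeff g (n - k))"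
proof -
  let ?c = "fourier_coeff f"
  have "(\<lambda>k. cmod (?c k) * cmod (fourier_coeff g (n - k))) summable_on UNIV"
    by (rule summable_on_mult_l2[OF bessel[OF f] bessel[OF g]])
  then have "(\<lambda>k. norm (?c k * fourier_coeff g (n - k))) summable_on UNIV"
    by (simp only: norm_mult)
  from abs_summable_summable[OF this] have "(\<lambda>k. ?c k * fourier_coeff g (n - k)) summable_on UNIV" .
  then have 1: "(\<lambda>N. \<Sum>k\<in>{- int N..int N}. ?c k * fourier_coeff g (n - k)) \<longlonglongrightarrow> (\<Sum>\<^sub>\<infinity>k. ?c k * fourier_coeff g (n - k))"
    by (intro has_sum_sym_limit has_sum_infsum)
  have d: "(\<lambda>x. f x - trigsum ?c N x) \<in> L2_torus" for N by (intro L2_diff f trigsum_L2)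
  have "(\<lambda>N. sqrt (\<integral>x. (f x - trigsum ?c N x)\<^sup>2 \<partial>circ) * sqrt (\<integral>x. (g x)\<^sup>2 \<partial>circ) / (2 * pi)) \<longlonglongrightarrow> sqrt 0 * sqrt (\<integral>x. (g x)\<^sup>2 \<partial>circ) / (2 * pi)"
    by (intro tendsto_intros trigsum_tendsto f) simp
  then have z: "(\<lambda>N. sqrt (\<integral>x. (f x - trigsum ?c N x)\<^sup>2 \<partial>circ) * sqrt (\<integral>x. (g x)\<^sup>2 \<partial>circ) / (2 * pi)) \<longlonglongrightarrow> 0" by simp
  have "(\<lambda>N. fourier_coeff (\<lambda>x. (f x - trigsum ?c N x) * g x) n) \<longlonglongrightarrow> 0"
    by (rule Lim_null_comparison[OF _ z], rule always_eventually, rule allI, rule fourier_coeff_mult_bound[OF d g])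
  moreover have "fourier_coeff (\<lambda>x. (f x - trigsum ?c N x) * g x) n = fourier_coeff (\<lambda>x. f x * g x) n - (\<Sum>k\<in>{- int N..int N}. ?c k * fourier_coeff g (n - k))" for N
  proof -
    have "fourier_coeff (\<lambda>x. 1 * (f x * g x) + (-1) * (g x * trigsum ?c N x)) n = fourier_coeff (\<lambda>x. f x * g x) n - fourier_coeff (\<lambda>x. g x * trigsum ?c N x) n"
      by (subst fourier_coeff_lincomb) (auto intro: L2_mult_integrable f g)
    then show ?thesis
      using integral_mult_trigsum[OF L2_integrable[OF g] hermitian_fourier_coeff, of f N n] by (simp add: algebra_simps)
  qed
  ultimately have "(\<lambda>N. fourier_coeff (\<lambda>x. f x * g x) n - (\<Sum>k\<in>{- int N..int N}. ?c k * fourier_coeff g (n - k))) \<longlonglongrightarrow> 0" by simp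
  from tendsto_diff[OF tendsto_const[of "fourier_coeff (\<lambda>x. f x * g x) n"] this]
  have "(\<lambda>N. \<Sum>k\<in>{- int N..int N}. ?c k * fourier_coeff g (n - k)) \<longlonglongrightarrow> fourier_coeff (\<lambda>x. f x * g x) n" by simp
  then show ?thesis using 1 LIMSEQ_unique by blast
qed

section \<open>Hermitian square summable sequences\<close>

text \<open>A complex sequence is the coefficient sequence of a real-valued function exactly if it is Hermitian. The Hermitian
  sequences form a real, not a complex, Hilbert space, with inner product the sum of the real inner products in
  \<open>complex\<close>. One space serves all Sobolev spaces: the exponent \<open>s\<close> enters only through the embedding
  \<open>emb s\<close>.\<close>

typedef hl2 = "{c. hermitian c \<and> (\<lambda>n. (cmod (c n))\<^sup>2) summable_on UNIV}"
  morphisms cf Hl2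
  by (rule exI[of _ "\<lambda>_. 0"]) (simp add: hermitian_def)

definition l2 :: "(int \<Rightarrow> complex) \<Rightarrow> bool" where
  "l2 c \<longleftrightarrow> (\<lambda>n. (cmod (c n))\<^sup>2) summable_on UNIV"

lemma cf_hermitian: "hermitian (cf x)" and cf_l2: "l2 (cf x)"
  using cf[of x] by (auto simp: l2_def)

lemma cf_Hl2: "hermitian c \<Longrightarrow> l2 c \<Longrightarrow> cf (Hl2 c) = c"
  by (rule Hl2_inverse) (simp add: l2_def)

lemma hl2_eqI: "(\<And>n. cf x n = cf y n) \<Longrightarrow> x = y"
  by (simp add: cf_inject[symmetric] ext)

lemma l2_mono:
  assumes "(\<lambda>n. (g n)\<^sup>2) summable_on (UNIV :: int set)" "\<And>n. cmod (c n) \<le> g n"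
  shows "l2 c"
  unfolding l2_def
  by (rule summable_on_comparison_test[OF assms(1)]) (auto intro!: power_mono assms(2))

lemma l2_add:
  assumes "l2 c" "l2 d" shows "l2 (\<lambda>n. c n + d n)"
  unfolding l2_def
proof (rule summable_on_comparison_test)
  show "(\<lambda>n. 2 * (cmod (c n))\<^sup>2 + 2 * (cmod (d n))\<^sup>2) summable_on UNIV"
    using assms unfolding l2_def by (intro summable_on_add summable_on_cmult_right)
  fix n
  have "(cmod (c n + d n))\<^sup>2 \<le> (cmod (c n) + cmod (d n))\<^sup>2"
    by (intro power_mono norm_triangle_ineq) simp
  also have "\<dots> \<le> 2 * (cmod (c n))\<^sup>2 + 2 * (cmod (d n))\<^sup>2"
    using sum_squares_bound[of "cmod (c n)" "cmod (d n)"] by (simp add: power2_sum)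
  finally show "(cmod (c n + d n))\<^sup>2 \<le> 2 * (cmod (c n))\<^sup>2 + 2 * (cmod (d n))\<^sup>2" .
qed simp

lemma l2_bounded_mult:
  assumes "l2 c" "\<And>n. cmod (\<mu> n) \<le> C" shows "l2 (\<lambda>n. \<mu> n * c n)"
proof (rule l2_mono)
  show "(\<lambda>n. (C * cmod (c n))\<^sup>2) summable_on UNIV"
    using assms(1) unfolding l2_def power_mult_distrib by (rule summable_on_cmult_right)
qed (simp add: norm_mult mult_right_mono assms)

lemma l2_scale: "l2 c \<Longrightarrow> l2 (\<lambda>n. a * c n)"
  by (rule l2_bounded_mult[of c "\<lambda>_. a" "cmod a"]) auto

lemma l2_inner_summable:
  assumes "l2 c" "l2 d" shows "(\<lambda>n. norm (inner (c n) (d n))) summable_on UNIV"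
proof (rule summable_on_comparison_test)
  show "(\<lambda>n. (cmod (c n))\<^sup>2 + (cmod (d n))\<^sup>2) summable_on UNIV"
    using assms unfolding l2_def by (intro summable_on_add)
  fix n
  have "norm (inner (c n) (d n)) \<le> cmod (c n) * cmod (d n)" by (simp add: Cauchy_Schwarz_ineq2)
  also have "\<dots> \<le> (cmod (c n))\<^sup>2 + (cmod (d n))\<^sup>2"
    using sum_squares_bound[of "cmod (c n)" "cmod (d n)"] mult_nonneg_nonneg[OF norm_ge_zero[of "c n"] norm_ge_zero[of "d n"]] by linarith
  finally show "norm (inner (c n) (d n)) \<le> (cmod (c n))\<^sup>2 + (cmod (d n))\<^sup>2" .
qed simp

lemma hermitian_add: "hermitian c \<Longrightarrow> hermitian d \<Longrightarrow> hermitian (\<lambda>n. c n + d n)"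
  and hermitian_mult: "hermitian c \<Longrightarrow> hermitian d \<Longrightarrow> hermitian (\<lambda>n. c n * d n)"
  and hermitian_uminus: "hermitian c \<Longrightarrow> hermitian (\<lambda>n. - c n)"
  and hermitian_scaleR: "hermitian c \<Longrightarrow> hermitian (\<lambda>n. complex_of_real r * c n)"
  and hermitian_0: "hermitian (\<lambda>n. 0)"
  by (auto simp: hermitian_def)

instantiation hl2 :: real_inner
begin

definition "0 = Hl2 (\<lambda>_. 0)"
definition "x + y = Hl2 (\<lambda>n. cf x n + cf y n)"
definition "- x = Hl2 (\<lambda>n. - cf x n)"
definition "x - y = x + (- y :: hl2)"
definition "r *\<^sub>R x = Hl2 (\<lambda>n. complex_of_real r * cf x n)"
definition "inner x y = (\<Sum>\<^sub>\<infinity>n. inner (cf x n) (cf y n))"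
definition "norm (x::hl2) = sqrt (inner x x)"
definition "dist x y = norm (x - y :: hl2)"
definition "sgn (x::hl2) = inverse (norm x) *\<^sub>R x"
definition uniformity_hl2 :: "(hl2 \<times> hl2) filter" where
  "uniformity_hl2 = (INF e\<in>{0<..}. principal {(x, y). dist x y < e})"
definition open_hl2 :: "hl2 set \<Rightarrow> bool" where
  "open_hl2 U \<longleftrightarrow> (\<forall>x\<in>U. \<forall>\<^sub>F (x', y) in uniformity. x' = x \<longrightarrow> y \<in> U)"

lemma cf_0 [simp]: "cf 0 n = 0"
  by (simp add: zero_hl2_def cf_Hl2 hermitian_0 l2_def)

lemma cf_add [simp]: "cf (x + y) n = cf x n + cf y n"
  by (simp add: plus_hl2_def cf_Hl2 hermitian_add l2_add cf_hermitian cf_l2)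

lemma cf_uminus [simp]: "cf (- x) n = - cf x n"
  using l2_scale[OF cf_l2[of x], of "-1"]
  by (simp add: uminus_hl2_def cf_Hl2 hermitian_uminus cf_hermitian)

lemma cf_minus [simp]: "cf (x - y) n = cf x n - cf y n"
  by (simp add: minus_hl2_def)

lemma cf_scaleR [simp]: "cf (r *\<^sub>R x) n = complex_of_real r * cf x n"
  by (simp add: scaleR_hl2_def cf_Hl2 hermitian_scaleR l2_scale cf_hermitian cf_l2)

lemma cf_inner_summable: "(\<lambda>n. inner (cf x n) (cf y n)) summable_on UNIV"
  using abs_summable_summable[OF l2_inner_summable[OF cf_l2[of x] cf_l2[of y]]] .

instance
proof
  fix x y z :: hl2 and r s :: real
  show "x + y + z = x + (y + z)" "x + y = y + x" "0 + x = x" "- x + x = 0" "x - y = x + - y"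
    "r *\<^sub>R (x + y) = r *\<^sub>R x + r *\<^sub>R y" "(r + s) *\<^sub>R x = r *\<^sub>R x + s *\<^sub>R x" "r *\<^sub>R s *\<^sub>R x = (r * s) *\<^sub>R x" "1 *\<^sub>R x = x"
    by (rule hl2_eqI; simp add: algebra_simps)+
  show "dist x y = norm (x - y)" "sgn x = inverse (norm x) *\<^sub>R x" "norm x = sqrt (inner x x)"
    by (simp_all add: dist_hl2_def sgn_hl2_def norm_hl2_def)
  show "(uniformity :: (hl2 \<times> hl2) filter) = (INF e\<in>{0<..}. principal {(x, y). dist x y < e})"
    by (rule uniformity_hl2_def)
  show "open U = (\<forall>x\<in>U. \<forall>\<^sub>F (x', y) in uniformity. x' = x \<longrightarrow> y \<in> U)" for U :: "hl2 set"
    by (rule open_hl2_def)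
  show "inner x y = inner y x" by (simp add: inner_hl2_def inner_commute)
  show "inner (x + y) z = inner x z + inner y z"
    unfolding inner_hl2_def by (simp add: inner_add_left infsum_add[OF cf_inner_summable cf_inner_summable])
  show "inner (r *\<^sub>R x) y = r * inner x y"
  proof -
    have "inner (complex_of_real r * a) b = r * inner a b" for a b :: complex
      by (simp add: inner_complex_def algebra_simps)
    then show ?thesis unfolding inner_hl2_def by (simp add: infsum_cmult_right')
  qed
  show "0 \<le> inner x x" unfolding inner_hl2_def by (intro infsum_nonneg) simp
  show "(inner x x = 0) = (x = 0)"
  proof
    assume "inner x x = 0"
    then have "inner (cf x n) (cf x n) = 0" for n
      unfolding inner_hl2_def using nonneg_infsum_le_0D[OF _ cf_inner_summable[of x x], of n] by simp
    then show "x = 0" by (intro hl2_eqI) simp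
  next
    assume "x = 0"
    then show "inner x x = 0" by (simp add: inner_hl2_def)
  qed
qed

end

lemma norm_hl2_sq: "(norm x)\<^sup>2 = (\<Sum>\<^sub>\<infinity>n. (cmod (cf x n))\<^sup>2)"
  by (simp add: power2_norm_eq_inner inner_hl2_def)

lemma cf_sq_sum_le: "finite F \<Longrightarrow> (\<Sum>n\<in>F. (cmod (cf x n))\<^sup>2) \<le> (norm x)\<^sup>2"
  unfolding norm_hl2_sq using cf_l2[of x] by (intro finite_sum_le_infsum) (auto simp: l2_def)

lemma cf_le_norm: "cmod (cf x n) \<le> norm x"
  using cf_sq_sum_le[of "{n}" x] by (simp add: abs_le_square_iff[symmetric])

lemma norm_hl2_leI:
  assumes "\<And>F. finite F \<Longrightarrow> (\<Sum>n\<in>F. (cmod (cf x n))\<^sup>2) \<le> B\<^sup>2" "0 \<le> B"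
  shows "norm x \<le> B"
proof -
  have "(norm x)\<^sup>2 \<le> B\<^sup>2"
    unfolding norm_hl2_sq using cf_l2[of x] assms(1) by (intro infsum_le_finite_sums) (auto simp: l2_def)
  then show ?thesis using assms(2) by (simp add: abs_le_square_iff[symmetric])
qed

lemma bounded_linear_cf: "bounded_linear (\<lambda>x. cf x n)"
  by (rule bounded_linear_intro[where K=1]) (auto simp: scaleR_conv_of_real cf_le_norm)

instance hl2 :: complete_space
proof
  fix X :: "nat \<Rightarrow> hl2" assume X: "Cauchy X"
  have "Cauchy (\<lambda>i. cf (X i) n)" for n
    by (rule bounded_linear.Cauchy[OF bounded_linear_cf X])
  then have "\<exists>l. (\<lambda>i. cf (X i) n) \<longlonglongrightarrow> l" for n using Cauchy_convergent convergent_def by blast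
  then obtain c where c: "\<And>n. (\<lambda>i. cf (X i) n) \<longlonglongrightarrow> c n" by metis
  have h: "hermitian c"
    unfolding hermitian_def
  proof
    fix n
    have "(\<lambda>i. cf (X i) (- n)) \<longlonglongrightarrow> cnj (c n)"
      using tendsto_cnj[OF c[of n]] by (simp add: hermitianD[OF cf_hermitian])
    then show "c (- n) = cnj (c n)" using c LIMSEQ_unique by blast
  qed
  have bd: "\<exists>N. \<forall>m\<ge>N. \<forall>F. finite F \<longrightarrow> (\<Sum>n\<in>F. (cmod (cf (X m) n - c n))\<^sup>2) \<le> e\<^sup>2" if e: "e > 0" for e
  proof -
    obtain N where N: "\<And>m k. m \<ge> N \<Longrightarrow> k \<ge> N \<Longrightarrow> norm (X m - X k) < e"
      using X e unfolding Cauchy_def dist_norm by blast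
    have "(\<Sum>n\<in>F. (cmod (cf (X m) n - c n))\<^sup>2) \<le> e\<^sup>2" if m: "m \<ge> N" and F: "finite F" for m F
    proof (rule LIMSEQ_le_const2)
      show "(\<lambda>k. \<Sum>n\<in>F. (cmod (cf (X m) n - cf (X k) n))\<^sup>2) \<longlonglongrightarrow> (\<Sum>n\<in>F. (cmod (cf (X m) n - c n))\<^sup>2)"
        by (intro tendsto_intros c)
      show "\<exists>N'. \<forall>k\<ge>N'. (\<Sum>n\<in>F. (cmod (cf (X m) n - cf (X k) n))\<^sup>2) \<le> e\<^sup>2"
      proof (intro exI allI impI)
        fix k assume "k \<ge> N"
        have "(\<Sum>n\<in>F. (cmod (cf (X m) n - cf (X k) n))\<^sup>2) \<le> (norm (X m - X k))\<^sup>2"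
          using cf_sq_sum_le[OF F, of "X m - X k"] by simp
        also have "\<dots> \<le> e\<^sup>2" using N[OF m \<open>k \<ge> N\<close>] by (intro power_mono) auto
        finally show "(\<Sum>n\<in>F. (cmod (cf (X m) n - cf (X k) n))\<^sup>2) \<le> e\<^sup>2" .
      qed
    qed
    then show ?thesis by blast
  qed
  have "l2 c"
  proof -
    obtain N where N: "\<And>F. finite F \<Longrightarrow> (\<Sum>n\<in>F. (cmod (cf (X N) n - c n))\<^sup>2) \<le> 1"
      using bd[of 1] by auto
    have "(\<lambda>n. (cmod (c n - cf (X N) n))\<^sup>2) summable_on UNIV"
      using N by (intro nonneg_bdd_above_summable_on bdd_aboveI2[where M=1]) (auto simp: norm_minus_commute)
    then have "l2 (\<lambda>n. c n - cf (X N) n)" by (simp add: l2_def)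
    then show ?thesis using l2_add[OF _ cf_l2[of "X N"]] by fastforce
  qed
  have "X \<longlonglongrightarrow> Hl2 c"
  proof (rule LIMSEQ_I)
    fix e :: real assume e: "e > 0"
    obtain N where N: "\<And>m F. m \<ge> N \<Longrightarrow> finite F \<Longrightarrow> (\<Sum>n\<in>F. (cmod (cf (X m) n - c n))\<^sup>2) \<le> (e/2)\<^sup>2"
      using bd[of "e/2"] e by auto
    have "norm (X m - Hl2 c) < e" if "m \<ge> N" for m
    proof -
      have "norm (X m - Hl2 c) \<le> e/2"
        using N[OF that] e by (intro norm_hl2_leI) (auto simp: cf_Hl2[OF h \<open>l2 c\<close>])
      then show ?thesis using e by simp
    qed
    then show "\<exists>N. \<forall>m\<ge>N. norm (X m - Hl2 c) < e" by blast
  qed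
  then show "convergent X" by (rule convergentI)
qed

instance hl2 :: banach ..

definition mul :: "(int \<Rightarrow> complex) \<Rightarrow> hl2 \<Rightarrow> hl2" where
  "mul \<mu> x = Hl2 (\<lambda>n. \<mu> n * cf x n)"

text \<open>The Hermitian condition keeps the sequences in \<open>hl2\<close>; the explicit bound \<open>C\<close> is the operator
  norm estimate.\<close>

definition multiplier :: "real \<Rightarrow> (int \<Rightarrow> complex) \<Rightarrow> bool" where
  "multiplier C \<mu> \<longleftrightarrow> hermitian \<mu> \<and> (\<forall>n. cmod (\<mu> n) \<le> C)"

lemma cf_mul:
  assumes "multiplier C \<mu>" shows "cf (mul \<mu> x) n = \<mu> n * cf x n"
  using assms l2_bounded_mult[OF cf_l2, of \<mu> C x] unfolding mul_def multiplier_def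
  by (simp add: cf_Hl2 hermitian_mult cf_hermitian)

lemma norm_hl2_le_scaled:
  assumes "\<And>n. cmod (cf x n) \<le> C * cmod (cf y n)" "0 \<le> C"
  shows "norm x \<le> C * norm y"
proof (rule norm_hl2_leI)
  fix F :: "int set" assume F: "finite F"
  have "(\<Sum>n\<in>F. (cmod (cf x n))\<^sup>2) \<le> (\<Sum>n\<in>F. C\<^sup>2 * (cmod (cf y n))\<^sup>2)"
    by (intro sum_mono) (metis assms(1) norm_ge_zero power_mono power_mult_distrib)
  also have "\<dots> \<le> (C * norm y)\<^sup>2"
    using mult_left_mono[OF cf_sq_sum_le[OF F, of y], of "C\<^sup>2"] by (simp add: sum_distrib_left power_mult_distrib)
  finally show "(\<Sum>n\<in>F. (cmod (cf x n))\<^sup>2) \<le> (C * norm y)\<^sup>2" .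
qed (use assms in simp)

lemma multiplier_nonneg: "multiplier C \<mu> \<Longrightarrow> 0 \<le> C"
  unfolding multiplier_def using norm_ge_zero order_trans by blast

lemma norm_mul_le: "multiplier C \<mu> \<Longrightarrow> norm (mul \<mu> x) \<le> C * norm x"
  by (intro norm_hl2_le_scaled) (auto simp: cf_mul norm_mult multiplier_nonneg, simp add: multiplier_def mult_right_mono)

lemma bounded_linear_mul: 
  assumes "multiplier C \<mu>" shows "bounded_linear (mul \<mu>)"
proof (rule bounded_linear_intro)
  show "mul \<mu> (x + y) = mul \<mu> x + mul \<mu> y" "mul \<mu> (r *\<^sub>R x) = r *\<^sub>R mul \<mu> x" for x y r
    by (rule hl2_eqI, simp add: cf_mul[OF assms] algebra_simps)+
  show "norm (mul \<mu> x) \<le> norm x * C" for x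
    using norm_mul_le[OF assms, of x] by (simp add: mult.commute)
qed

text \<open>The square of \<open>weight s\<close> is the weight \<open>(1 + n\<^sup>2) powr s\<close> of the \<open>H\<^sup>s\<close> norm.\<close>

definition weight :: "real \<Rightarrow> int \<Rightarrow> real" where
  "weight s n = (1 + (real_of_int n)\<^sup>2) powr (s / 2)"

lemma one_plus_sq_pos [simp]: "0 < 1 + (real_of_int n)\<^sup>2"
  by (simp add: add_pos_nonneg)

lemma weight_pos [simp]: "0 < weight s n" and weight_nonneg [simp]: "0 \<le> weight s n" and weight_0 [simp]: "weight 0 n = 1"
  and weight_minus [simp]: "weight s (- n) = weight s n"
  using one_plus_sq_pos[of n] by (simp_all add: weight_def del: one_plus_sq_pos)

lemma weight_neq_0 [simp]: "weight s n \<noteq> 0" using weight_pos[of s n] by linarith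

lemma weight_add: "weight s n * weight t n = weight (s + t) n"
  by (simp add: weight_def add_divide_distrib powr_add)

lemma weight_sq: "(weight s n)\<^sup>2 = (1 + (real_of_int n)\<^sup>2) powr s"
  by (simp add: weight_def power2_eq_square flip: powr_add)

lemma weight_2: "weight 2 n = 1 + (real_of_int n)\<^sup>2"
  using one_plus_sq_pos[of n] by (simp add: weight_def del: one_plus_sq_pos)

lemma weight_mono: "s \<le> t \<Longrightarrow> weight s n \<le> weight t n"
  unfolding weight_def by (rule powr_mono) auto

lemma weight_le_1: "s \<le> 0 \<Longrightarrow> weight s n \<le> 1"
  using weight_mono[of s 0 n] by simp

lemma hermitian_weight: "hermitian (\<lambda>n. complex_of_real (weight s n))"
  by (simp add: hermitian_def)

lemma weight_1_abs: "\<bar>real_of_int n\<bar> \<le> weight 1 n"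
proof -
  have "\<bar>real_of_int n\<bar> = sqrt ((real_of_int n)\<^sup>2)" by simp
  also have "\<dots> \<le> sqrt (1 + (real_of_int n)\<^sup>2)" by (intro real_sqrt_le_mono) simp
  also have "\<dots> = weight 1 n" by (simp add: weight_def powr_half_sqrt)
  finally show ?thesis .
qed

text \<open>One of \<open>k\<close> and \<open>n - k\<close> has absolute value at least \<open>\<bar>n\<bar> / 2\<close>. This distributes the
  weight over the two factors of a convolution, as the Leibniz rule distributes derivatives over a product.\<close>

lemma weight_quasi_subadd:
  assumes "0 \<le> s" shows "weight s n \<le> 2 powr s * (weight s k + weight s (n - k))"
proof -
  define m where "m = max (1 + (real_of_int k)\<^sup>2) (1 + (real_of_int (n - k))\<^sup>2)"
  have "(real_of_int n)\<^sup>2 \<le> 2 * (real_of_int k)\<^sup>2 + 2 * (real_of_int (n - k))\<^sup>2"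
    using sum_squares_bound[of "real_of_int k" "real_of_int (n - k)"] by (simp add: power2_eq_square algebra_simps)
  then have "1 + (real_of_int n)\<^sup>2 \<le> 4 * m" unfolding m_def by (simp add: max_def)
  then have "weight s n \<le> (4 * m) powr (s/2)" unfolding weight_def using assms by (intro powr_mono2) auto
  also have "\<dots> = 2 powr s * m powr (s/2)"
  proof -
    have "(4::real) powr (s/2) = (2 powr 2) powr (s/2)" by simp
    then have "(4::real) powr (s/2) = 2 powr s" by (simp only: powr_powr) simp
    moreover have "0 \<le> m" unfolding m_def by (simp add: max_def)
    ultimately show ?thesis by (simp add: powr_mult)
  qed
  also have "m powr (s/2) \<le> weight s k + weight s (n - k)"
  proof -
    have "m powr (s/2) = weight s k \<or> m powr (s/2) = weight s (n - k)" unfolding m_def weight_def max_def by auto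
    then show ?thesis using weight_nonneg[of s k] weight_nonneg[of s "n - k"] by linarith
  qed
  finally show ?thesis by simp
qed

lemma summable_weight:
  assumes "p < -1" shows "(\<lambda>n. weight p n) summable_on UNIV"
proof -
  have s: "summable (\<lambda>n. real n powr p)" using assms by (simp add: summable_real_powr_iff)
  have "(\<lambda>n::nat. weight p (int n)) summable_on UNIV"
  proof (rule norm_summable_imp_summable_on)
    show "summable (\<lambda>n. norm (weight p (int n)))"
    proof (rule summable_comparison_test_ev[OF _ s])
      show "\<forall>\<^sub>F n in sequentially. norm (norm (weight p (int n))) \<le> real n powr p"
        using eventually_gt_at_top[of 0]
      proof eventually_elim
        case (elim n)
        have "weight p (int n) \<le> ((real n)\<^sup>2) powr (p/2)"
          unfolding weight_def using assms elim by (intro powr_mono2') auto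
        also have "(real n)\<^sup>2 = real n powr 2" using elim by simp
        also have "(real n powr 2) powr (p/2) = real n powr p" by (simp only: powr_powr) simp
        finally show ?case by simp
      qed
    qed
  qed
  then have 1: "weight p summable_on (range int)"
    by (subst summable_on_reindex) (auto simp: o_def inj_on_def)
  then have "(weight p \<circ> uminus) summable_on (range int)"
    by (simp add: o_def)
  then have 2: "weight p summable_on (uminus ` range int)"
    by (subst summable_on_reindex) (auto simp: inj_on_def)
  have "weight p summable_on (uminus ` range int - range int)"
    using 2 by (rule summable_on_subset_banach) auto
  from summable_on_Un_disjoint[OF 1 this] have "weight p summable_on (range int \<union> (uminus ` range int - range int))" by auto
  moreover have "range int \<union> (uminus ` range int - range int) = UNIV"
  proof (intro set_eqI iffI UNIV_I)
    fix n :: int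
    show "n \<in> range int \<union> (uminus ` range int - range int)"
    proof (cases "0 \<le> n")
      case True
      then have "n = int (nat n)" by simp
      then show ?thesis by blast
    next
      case False
      then have "n = - int (nat (- n))" by simp
      then show ?thesis by blast
    qed
  qed
  ultimately show ?thesis by simp
qed

section \<open>Weighted convolutions and Sobolev functions\<close>

definition l2norm :: "(int \<Rightarrow> complex) \<Rightarrow> real" where
  "l2norm c = sqrt (\<Sum>\<^sub>\<infinity>n. (cmod (c n))\<^sup>2)"

lemma norm_eq_l2norm: "norm x = l2norm (cf x)"
  unfolding l2norm_def norm_hl2_sq[symmetric] by simp

lemma l2norm_nonneg [simp]: "0 \<le> l2norm c"
  unfolding l2norm_def by (intro real_sqrt_ge_zero infsum_nonneg) simp

lemma l2norm_finite: "l2 c \<Longrightarrow> finite F \<Longrightarrow> L2_set (\<lambda>n. cmod (c n)) F \<le> l2norm c"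
  unfolding L2_set_def l2norm_def l2_def
  by (intro real_sqrt_le_mono finite_sum_le_infsum) auto

definition conv :: "(int \<Rightarrow> complex) \<Rightarrow> (int \<Rightarrow> complex) \<Rightarrow> int \<Rightarrow> complex" where
  "conv c d n = (\<Sum>\<^sub>\<infinity>k. c k * d (n - k))"

lemma conv_abs_summable: "l2 c \<Longrightarrow> l2 d \<Longrightarrow> (\<lambda>k. cmod (c k) * cmod (d (n - k))) summable_on UNIV"
  unfolding l2_def by (rule summable_on_mult_l2)

lemma conv_summable:
  assumes "l2 c" "l2 d" shows "(\<lambda>k. c k * d (n - k)) summable_on UNIV"
  by (rule abs_summable_summable) (simp add: norm_mult conv_abs_summable[OF assms])

lemma conv_abs_le:
  assumes c: "l2 c" and d: "l2 d"
  shows "(\<Sum>\<^sub>\<infinity>k. cmod (c k) * cmod (d (n - k))) \<le> l2norm c * l2norm d"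
proof (rule infsum_le_finite_sums[OF conv_abs_summable[OF c d]])
  fix F :: "int set" assume F: "finite F"
  have "(\<Sum>k\<in>F. cmod (c k) * cmod (d (n - k))) \<le> L2_set (\<lambda>k. cmod (c k)) F * L2_set (\<lambda>k. cmod (d (n - k))) F"
    using L2_set_mult_ineq[of "\<lambda>k. cmod (c k)" "\<lambda>k. cmod (d (n - k))" F] by simp
  also have "L2_set (\<lambda>k. cmod (d (n - k))) F = L2_set (\<lambda>k. cmod (d k)) ((\<lambda>k. n - k) ` F)"
    unfolding L2_set_def by (subst sum.reindex) (auto simp: inj_on_def)
  also have "L2_set (\<lambda>k. cmod (c k)) F * L2_set (\<lambda>k. cmod (d k)) ((\<lambda>k. n - k) ` F) \<le> l2norm c * l2norm d"
    using F by (intro mult_mono l2norm_finite c d L2_set_nonneg) auto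
  finally show "(\<Sum>k\<in>F. cmod (c k) * cmod (d (n - k))) \<le> l2norm c * l2norm d" .
qed

lemma conv_commute: "conv c d n = conv d c n"
  unfolding conv_def
  using infsum_reindex_bij_betw[of "\<lambda>k. n - k" UNIV UNIV "\<lambda>k. d k * c (n - k)"]
  by (simp add: bij_betw_byWitness[where f'="\<lambda>k. n - k"] mult.commute)

lemma hermitian_conv: assumes "hermitian c" "hermitian d" shows "hermitian (conv c d)"
  unfolding hermitian_def
proof
  fix n
  have "conv c d (- n) = (\<Sum>\<^sub>\<infinity>k. c (- k) * d (- n - (- k)))"
    unfolding conv_def
    using infsum_reindex_bij_betw[of "uminus" UNIV UNIV "\<lambda>k. c k * d (- n - k)"]
    by (simp add: bij_betw_byWitness[where f'=uminus])
  also have "\<dots> = (\<Sum>\<^sub>\<infinity>k. cnj (c k * d (n - k)))"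
    using hermitianD[OF assms(1)] hermitianD[OF assms(2), of "n - _"] by (simp add: algebra_simps)
  also have "\<dots> = cnj (conv c d n)" unfolding conv_def by (rule infsum_cnj)
  finally show "conv c d (- n) = cnj (conv c d n)" .
qed

lemma l2_weight_mult: "0 \<le> s \<Longrightarrow> l2 c \<Longrightarrow> l2 (\<lambda>k. complex_of_real (weight (- s) k) * c k)"
  by (rule l2_bounded_mult[where C=1]) (auto simp: weight_le_1)

lemma l2norm_mono:
  assumes "l2 d" "\<And>n. cmod (c n) \<le> cmod (d n)" shows "l2norm c \<le> l2norm d"
proof -
  have "l2 c" by (rule l2_mono[of "\<lambda>n. cmod (d n)"]) (use assms in \<open>auto simp: l2_def\<close>)
  then show ?thesis
    using assms unfolding l2norm_def l2_def by (intro real_sqrt_le_mono infsum_mono power_mono) auto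
qed

text \<open>The Fourier coefficients of the function that the sequence represents in \<open>H\<^sup>s\<close>.\<close>

definition unweight :: "real \<Rightarrow> hl2 \<Rightarrow> int \<Rightarrow> complex" where
  "unweight s x k = complex_of_real (weight (- s) k) * cf x k"

lemma unweight_l2: "0 \<le> s \<Longrightarrow> l2 (unweight s x)"
  unfolding unweight_def by (rule l2_weight_mult[OF _ cf_l2])

lemma unweight_norm_le: "0 \<le> s \<Longrightarrow> l2norm (unweight s x) \<le> norm x"
  unfolding norm_eq_l2norm
  by (rule l2norm_mono[OF cf_l2]) (auto simp: unweight_def norm_mult weight_le_1 mult_left_le_one_le)

lemma weight_unweight: "complex_of_real (weight s k) * unweight s x k = cf x k"
  unfolding unweight_def mult.assoc[symmetric] of_real_mult[symmetric] by (simp add: weight_add)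

lemma hermitian_unweight: "hermitian (unweight s x)"
  unfolding unweight_def by (intro hermitian_mult hermitian_weight cf_hermitian)

text \<open>By quasi-subadditivity the weight falls on one of the factors at a time; the other factor is still square
  summable without its weight since \<open>s \<ge> 0\<close>. Cauchy--Schwarz in each of the two sums gives a bound uniform in
  \<open>n\<close>.\<close>

lemma conv_weighted_bound:
  assumes s: "0 \<le> s"
  shows "weight s n * cmod (conv (unweight s x) (unweight s y) n) \<le> 2 * 2 powr s * (norm x * norm y)"
proof -
  let ?c = "unweight s x" and ?d = "unweight s y"
  note lc = unweight_l2[OF s, of x] and ld = unweight_l2[OF s, of y]
  have s1: "(\<lambda>k. cmod (cf x k) * cmod (?d (n - k))) summable_on UNIV"
    and s2: "(\<lambda>k. cmod (?c k) * cmod (cf y (n - k))) summable_on UNIV"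
    and s0: "(\<lambda>k. cmod (?c k) * cmod (?d (n - k))) summable_on UNIV"
    by (intro conv_abs_summable lc ld cf_l2)+
  have "cmod (conv ?c ?d n) \<le> (\<Sum>\<^sub>\<infinity>k. cmod (?c k) * cmod (?d (n - k)))"
    unfolding conv_def using norm_infsum_bound[of "\<lambda>k. ?c k * ?d (n - k)" UNIV] s0 by (simp add: norm_mult)
  then have "weight s n * cmod (conv ?c ?d n) \<le> weight s n * (\<Sum>\<^sub>\<infinity>k. cmod (?c k) * cmod (?d (n - k)))"
    by (intro mult_left_mono) auto
  also have "\<dots> = (\<Sum>\<^sub>\<infinity>k. weight s n * (cmod (?c k) * cmod (?d (n - k))))"
    by (rule infsum_cmult_right'[symmetric])
  also have "\<dots> \<le> (\<Sum>\<^sub>\<infinity>k. 2 powr s * (cmod (cf x k) * cmod (?d (n - k)) + cmod (?c k) * cmod (cf y (n - k))))"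
  proof (rule infsum_mono)
    show "(\<lambda>k. weight s n * (cmod (?c k) * cmod (?d (n - k)))) summable_on UNIV"
      by (intro summable_on_cmult_right s0)
    show "(\<lambda>k. 2 powr s * (cmod (cf x k) * cmod (?d (n - k)) + cmod (?c k) * cmod (cf y (n - k)))) summable_on UNIV"
      by (intro summable_on_cmult_right summable_on_add s1 s2)
    fix k
    have e: "cmod (cf x k) = weight s k * cmod (?c k)" "cmod (cf y (n - k)) = weight s (n - k) * cmod (?d (n - k))"
      using weight_unweight[of s k x] weight_unweight[of s "n - k" y] by (metis norm_mult norm_of_real abs_of_nonneg weight_nonneg)+
    have "weight s n * (cmod (?c k) * cmod (?d (n - k))) \<le> (2 powr s * (weight s k + weight s (n - k))) * (cmod (?c k) * cmod (?d (n - k)))"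
      by (intro mult_right_mono weight_quasi_subadd s) simp
    also have "\<dots> = 2 powr s * (cmod (cf x k) * cmod (?d (n - k)) + cmod (?c k) * cmod (cf y (n - k)))"
      unfolding e by (simp add: algebra_simps)
    finally show "weight s n * (cmod (?c k) * cmod (?d (n - k))) \<le> \<dots>" .
  qed
  also have "\<dots> = 2 powr s * ((\<Sum>\<^sub>\<infinity>k. cmod (cf x k) * cmod (?d (n - k))) + (\<Sum>\<^sub>\<infinity>k. cmod (?c k) * cmod (cf y (n - k))))"
    by (simp add: infsum_cmult_right' infsum_add[OF s1 s2])
  also have "\<dots> \<le> 2 powr s * (norm x * norm y + norm x * norm y)"
  proof (intro mult_left_mono add_mono)
    show "(\<Sum>\<^sub>\<infinity>k. cmod (cf x k) * cmod (?d (n - k))) \<le> norm x * norm y"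
      by (rule order_trans[OF conv_abs_le[OF cf_l2 ld]])
         (auto simp: norm_eq_l2norm[symmetric] intro!: mult_left_mono unweight_norm_le s)
    show "(\<Sum>\<^sub>\<infinity>k. cmod (?c k) * cmod (cf y (n - k))) \<le> norm x * norm y"
      by (rule order_trans[OF conv_abs_le[OF lc cf_l2]])
         (auto simp: norm_eq_l2norm[symmetric] intro!: mult_right_mono unweight_norm_le s)
  qed simp
  finally show ?thesis by simp
qed

text \<open>Multiplication of functions followed by the smoothing \<open>(1 - \<partial>\<^sub>x\<^sup>2) powr (- 1/2)\<close>, read on \<open>hl2\<close>. Half of the
  inverse Helmholtz operator is built in because for \<open>s \<le> 1/2\<close> the product alone leaves \<open>H\<^sup>s\<close>; the other half
  is kept for the derivative in the equation.\<close>

definition wconv :: "real \<Rightarrow> hl2 \<Rightarrow> hl2 \<Rightarrow> hl2" where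
  "wconv s x y = Hl2 (\<lambda>n. complex_of_real (weight (s - 1) n) * conv (unweight s x) (unweight s y) n)"

definition wconv_const :: "real \<Rightarrow> real" where
  "wconv_const s = 2 * 2 powr s * sqrt (\<Sum>\<^sub>\<infinity>n. weight (-2) n)"

lemma wconv_bound:
  assumes "0 \<le> s"
  shows "cmod (complex_of_real (weight (s - 1) n) * conv (unweight s x) (unweight s y) n) \<le> weight (-1) n * (2 * 2 powr s * (norm x * norm y))"
proof -
  have "weight (s - 1) n = weight (-1) n * weight s n" by (simp add: weight_add)
  then have "cmod (complex_of_real (weight (s - 1) n) * conv (unweight s x) (unweight s y) n) = weight (-1) n * (weight s n * cmod (conv (unweight s x) (unweight s y) n))"
    by (simp add: norm_mult)
  also have "\<dots> \<le> weight (-1) n * (2 * 2 powr s * (norm x * norm y))"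
    by (intro mult_left_mono conv_weighted_bound assms) simp
  finally show ?thesis .
qed

lemma weight_m1_sq: "(weight (-1) n)\<^sup>2 = weight (-2) n"
  by (simp add: power2_eq_square weight_add)

lemma wconv_bound_summable: "(\<lambda>n. (weight (-1) n * B)\<^sup>2) summable_on UNIV"
  unfolding power_mult_distrib weight_m1_sq by (rule summable_on_cmult_left[OF summable_weight]) simp

lemma cf_wconv:
  assumes "0 \<le> s"
  shows "cf (wconv s x y) n = complex_of_real (weight (s - 1) n) * conv (unweight s x) (unweight s y) n"
  unfolding wconv_def
  by (subst cf_Hl2) (auto intro!: hermitian_mult hermitian_weight hermitian_conv hermitian_unweight l2_mono[OF wconv_bound_summable wconv_bound[OF assms]])

text \<open>The bilinear estimate. The smoothing contributes the square summable factor \<open>weight (- 1)\<close> to the uniform bound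
  on the weighted convolution, which is all that is needed for \<open>s \<ge> 0\<close>.\<close>

lemma norm_wconv_le:
  assumes "0 \<le> s" shows "norm (wconv s x y) \<le> norm x * norm y * wconv_const s"
proof -
  let ?B = "2 * 2 powr s * (norm x * norm y)"
  have "(norm (wconv s x y))\<^sup>2 \<le> (\<Sum>\<^sub>\<infinity>n. (weight (-1) n * ?B)\<^sup>2)"
    unfolding norm_hl2_sq
  proof (rule infsum_mono)
    show "(\<lambda>n. (cmod (cf (wconv s x y) n))\<^sup>2) summable_on UNIV" using cf_l2 by (simp add: l2_def)
    show "(\<lambda>n. (weight (-1) n * ?B)\<^sup>2) summable_on UNIV" by (rule wconv_bound_summable)
    show "(cmod (cf (wconv s x y) n))\<^sup>2 \<le> (weight (-1) n * ?B)\<^sup>2" for n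
      unfolding cf_wconv[OF assms] by (intro power_mono wconv_bound[OF assms]) simp
  qed
  also have "\<dots> = (\<Sum>\<^sub>\<infinity>n. weight (-2) n) * ?B\<^sup>2"
    unfolding power_mult_distrib[of "weight (-1) _"] weight_m1_sq by (rule infsum_cmult_left')
  also have "\<dots> = (norm x * norm y * wconv_const s)\<^sup>2"
    unfolding wconv_const_def using infsum_nonneg[of UNIV "weight (-2)"] by (simp add: power_mult_distrib)
  finally show ?thesis
    by (rule power2_le_imp_le) (auto simp: wconv_const_def intro!: mult_nonneg_nonneg infsum_nonneg)
qed

lemma wconv_commute: "wconv s x y = wconv s y x"
  unfolding wconv_def by (simp add: conv_commute[of "unweight s x"])

lemma unweight_add: "unweight s (x + y) = (\<lambda>k. unweight s x k + unweight s y k)"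
  and unweight_scaleR: "unweight s (r *\<^sub>R x) = (\<lambda>k. complex_of_real r * unweight s x k)"
  by (auto simp: unweight_def algebra_simps)

lemma wconv_add_left: assumes "0 \<le> s" shows "wconv s (x + y) z = wconv s x z + wconv s y z"
proof (rule hl2_eqI)
  fix n
  have "conv (unweight s (x + y)) (unweight s z) n = conv (unweight s x) (unweight s z) n + conv (unweight s y) (unweight s z) n"
    unfolding conv_def unweight_add distrib_right by (intro infsum_add conv_summable unweight_l2 assms)
  then show "cf (wconv s (x + y) z) n = cf (wconv s x z + wconv s y z) n"
    by (simp add: cf_wconv[OF assms] algebra_simps)
qed

lemma wconv_scaleR_left: assumes "0 \<le> s" shows "wconv s (r *\<^sub>R x) z = r *\<^sub>R wconv s x z"
proof (rule hl2_eqI)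
  fix n
  have "conv (unweight s (r *\<^sub>R x)) (unweight s z) n = r * conv (unweight s x) (unweight s z) n"
    unfolding conv_def unweight_scaleR mult.assoc by (rule infsum_cmult_right')
  then show "cf (wconv s (r *\<^sub>R x) z) n = cf (r *\<^sub>R wconv s x z) n"
    by (simp add: cf_wconv[OF assms] algebra_simps)
qed

lemma bounded_bilinear_wconv: assumes "0 \<le> s" shows "bounded_bilinear (wconv s)"
proof
  show "wconv s (x + y) z = wconv s x z + wconv s y z" "wconv s (r *\<^sub>R x) z = r *\<^sub>R wconv s x z" for x y z r
    by (rule wconv_add_left[OF assms] wconv_scaleR_left[OF assms])+
  then show "wconv s z (x + y) = wconv s z x + wconv s z y" "wconv s z (r *\<^sub>R x) = r *\<^sub>R wconv s z x" for x y z r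
    using wconv_commute by metis+
  show "\<exists>C. \<forall>x y. norm (wconv s x y) \<le> norm x * norm y * C"
    using norm_wconv_le[OF assms] by blast
qed

text \<open>The isometric embedding of \<open>H\<^sup>s\<close> modulo equality almost everywhere; for \<open>s \<ge> 0\<close> it is onto.\<close>

definition emb :: "real \<Rightarrow> (real \<Rightarrow> real) \<Rightarrow> hl2" where
  "emb s f = Hl2 (\<lambda>n. complex_of_real (weight s n) * fourier_coeff f n)"

lemma weighted_sq: "(cmod (fourier_coeff f n))\<^sup>2 * (1 + (real_of_int n)\<^sup>2) powr s = (cmod (complex_of_real (weight s n) * fourier_coeff f n))\<^sup>2"
  by (simp add: norm_mult power_mult_distrib weight_sq)

lemma sobolev_iff: "f \<in> sobolev s \<longleftrightarrow> f \<in> L2_torus \<and> l2 (\<lambda>n. complex_of_real (weight s n) * fourier_coeff f n)"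
  unfolding sobolev_def l2_def weighted_sq by simp

lemma sobolev_L2: "f \<in> sobolev s \<Longrightarrow> f \<in> L2_torus"
  by (simp add: sobolev_iff)

lemma cf_emb: "f \<in> sobolev s \<Longrightarrow> cf (emb s f) n = complex_of_real (weight s n) * fourier_coeff f n"
  unfolding emb_def sobolev_iff by (simp add: cf_Hl2 hermitian_mult hermitian_weight hermitian_fourier_coeff)

lemma sobolev_norm_emb: "f \<in> sobolev s \<Longrightarrow> sobolev_norm s f = norm (emb s f)"
  by (simp add: sobolev_norm_def weighted_sq norm_eq_l2norm l2norm_def cf_emb del: power_mult_distrib)

lemma unweight_emb: "f \<in> sobolev s \<Longrightarrow> unweight s (emb s f) = fourier_coeff f"
  by (rule ext) (simp add: unweight_def cf_emb weight_add mult.assoc[symmetric] flip: of_real_mult)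

lemma sobolev_lincomb:
  assumes "f \<in> sobolev s" "g \<in> sobolev s"
  shows "(\<lambda>x. c * f x + d * g x) \<in> sobolev s" "emb s (\<lambda>x. c * f x + d * g x) = c *\<^sub>R emb s f + d *\<^sub>R emb s g"
proof -
  note f = assms(1)[unfolded sobolev_iff] and g = assms(2)[unfolded sobolev_iff]
  have e: "complex_of_real (weight s n) * fourier_coeff (\<lambda>x. c * f x + d * g x) n =
     c * (complex_of_real (weight s n) * fourier_coeff f n) + d * (complex_of_real (weight s n) * fourier_coeff g n)" for n
    using fourier_coeff_lincomb[of f g c d n] L2_integrable f g by (simp add: algebra_simps)
  show s: "(\<lambda>x. c * f x + d * g x) \<in> sobolev s"
    unfolding sobolev_iff e using f g by (auto intro!: L2_lincomb l2_add l2_scale)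
  show "emb s (\<lambda>x. c * f x + d * g x) = c *\<^sub>R emb s f + d *\<^sub>R emb s g"
    by (rule hl2_eqI) (simp add: cf_emb assms s e)
qed

lemma sobolev_diff:
  assumes "f \<in> sobolev s" "g \<in> sobolev s"
  shows "(\<lambda>x. f x - g x) \<in> sobolev s" "emb s (\<lambda>x. f x - g x) = emb s f - emb s g"
  using sobolev_lincomb[OF assms, of 1 "-1"] by simp_all

lemma sobolev_dist_emb: "f \<in> sobolev s \<Longrightarrow> g \<in> sobolev s \<Longrightarrow> sobolev_dist s f g = norm (emb s f - emb s g)"
  by (simp add: sobolev_dist_def sobolev_norm_emb sobolev_diff)

lemma sobolev_zero: "(\<lambda>_. 0) \<in> sobolev s" and emb_zero: "emb s (\<lambda>_. 0) = 0"
proof -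
  have z: "fourier_coeff (\<lambda>_. 0) n = 0" for n by (simp add: fourier_coeff_circ)
  show "(\<lambda>_. 0) \<in> sobolev s" by (simp add: sobolev_iff z l2_def)
  then show "emb s (\<lambda>_. 0) = 0" by (intro hl2_eqI) (simp add: cf_emb z)
qed

lemma sobolev_sum:
  assumes "finite I" "\<And>i. i \<in> I \<Longrightarrow> f i \<in> sobolev s"
  shows "(\<lambda>x. \<Sum>i\<in>I. c i * f i x) \<in> sobolev s \<and> emb s (\<lambda>x. \<Sum>i\<in>I. c i * f i x) = (\<Sum>i\<in>I. c i *\<^sub>R emb s (f i))"
  using assms
proof (induction I rule: finite_induct)
  case empty then show ?case by (simp add: sobolev_zero emb_zero)
next
  case (insert i I)
  then show ?case
    using sobolev_lincomb[of "f i" s "\<lambda>x. \<Sum>i\<in>I. c i * f i x" "c i" 1] by simp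
qed

text \<open>Injectivity of the embedding is uniqueness of Fourier coefficients.\<close>

lemma emb_eq_iff:
  assumes "f \<in> sobolev s" "g \<in> sobolev s"
  shows "emb s f = emb s g \<longleftrightarrow> (AE x in lborel. f x = g x)"
proof
  assume e: "emb s f = emb s g"
  have "fourier_coeff f n = fourier_coeff g n" for n
    using arg_cong[OF e, of "\<lambda>x. cf x n"] by (simp add: cf_emb assms)
  then show "AE x in lborel. f x = g x"
    using assms by (intro fourier_unique) (auto simp: sobolev_L2)
next
  assume "AE x in lborel. f x = g x"
  then have "fourier_coeff f n = fourier_coeff g n" for n
    using assms[THEN sobolev_L2, THEN L2_torusD(2)] by (intro fourier_coeff_cong_AE)
  then show "emb s f = emb s g" by (intro hl2_eqI) (simp add: cf_emb assms)
qed

text \<open>Surjectivity of the embedding is the Riesz--Fischer theorem.\<close>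

lemma L2_with_coeffs:
  assumes "0 \<le> s"
  obtains f where "f \<in> sobolev s" "fourier_coeff f = unweight s b" "emb s f = b"
proof -
  obtain f where f: "f \<in> L2_torus" "fourier_coeff f = unweight s b"
    by (rule riesz_fischer[OF hermitian_unweight unweight_l2[OF assms, unfolded l2_def]])
  have m: "f \<in> sobolev s" unfolding sobolev_iff f(2) weight_unweight using f(1) cf_l2 by auto
  show thesis
    by (rule that[OF m f(2)], rule hl2_eqI) (simp add: cf_emb[OF m] f(2) weight_unweight)
qed

lemma sobolev_mono: 
  assumes "s \<le> t" "f \<in> sobolev t" shows "f \<in> sobolev s" "emb s f = mul (\<lambda>n. weight (s - t) n) (emb t f)"
proof -
  have m: "multiplier 1 (\<lambda>n. complex_of_real (weight (s - t) n))"
    using assms by (simp add: multiplier_def hermitian_weight weight_le_1)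
  have e: "complex_of_real (weight s n) * fourier_coeff f n = cf (mul (\<lambda>n. weight (s - t) n) (emb t f)) n" for n
    by (simp add: cf_mul[OF m] cf_emb assms weight_add mult.assoc[symmetric] flip: of_real_mult)
  show s: "f \<in> sobolev s" unfolding sobolev_iff e using assms(2) cf_l2 by (auto simp: sobolev_L2)
  show "emb s f = mul (\<lambda>n. weight (s - t) n) (emb t f)"
    by (rule hl2_eqI) (simp add: cf_emb[OF s] e)
qed

section \<open>The integral equation as an ordinary differential equation\<close>

lemma coeff_mult_wconv:
  assumes "0 \<le> s" "f \<in> sobolev s" "g \<in> sobolev s"
  shows "complex_of_real (weight (s - 1) n) * fourier_coeff (\<lambda>x. f x * g x) n = cf (wconv s (emb s f) (emb s g)) n"
  using fourier_coeff_mult[OF sobolev_L2[OF assms(2)] sobolev_L2[OF assms(3)], of n]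
  by (simp add: cf_wconv[OF assms(1)] unweight_emb assms conv_def)

text \<open>The multipliers of \<open>(1 - \<partial>\<^sub>x\<^sup>2)\<^sup>-\<^sup>1 \<partial>\<^sub>x\<close> (for the linear transport term), of
  \<open>(1 - \<partial>\<^sub>x\<^sup>2) powr (- 1/2) \<partial>\<^sub>x\<close> (for the quadratic term, the other half of the inverse being part of \<open>wconv\<close>)
  and, below, of \<open>(1 - \<partial>\<^sub>x\<^sup>2) powr (- 1/2)\<close>. The last one also represents the inclusion of \<open>H\<^sup>1\<close> in
  \<open>L\<^sup>2\<close>.\<close>

definition transport_mult :: "int \<Rightarrow> complex" where "transport_mult n = \<i> * of_int n * of_real (weight (-2) n)"
definition deriv_mult :: "int \<Rightarrow> complex" where "deriv_mult n = \<i> * of_int n * of_real (weight (-1) n)"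

lemma multiplier_deriv: "multiplier 1 deriv_mult"
proof -
  have "cmod (deriv_mult n) \<le> 1" for n
  proof -
    have "cmod (deriv_mult n) = \<bar>real_of_int n\<bar> * weight (-1) n" by (simp add: deriv_mult_def norm_mult)
    also have "\<dots> \<le> weight 1 n * weight (-1) n" by (intro mult_right_mono weight_1_abs) simp
    finally show ?thesis by (simp add: weight_add)
  qed
  then show ?thesis by (simp add: multiplier_def hermitian_def deriv_mult_def)
qed

lemma multiplier_transport: "multiplier 1 transport_mult"
proof -
  have "cmod (transport_mult n) \<le> 1" for n
  proof -
    have "transport_mult n = deriv_mult n * of_real (weight (-1) n)" by (simp add: deriv_mult_def transport_mult_def weight_add mult.assoc flip: of_real_mult)
    then have "cmod (transport_mult n) = cmod (deriv_mult n) * weight (-1) n" by (simp add: norm_mult)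
    also have "\<dots> \<le> 1 * 1" using multiplier_deriv by (intro mult_mono) (auto simp: multiplier_def weight_le_1)
    finally show ?thesis by simp
  qed
  then show ?thesis by (simp add: multiplier_def hermitian_def transport_mult_def)
qed

abbreviation half_mult :: "int \<Rightarrow> complex" where "half_mult \<equiv> (\<lambda>n. complex_of_real (weight (-1) n))"

lemma multiplier_half: "multiplier 1 half_mult"
  by (simp add: multiplier_def hermitian_weight weight_le_1)

text \<open>The equation as a vector field: \<open>x\<close> stands for the solution and \<open>\<alpha>\<close> for the damping coefficient, so
  that the three terms are damping, transport and nonlinearity.\<close>

definition field :: "real \<Rightarrow> hl2 \<Rightarrow> hl2 \<Rightarrow> hl2" where
  "field s \<alpha> x = - (mul half_mult (wconv s \<alpha> x) + mul transport_mult x + (1/2) *\<^sub>R mul deriv_mult (wconv s x x))"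

lemma cf_field:
  assumes "0 \<le> s"
  shows "cf (field s \<alpha> x) n = - (weight (-1) n * cf (wconv s \<alpha> x) n + transport_mult n * cf x n + deriv_mult n * cf (wconv s x x) n / 2)"
  by (simp add: field_def cf_mul[OF multiplier_half] cf_mul[OF multiplier_deriv] cf_mul[OF multiplier_transport])

text \<open>The choice operator in \<open>helmholtz_inv\<close> is harmless once a function with the required coefficients exists;
  the candidate is the function that \<open>field\<close> represents.\<close>

lemma emb_bbm_rhs:
  assumes s: "0 \<le> s" and a: "a \<in> sobolev s" and f: "f \<in> sobolev s"
  shows "bbm_rhs a f \<in> sobolev s" "emb s (bbm_rhs a f) = - field s (emb s a) (emb s f)"
    and "fourier_coeff (bbm_rhs a f) = unweight s (- field s (emb s a) (emb s f))"
proof -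
  define c where "c n = fourier_coeff (\<lambda>x. a x * f x) n + dx_coeff (fourier_coeff (\<lambda>x. f x + (f x)\<^sup>2 / 2)) n" for n
  let ?b = "- field s (emb s a) (emb s f)"
  have W2: "1 / (1 + (of_int n)\<^sup>2) = complex_of_real (weight (-2) n)" for n
  proof -
    have "weight (-2) n = 1 / weight 2 n" using weight_add[of "-2" n 2] by (simp add: eq_divide_eq)
    then show ?thesis by (simp add: weight_2)
  qed
  have f2: "fourier_coeff (\<lambda>x. f x + (f x)\<^sup>2 / 2) n = fourier_coeff f n + fourier_coeff (\<lambda>x. f x * f x) n / 2" for n
    using fourier_coeff_lincomb[OF L2_integrable[OF sobolev_L2[OF f]] L2_mult_integrable[OF sobolev_L2[OF f] sobolev_L2[OF f]], of 1 "1/2" n]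
    by (simp add: power2_eq_square)
  have eq: "c n / (1 + (of_int n)\<^sup>2) = unweight s ?b n" for n
  proof -
    have Ka: "complex_of_real (weight (- s) n) * cf (wconv s (emb s a) (emb s f)) n = weight (-1) n * fourier_coeff (\<lambda>x. a x * f x) n"
      and Kf: "complex_of_real (weight (- s) n) * cf (wconv s (emb s f) (emb s f)) n = weight (-1) n * fourier_coeff (\<lambda>x. f x * f x) n"
      by (simp_all add: coeff_mult_wconv[symmetric] s a f weight_add mult.assoc[symmetric] flip: of_real_mult)
    have Df: "complex_of_real (weight (- s) n) * cf (emb s f) n = fourier_coeff f n"
      using fun_cong[OF unweight_emb[OF f]] by (simp add: unweight_def)
    have "unweight s ?b n = weight (-1) n * (complex_of_real (weight (- s) n) * cf (wconv s (emb s a) (emb s f)) n) 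
        + transport_mult n * (complex_of_real (weight (- s) n) * cf (emb s f) n) + deriv_mult n * (complex_of_real (weight (- s) n) * cf (wconv s (emb s f) (emb s f)) n) / 2"
      by (simp add: unweight_def cf_field[OF s] algebra_simps)
    also have "\<dots> = weight (-2) n * fourier_coeff (\<lambda>x. a x * f x) n + transport_mult n * fourier_coeff f n + transport_mult n * fourier_coeff (\<lambda>x. f x * f x) n / 2"
    proof -
      have "complex_of_real (weight (-1) n) * of_real (weight (-1) n) = of_real (weight (-2) n)" by (simp add: weight_add flip: of_real_mult)
      then have "weight (-1) n * (weight (-1) n * z) = weight (-2) n * z" "deriv_mult n * (weight (-1) n * z) = transport_mult n * z" for z :: complex
        by (simp_all only: deriv_mult_def transport_mult_def mult.assoc[symmetric]) (simp only: mult.assoc)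
      then show ?thesis unfolding Ka Kf Df by (simp only:)
    qed
    also have "\<dots> = weight (-2) n * c n"
      unfolding c_def dx_coeff_def f2 transport_mult_def by (simp add: algebra_simps)
    also have "\<dots> = c n / (1 + (of_int n)\<^sup>2)"
      unfolding W2[symmetric] by simp
    finally show ?thesis ..
  qed
  obtain v where v: "v \<in> sobolev s" "fourier_coeff v = unweight s ?b" "emb s v = ?b"
    by (rule L2_with_coeffs[OF s])
  have "\<exists>v. v \<in> L2_torus \<and> (\<forall>n. fourier_coeff v n = c n / (1 + (of_int n)\<^sup>2))"
    using v(2) eq sobolev_L2[OF v(1)] by auto
  then have h: "helmholtz_inv c \<in> L2_torus \<and> (\<forall>n. fourier_coeff (helmholtz_inv c) n = c n / (1 + (of_int n)\<^sup>2))"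
    unfolding helmholtz_inv_def by (rule someI_ex)
  have b: "bbm_rhs a f = helmholtz_inv c" unfolding bbm_rhs_def c_def ..
  show cfb: "fourier_coeff (bbm_rhs a f) = unweight s ?b"
    using h unfolding b eq by auto
  show m: "bbm_rhs a f \<in> sobolev s"
    unfolding sobolev_iff cfb weight_unweight using h cf_l2[of ?b] unfolding b by blast
  show "emb s (bbm_rhs a f) = ?b"
    by (rule hl2_eqI) (simp only: cf_emb[OF m] cfb weight_unweight)
qed

lemma continuous_on_field:
  assumes "0 \<le> s" "continuous_on S f" shows "continuous_on S (\<lambda>t. field s \<alpha> (f t))"
proof -
  note K = bounded_bilinear.continuous_on[OF bounded_bilinear_wconv[OF assms(1)]]
  note mm = bounded_linear.continuous_on[OF bounded_linear_mul]
  show ?thesis unfolding field_def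
    by (intro continuous_intros K mm[OF multiplier_half] mm[OF multiplier_transport] mm[OF multiplier_deriv] assms)
qed

lemma deriv_shift_periodic:
  fixes f :: "real \<Rightarrow> real"
  assumes p: "torus_periodic f" and d: "\<And>x. f field_differentiable (at x)"
  shows "torus_periodic (deriv f)"
  unfolding torus_periodic_def
proof
  fix x
  have "(f has_field_derivative deriv f (x + 2 * pi)) (at (x + 2 * pi))"
    using d field_differentiable_derivI by blast
  then have "((\<lambda>y. f (y + 2 * pi)) has_field_derivative deriv f (x + 2 * pi)) (at x)"
    by (simp add: DERIV_shift)
  then have "(f has_field_derivative deriv f (x + 2 * pi)) (at x)"
    using p by (simp add: torus_periodic_def)
  then show "deriv f (x + 2 * pi) = deriv f x" by (simp add: DERIV_imp_deriv)
qed

lemma continuous_L2: 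
  assumes "torus_periodic f" "continuous_on UNIV f" shows "f \<in> L2_torus"
proof -
  have "set_integrable lborel {0..2*pi} (\<lambda>x. (f x)\<^sup>2)"
    by (rule borel_integrable_atLeastAtMost') (intro continuous_intros continuous_on_subset[OF assms(2)], auto)
  then show ?thesis using assms by (simp add: L2_torus_def borel_measurable_continuous_onI)
qed

text \<open>Integration by parts over a period.\<close>

lemma fourier_coeff_deriv:
  fixes f f' :: "real \<Rightarrow> real"
  assumes p: "torus_periodic f" and d: "\<And>x. (f has_field_derivative f' x) (at x)" and c: "continuous_on UNIV f'"
  shows "fourier_coeff f' n = \<i> * of_int n * fourier_coeff f n"
proof -
  have fc: "continuous_on UNIV f" using d DERIV_continuous_on by blast
  have p': "torus_periodic f'"
    using deriv_shift_periodic[OF p] d DERIV_imp_deriv[OF d] field_differentiable_def by (metis ext)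
  have fi: "integrable circ f" "integrable circ f'" by (intro L2_integrable continuous_L2 p p' fc c)+
  have i1: "integrable circ (\<lambda>x. of_real (f x) * cis (- (of_int n * x)))" "integrable circ (\<lambda>x. of_real (f' x) * cis (- (of_int n * x)))"
    using mult_cis_integrable(2)[of "\<lambda>x. of_real (f x)"] mult_cis_integrable(2)[of "\<lambda>x. of_real (f' x)"] fi by auto
  define G where "G x = of_real (f x) * cis (- (of_int n * x))" for x
  define g where "g x = of_real (f' x) * cis (- (of_int n * x)) - (\<i> * of_int n) * (of_real (f x) * cis (- (of_int n * x)))" for x
  have "(LBINT x. indicator {0..2*pi} x *\<^sub>R g x) = G (2*pi) - G 0"
  proof (rule integral_FTC_atLeastAtMost)
    show "continuous_on {0..2*pi} g"
      unfolding g_def by (intro continuous_intros continuous_on_subset[OF fc] continuous_on_subset[OF c]) auto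
    fix x :: real
    have a: "((\<lambda>x. complex_of_real (f x)) has_vector_derivative of_real (f' x)) (at x within {0..2*pi})"
      using bounded_linear.has_vector_derivative[OF bounded_linear_of_real] d
        has_real_derivative_iff_has_vector_derivative has_vector_derivative_at_within by metis
    have b: "((\<lambda>x. exp (- (\<i> * of_int n) * of_real x)) has_vector_derivative - (\<i> * of_int n) * exp (- (\<i> * of_int n) * of_real x)) (at x within {0..2*pi})"
      by (auto intro!: derivative_eq_intros has_vector_derivative_real_field)
    have e: "cis (- (of_int n * x)) = exp (- (\<i> * of_int n) * of_real x)" for x
      by (simp add: cis_conv_exp mult.assoc)
    show "(G has_vector_derivative g x) (at x within {0..2*pi})"
      unfolding G_def g_def e using has_vector_derivative_mult[OF a b] by (simp add: algebra_simps)
  qed simp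
  moreover have "G (2*pi) = G 0"
  proof -
    have "f (2 * pi) = f 0" using p[unfolded torus_periodic_def, rule_format, of 0] by simp
    then show ?thesis by (simp add: G_def cis_full_turns)
  qed
  ultimately have "integral\<^sup>L circ g = 0" by (simp add: integral_restrict_space)
  then have "(\<integral>x. of_real (f' x) * cis (- (of_int n * x)) \<partial>circ) = (\<i> * of_int n) * (\<integral>x. of_real (f x) * cis (- (of_int n * x)) \<partial>circ)"
    unfolding g_def using i1 by (subst (asm) Bochner_Integration.integral_diff) auto
  then show ?thesis by (simp add: fourier_coeff_circ)
qed

text \<open>Apply Bessel's inequality to a derivative of order \<open>k \<ge> s\<close>: the weight is bounded by a multiple of
  \<open>1 + \<bar>n\<bar> ^ k\<close>.\<close>

lemma smooth_sobolev:
  assumes a: "torus_smooth a" shows "a \<in> sobolev s"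
proof -
  define D where "D k = (deriv ^^ k) a" for k
  have d: "(D k has_field_derivative D (Suc k) x) (at x)" for k x
    using a field_differentiable_derivI unfolding torus_smooth_def D_def by fastforce
  have c: "continuous_on UNIV (D k)" for k using d DERIV_continuous_on by blast
  have p: "torus_periodic (D k)" for k
  proof (induction k)
    case 0 then show ?case using a by (simp add: torus_smooth_def D_def)
  next
    case (Suc k)
    have "torus_periodic (deriv (D k))"
      by (rule deriv_shift_periodic[OF Suc]) (use d field_differentiable_def in blast)
    then show ?case by (simp add: D_def)
  qed
  have L: "D k \<in> L2_torus" for k by (rule continuous_L2[OF p c])
  have co: "fourier_coeff (D k) n = (\<i> * of_int n) ^ k * fourier_coeff a n" for k n
  proof (induction k)
    case 0 then show ?case by (simp add: D_def)
  next
    case (Suc k)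
    have "fourier_coeff (D (Suc k)) n = \<i> * of_int n * fourier_coeff (D k) n"
      by (rule fourier_coeff_deriv[OF p d c])
    then show ?case using Suc by simp
  qed
  define k where "k = nat \<lceil>s\<rceil>"
  have sk: "s \<le> real k" unfolding k_def by linarith
  have "a \<in> L2_torus" using L[of 0] by (simp add: D_def)
  moreover have "l2 (\<lambda>n. complex_of_real (weight s n) * fourier_coeff a n)"
  proof (rule l2_mono)
    have "l2 (fourier_coeff (D 0))" "l2 (fourier_coeff (D k))" using bessel[OF L] by (auto simp: l2_def)
    then have "(\<lambda>n. (2^k)\<^sup>2 * (2 * (cmod (fourier_coeff (D 0) n))\<^sup>2 + 2 * (cmod (fourier_coeff (D k) n))\<^sup>2)) summable_on UNIV"
      unfolding l2_def by (intro summable_on_cmult_right summable_on_add)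
    then show "(\<lambda>n. (2^k * (cmod (fourier_coeff (D 0) n) + cmod (fourier_coeff (D k) n)))\<^sup>2) summable_on UNIV"
    proof (rule summable_on_comparison_test)
      fix n
      show "(2^k * (cmod (fourier_coeff (D 0) n) + cmod (fourier_coeff (D k) n)))\<^sup>2 \<le> (2^k)\<^sup>2 * (2 * (cmod (fourier_coeff (D 0) n))\<^sup>2 + 2 * (cmod (fourier_coeff (D k) n))\<^sup>2)"
        unfolding power_mult_distrib using sum_squares_bound[of "cmod (fourier_coeff (D 0) n)" "cmod (fourier_coeff (D k) n)"]
        by (intro mult_left_mono) (auto simp: power2_sum)
    qed simp
    fix n
    have "weight s n \<le> weight (real k) n" by (rule weight_mono[OF sk])
    also have "\<dots> = (weight 1 n) ^ k"
    proof -
      have "weight (real k) n = (weight 1 n) powr (real k)" by (simp add: weight_def powr_powr)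
      then show ?thesis by (simp add: powr_realpow)
    qed
    also have "\<dots> \<le> (2 * max 1 \<bar>real_of_int n\<bar>) ^ k"
    proof (rule power_mono)
      have "weight 1 n = sqrt (1 + (real_of_int n)\<^sup>2)" by (simp add: weight_def powr_half_sqrt)
      also have "\<dots> \<le> sqrt ((2 * max 1 \<bar>real_of_int n\<bar>)\<^sup>2)"
      proof (rule real_sqrt_le_mono)
        let ?m = "max 1 \<bar>real_of_int n\<bar>"
        have "(real_of_int n)\<^sup>2 \<le> ?m\<^sup>2" using power_mono[of "\<bar>real_of_int n\<bar>" ?m 2] by simp
        moreover have "1 \<le> ?m\<^sup>2" by (rule one_le_power) simp
        moreover have "(2 * ?m)\<^sup>2 = 4 * ?m\<^sup>2" by (simp only: power_mult_distrib) simp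
        ultimately show "1 + (real_of_int n)\<^sup>2 \<le> (2 * ?m)\<^sup>2" by linarith
      qed
      also have "\<dots> = 2 * max 1 \<bar>real_of_int n\<bar>" by (rule real_sqrt_unique) simp_all
      finally show "weight 1 n \<le> 2 * max 1 \<bar>real_of_int n\<bar>" .
    qed simp
    also have "\<dots> \<le> 2 ^ k * (1 + \<bar>real_of_int n\<bar> ^ k)"
      unfolding power_mult_distrib by (intro mult_left_mono) (auto simp: max_def)
    finally have "weight s n * cmod (fourier_coeff a n) \<le> 2 ^ k * (1 + \<bar>real_of_int n\<bar> ^ k) * cmod (fourier_coeff a n)"
      by (rule mult_right_mono) simp
    then show "cmod (complex_of_real (weight s n) * fourier_coeff a n) \<le> 2^k * (cmod (fourier_coeff (D 0) n) + cmod (fourier_coeff (D k) n))"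
      unfolding co by (simp add: norm_mult norm_power algebra_simps)
  qed
  ultimately show ?thesis by (simp add: sobolev_iff)
qed

lemma emb_riemann_sum:
  assumes g: "\<And>\<tau>. \<tau> \<in> {0..t} \<Longrightarrow> g \<tau> \<in> sobolev s" and p: "p tagged_division_of {0..t::real}"
  shows "(\<lambda>x. \<Sum>(\<tau>, K)\<in>p. measure lborel K * g \<tau> x) \<in> sobolev s"
    "emb s (\<lambda>x. \<Sum>(\<tau>, K)\<in>p. measure lborel K * g \<tau> x) = (\<Sum>(\<tau>, K)\<in>p. measure lborel K *\<^sub>R emb s (g \<tau>))"
proof -
  have "fst i \<in> {0..t}" if "i \<in> p" for i
    using tagged_division_ofD(2,3)[OF p, of "fst i" "snd i"] that by auto
  then show "(\<lambda>x. \<Sum>(\<tau>, K)\<in>p. measure lborel K * g \<tau> x) \<in> sobolev s"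
    "emb s (\<lambda>x. \<Sum>(\<tau>, K)\<in>p. measure lborel K * g \<tau> x) = (\<Sum>(\<tau>, K)\<in>p. measure lborel K *\<^sub>R emb s (g \<tau>))"
    using sobolev_sum[OF tagged_division_of_finite[OF p], of "\<lambda>i. g (fst i)" s "\<lambda>i. measure lborel (snd i)"] g
    by (auto simp: case_prod_beta)
qed

lemma has_sobolev_integral_iff:
  "has_sobolev_integral s g I t \<longleftrightarrow> (\<forall>\<tau>\<in>{0..t}. g \<tau> \<in> sobolev s) \<and> I \<in> sobolev s \<and>
     (\<forall>e>0. \<exists>d>0. \<forall>p. p tagged_division_of {0..t} \<and> (\<lambda>\<tau>. ball \<tau> d) fine p \<longrightarrow>
        norm ((\<Sum>(\<tau>, K)\<in>p. measure lborel K *\<^sub>R emb s (g \<tau>)) - emb s I) < e)"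
proof (cases "(\<forall>\<tau>\<in>{0..t}. g \<tau> \<in> sobolev s) \<and> I \<in> sobolev s")
  case True
  then have "sobolev_dist s (\<lambda>x. \<Sum>(\<tau>, K)\<in>p. measure lborel K * g \<tau> x) I = norm ((\<Sum>(\<tau>, K)\<in>p. measure lborel K *\<^sub>R emb s (g \<tau>)) - emb s I)"
    if "p tagged_division_of {0..t}" for p
    using emb_riemann_sum[of t g s, OF _ that] by (simp add: sobolev_dist_emb)
  then show ?thesis unfolding has_sobolev_integral_def by (simp cong: conj_cong imp_cong)
next
  case False
  then show ?thesis unfolding has_sobolev_integral_def by blast
qed

lemma sobolev_integral_imp_has_integral:
  assumes "has_sobolev_integral s g I t"
  shows "((\<lambda>\<tau>. emb s (g \<tau>)) has_integral emb s I) {0..t}"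
  unfolding has_integral_real
proof (intro allI impI)
  fix e :: real assume "e > 0"
  then obtain d where d: "d > 0" "\<And>p. p tagged_division_of {0..t} \<and> (\<lambda>\<tau>. ball \<tau> d) fine p \<Longrightarrow>
        norm ((\<Sum>(\<tau>, K)\<in>p. measure lborel K *\<^sub>R emb s (g \<tau>)) - emb s I) < e"
    using assms unfolding has_sobolev_integral_iff by blast
  then show "\<exists>\<gamma>. gauge \<gamma> \<and> (\<forall>\<D>. \<D> tagged_division_of {0..t} \<and> \<gamma> fine \<D> \<longrightarrow> norm ((\<Sum>(x, k)\<in>\<D>. measure lborel k *\<^sub>R emb s (g x)) - emb s I) < e)"
    by (intro exI[of _ "\<lambda>\<tau>. ball \<tau> d"]) auto
qed

text \<open>For a continuous integrand, uniform continuity allows the gauge to be a constant mesh. This is the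
  strong form of convergence of Riemann sums that \<open>has_sobolev_integral\<close> demands.\<close>

lemma continuous_uniform_riemann:
  fixes \<phi> :: "real \<Rightarrow> 'a::banach"
  assumes c: "continuous_on {0..t} \<phi>" and t: "0 \<le> t" and e: "0 < e"
  shows "\<exists>d>0. \<forall>p. p tagged_division_of {0..t} \<and> (\<lambda>\<tau>. ball \<tau> d) fine p \<longrightarrow>
        norm ((\<Sum>(\<tau>, K)\<in>p. measure lborel K *\<^sub>R \<phi> \<tau>) - integral {0..t} \<phi>) < e"
proof -
  \<comment> \<open>Division by \<open>t + 1\<close> instead of \<open>t\<close> covers the degenerate interval \<open>t = 0\<close>.\<close>
  define e' where "e' = e / (t + 1)"
  have e': "e' > 0" "e' * t < e" using e t by (auto simp: e'_def field_simps)
  have "uniformly_continuous_on {0..t} \<phi>" by (rule compact_uniformly_continuous[OF c]) simp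
  then obtain d where d: "d > 0" "\<And>x y. x \<in> {0..t} \<Longrightarrow> y \<in> {0..t} \<Longrightarrow> dist y x < d \<Longrightarrow> dist (\<phi> y) (\<phi> x) < e'"
    using e' unfolding uniformly_continuous_on_def by metis
  have "norm ((\<Sum>(\<tau>, K)\<in>p. measure lborel K *\<^sub>R \<phi> \<tau>) - integral {0..t} \<phi>) < e"
    if p: "p tagged_division_of {0..t}" and f: "(\<lambda>\<tau>. ball \<tau> d) fine p" for p
  proof -
    have int: "\<phi> integrable_on {0..t}" using c by (rule integrable_continuous_real)
    have i: "integral {0..t} \<phi> = (\<Sum>(\<tau>, K)\<in>p. integral K \<phi>)"
      using integral_combine_tagged_division_topdown[of \<phi> 0 t p] int p by simp
    have b: "norm (measure lborel K *\<^sub>R \<phi> \<tau> - integral K \<phi>) \<le> measure lborel K * e'" if i: "(\<tau>, K) \<in> p" for \<tau> K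
    proof -
      obtain u v where K: "K = cbox u v" using tagged_division_ofD(4)[OF p i] by blast
      have sub: "K \<subseteq> {0..t}" and \<tau>: "\<tau> \<in> {0..t}" using tagged_division_ofD(2,3)[OF p i] by auto
      have ball: "K \<subseteq> ball \<tau> d" using f i unfolding fine_def by auto
      have iK: "(\<phi> has_integral integral K \<phi>) K"
        unfolding K using integrable_on_subcbox[OF int, of u v] sub K by (auto intro: integrable_integral)
      have "((\<lambda>x. \<phi> \<tau> - \<phi> x) has_integral (measure lborel K *\<^sub>R \<phi> \<tau> - integral K \<phi>)) (cbox u v)"
        using has_integral_diff[OF has_integral_const[of "\<phi> \<tau>" u v] iK[unfolded K]] K by simp
      moreover have "norm (\<phi> \<tau> - \<phi> x) \<le> e'" if "x \<in> cbox u v" for x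
      proof -
        have "x \<in> {0..t}" "dist \<tau> x < d" using that sub ball K by auto
        then show ?thesis using d(2)[of x \<tau>] \<tau> by (simp add: dist_norm less_imp_le)
      qed
      ultimately show ?thesis using has_integral_bound[of e' "\<lambda>x. \<phi> \<tau> - \<phi> x"] e' K by (simp add: mult.commute)
    qed
    have "norm ((\<Sum>(\<tau>, K)\<in>p. measure lborel K *\<^sub>R \<phi> \<tau>) - integral {0..t} \<phi>) = norm (\<Sum>(\<tau>, K)\<in>p. measure lborel K *\<^sub>R \<phi> \<tau> - integral K \<phi>)"
      unfolding i by (simp add: case_prod_beta sum_subtractf)
    also have "\<dots> \<le> (\<Sum>(\<tau>, K)\<in>p. measure lborel K * e')"
      by (rule sum_norm_le) (use b in auto)
    also have "\<dots> = (\<Sum>(\<tau>, K)\<in>p. measure lborel K) * e'" by (simp add: case_prod_beta sum_distrib_right)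
    also have "(\<Sum>(\<tau>, K)\<in>p. measure lborel K) = t"
      using additive_content_tagged_division[of p 0 t] p t by simp
    finally show ?thesis using e' by (simp add: mult.commute)
  qed
  then show ?thesis using d(1) by blast
qed

text \<open>Integral curves, with one-sided derivatives at the two ends of the time interval.\<close>

definition ode_sol :: "('a::real_normed_vector \<Rightarrow> 'a) \<Rightarrow> real \<Rightarrow> 'a \<Rightarrow> (real \<Rightarrow> 'a) \<Rightarrow> bool" where
  "ode_sol F T x0 x \<longleftrightarrow> x 0 = x0 \<and> (\<forall>t\<in>{0..T}. (x has_vector_derivative F (x t)) (at t within {0..T}))"

lemma ode_sol_continuous: "ode_sol F T x0 x \<Longrightarrow> continuous_on {0..T} x"
  unfolding ode_sol_def continuous_on_eq_continuous_within
  using has_vector_derivative_continuous by blast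

lemma ode_sol_integral:
  fixes x :: "real \<Rightarrow> 'a::banach"
  assumes "ode_sol F T x0 x" "t \<in> {0..T}"
  shows "((\<lambda>\<tau>. F (x \<tau>)) has_integral (x t - x0)) {0..t}"
proof -
  have "((\<lambda>\<tau>. F (x \<tau>)) has_integral (x t - x 0)) {0..t}"
  proof (rule fundamental_theorem_of_calculus)
    fix \<tau> assume \<tau>: "\<tau> \<in> {0..t}"
    then have "(x has_vector_derivative F (x \<tau>)) (at \<tau> within {0..T})"
      using assms unfolding ode_sol_def by auto
    then show "(x has_vector_derivative F (x \<tau>)) (at \<tau> within {0..t})"
      by (rule has_vector_derivative_within_subset) (use assms in auto)
  qed (use assms in simp)
  then show ?thesis using assms by (simp add: ode_sol_def)
qed

text \<open>The bridge between the notion of solution of the theorem and ordinary differential equations in \<open>hl2\<close>. Since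
  the field is continuous, the integral equation and the differential equation are equivalent by the fundamental theorem of
  calculus. A Riemann integral in \<open>H\<^sup>s\<close> is in particular a Henstock--Kurzweil integral in \<open>hl2\<close>; the converse
  uses \<open>continuous_uniform_riemann\<close>.\<close>

lemma bbm_solution_iff:
  assumes s: "0 \<le> s" and a: "a \<in> sobolev s" and u0: "u0 \<in> sobolev s" and T: "0 \<le> T"
  shows "bbm_solution a s T u0 u \<longleftrightarrow> (\<forall>t\<in>{0..T}. u t \<in> sobolev s) \<and>
     ode_sol (field s (emb s a)) T (emb s u0) (\<lambda>t. emb s (u t))"
proof -
  let ?F = "field s (emb s a)" and ?b = "\<lambda>t. emb s (u t)"
  have cont: "sobolev_cont s T u \<longleftrightarrow> continuous_on {0..T} ?b" if m: "\<forall>t\<in>{0..T}. u t \<in> sobolev s"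
  proof -
    have "((\<lambda>\<tau>. sobolev_dist s (u \<tau>) (u t)) \<longlongrightarrow> 0) (at t within {0..T}) \<longleftrightarrow> (?b \<longlongrightarrow> ?b t) (at t within {0..T})"
      if t: "t \<in> {0..T}" for t
    proof -
      have "((\<lambda>\<tau>. sobolev_dist s (u \<tau>) (u t)) \<longlongrightarrow> 0) (at t within {0..T}) \<longleftrightarrow> ((\<lambda>\<tau>. dist (?b \<tau>) (?b t)) \<longlongrightarrow> 0) (at t within {0..T})"
        by (rule Lim_cong_within) (use m t in \<open>auto simp: sobolev_dist_emb dist_norm\<close>)
      then show ?thesis using tendsto_dist_iff[of ?b "?b t"] by blast
    qed
    then show ?thesis using m unfolding sobolev_cont_def continuous_on_def by blast
  qed
  show ?thesis
  proof
    assume sol: "bbm_solution a s T u0 u"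
    then have m: "\<forall>t\<in>{0..T}. u t \<in> sobolev s" unfolding bbm_solution_def sobolev_cont_def by blast
    then have c: "continuous_on {0..T} ?b" using sol cont unfolding bbm_solution_def by blast
    have eq: "?b t = emb s u0 + integral {0..t} (\<lambda>\<tau>. ?F (?b \<tau>))" if t: "t \<in> {0..T}" for t
    proof -
      obtain I where I: "has_sobolev_integral s (\<lambda>\<tau>. bbm_rhs a (u \<tau>)) I t" "AE x in lborel. u t x = u0 x - I x"
        using sol t unfolding bbm_solution_def by blast
      have Is: "I \<in> sobolev s" using I(1) unfolding has_sobolev_integral_def by blast
      have "((\<lambda>\<tau>. emb s (bbm_rhs a (u \<tau>))) has_integral emb s I) {0..t}"
        by (rule sobolev_integral_imp_has_integral[OF I(1)])
      then have "((\<lambda>\<tau>. - ?F (?b \<tau>)) has_integral emb s I) {0..t}"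
        by (rule has_integral_eq[rotated]) (use m t in \<open>simp add: emb_bbm_rhs[OF s a]\<close>)
      then have "((\<lambda>\<tau>. ?F (?b \<tau>)) has_integral - emb s I) {0..t}"
        using has_integral_neg[of "\<lambda>\<tau>. - ?F (?b \<tau>)" "emb s I" "{0..t}"] by simp
      then have "integral {0..t} (\<lambda>\<tau>. ?F (?b \<tau>)) = - emb s I" by (rule integral_unique)
      moreover have "?b t = emb s u0 - emb s I"
        using emb_eq_iff[of "u t" s "\<lambda>x. u0 x - I x"] sobolev_diff[OF u0 Is] I(2) m t by simp
      ultimately show ?thesis by simp
    qed
    have "ode_sol ?F T (emb s u0) ?b"
      unfolding ode_sol_def
    proof (intro conjI ballI)
      show "?b 0 = emb s u0" using eq[of 0] T by simp
      fix t assume t: "t \<in> {0..T}"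
      have "((\<lambda>t. integral {0..t} (\<lambda>\<tau>. ?F (?b \<tau>))) has_vector_derivative ?F (?b t)) (at t within {0..T})"
        by (rule integral_has_vector_derivative[OF continuous_on_field[OF s c] t])
      then have "((\<lambda>t. emb s u0 + integral {0..t} (\<lambda>\<tau>. ?F (?b \<tau>))) has_vector_derivative 0 + ?F (?b t)) (at t within {0..T})"
        by (intro has_vector_derivative_add has_vector_derivative_const)
      then have "((\<lambda>t. emb s u0 + integral {0..t} (\<lambda>\<tau>. ?F (?b \<tau>))) has_vector_derivative ?F (?b t)) (at t within {0..T})"
        by simp
      then show "(?b has_vector_derivative ?F (?b t)) (at t within {0..T})"
        by (rule has_vector_derivative_transform[OF t, rotated]) (rule eq)
    qed
    with m show "(\<forall>t\<in>{0..T}. u t \<in> sobolev s) \<and> ode_sol ?F T (emb s u0) ?b" by blast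
  next
    assume "(\<forall>t\<in>{0..T}. u t \<in> sobolev s) \<and> ode_sol ?F T (emb s u0) ?b"
    then have m: "\<forall>t\<in>{0..T}. u t \<in> sobolev s" and sol: "ode_sol ?F T (emb s u0) ?b" by auto
    have c: "continuous_on {0..T} ?b" by (rule ode_sol_continuous[OF sol])
    have "\<exists>I. has_sobolev_integral s (\<lambda>\<tau>. bbm_rhs a (u \<tau>)) I t \<and> (AE x in lborel. u t x = u0 x - I x)" if t: "t \<in> {0..T}" for t
    proof (intro exI conjI)
      let ?I = "\<lambda>x. u0 x - u t x"
      let ?\<phi> = "\<lambda>\<tau>. emb s (bbm_rhs a (u \<tau>))"
      have ut: "u t \<in> sobolev s" using m t by blast
      have \<phi>: "?\<phi> \<tau> = - ?F (?b \<tau>)" if "\<tau> \<in> {0..t}" for \<tau>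
        using emb_bbm_rhs(2)[OF s a, of "u \<tau>"] m t that by auto
      have "continuous_on {0..t} (\<lambda>\<tau>. - ?F (?b \<tau>))"
        using continuous_on_subset[OF c] t by (intro continuous_intros continuous_on_field s) auto
      then have c\<phi>: "continuous_on {0..t} ?\<phi>" by (rule continuous_on_eq) (rule \<phi>[symmetric])
      have "((\<lambda>\<tau>. - ?F (?b \<tau>)) has_integral - (?b t - emb s u0)) {0..t}"
        by (rule has_integral_neg[OF ode_sol_integral[OF sol t]])
      then have "(?\<phi> has_integral - (?b t - emb s u0)) {0..t}"
        by (rule has_integral_eq[rotated]) (use \<phi> in auto)
      then have i: "integral {0..t} ?\<phi> = emb s ?I"
        by (simp add: integral_unique sobolev_diff[OF u0 ut])
      show "has_sobolev_integral s (\<lambda>\<tau>. bbm_rhs a (u \<tau>)) ?I t"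
        unfolding has_sobolev_integral_iff
      proof (intro conjI)
        show "\<forall>\<tau>\<in>{0..t}. bbm_rhs a (u \<tau>) \<in> sobolev s" using emb_bbm_rhs(1)[OF s a] m t by auto
        show "?I \<in> sobolev s" by (rule sobolev_diff[OF u0 ut])
        show "\<forall>e>0. \<exists>d>0. \<forall>p. p tagged_division_of {0..t} \<and> (\<lambda>\<tau>. ball \<tau> d) fine p \<longrightarrow>
           norm ((\<Sum>(\<tau>, K)\<in>p. measure lborel K *\<^sub>R ?\<phi> \<tau>) - emb s ?I) < e"
          using continuous_uniform_riemann[OF c\<phi>] t unfolding i by auto
      qed
      show "AE x in lborel. u t x = u0 x - ?I x" by simp
    qed
    then show "bbm_solution a s T u0 u"
      unfolding bbm_solution_def using cont m c by blast
  qed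
qed

section \<open>Picard iteration and local well-posedness\<close>

definition loc_lip :: "('a::real_normed_vector \<Rightarrow> 'a) \<Rightarrow> bool" where
  "loc_lip F \<longleftrightarrow> (\<forall>r. \<exists>L>0. \<forall>x y. norm x \<le> r \<longrightarrow> norm y \<le> r \<longrightarrow> norm (F x - F y) \<le> L * norm (x - y))"

lemma has_integral_nonpos:
  fixes f :: "real \<Rightarrow> real"
  assumes "(f has_integral I) S" "\<And>x. x \<in> S \<Longrightarrow> f x \<le> 0"
  shows "I \<le> 0"
  by (rule has_integral_le[OF assms(1) has_integral_0 assms(2)])

lemma ode_sol_0: "ode_sol F T x0 x \<Longrightarrow> x 0 = x0"
  by (simp add: ode_sol_def)

lemma ode_norm_sq_integral:
  fixes x y :: "real \<Rightarrow> 'a::{real_inner, banach}"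
  assumes d: "\<And>t. t \<in> {0..T} \<Longrightarrow> (x has_vector_derivative x' t) (at t within {0..T})"
    and ab: "0 \<le> a" "a \<le> b" "b \<le> T"
  shows "((\<lambda>t. 2 * inner (x t) (x' t)) has_integral ((norm (x b))\<^sup>2 - (norm (x a))\<^sup>2)) {a..b}"
proof (rule fundamental_theorem_of_calculus[OF ab(2)])
  fix t assume t: "t \<in> {a..b}"
  have "(x has_vector_derivative x' t) (at t within {a..b})"
    by (rule has_vector_derivative_within_subset[OF d]) (use t ab in auto)
  from bounded_bilinear.has_vector_derivative[OF bounded_bilinear_inner this this]
  show "((\<lambda>t. (norm (x t))\<^sup>2) has_vector_derivative 2 * inner (x t) (x' t)) (at t within {a..b})"
    by (simp add: power2_norm_eq_inner inner_commute)
qed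

text \<open>The squared norm of \<open>exp (- L t) (x t - y t)\<close> is nonincreasing, because its derivative is
  \<open>2 exp (- 2 L t)\<close> times \<open>\<langle>x - y, F x - F y\<rangle> - L \<bar>x - y\<bar>\<^sup>2 \<le> 0\<close>.\<close>

lemma ode_gronwall:
  fixes x y :: "real \<Rightarrow> 'a::{real_inner, banach}"
  assumes x: "ode_sol F T x0 x" and y: "ode_sol F T y0 y"
    and bx: "\<And>t. t \<in> {0..T} \<Longrightarrow> norm (x t) \<le> r" and by_: "\<And>t. t \<in> {0..T} \<Longrightarrow> norm (y t) \<le> r"
    and L: "\<And>x y. norm x \<le> r \<Longrightarrow> norm y \<le> r \<Longrightarrow> norm (F x - F y) \<le> L * norm (x - y)"
    and t: "t \<in> {0..T}"
  shows "norm (x t - y t) \<le> exp (L * t) * norm (x0 - y0)"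
proof -
  define z where "z \<tau> = exp (- L * \<tau>) *\<^sub>R (x \<tau> - y \<tau>)" for \<tau>
  define z' where "z' \<tau> = exp (- L * \<tau>) *\<^sub>R ((F (x \<tau>) - F (y \<tau>)) - L *\<^sub>R (x \<tau> - y \<tau>))" for \<tau>
  have "(z has_vector_derivative z' \<tau>) (at \<tau> within {0..T})" if "\<tau> \<in> {0..T}" for \<tau>
  proof -
    have d: "((\<lambda>\<tau>. x \<tau> - y \<tau>) has_vector_derivative F (x \<tau>) - F (y \<tau>)) (at \<tau> within {0..T})"
      using x y that unfolding ode_sol_def by (intro has_vector_derivative_diff) auto
    have e: "((\<lambda>\<tau>. exp (- L * \<tau>)) has_real_derivative - L * exp (- L * \<tau>)) (at \<tau> within {0..T})"
      by (auto intro!: derivative_eq_intros)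
    from has_vector_derivative_scaleR[OF e d] show ?thesis
      unfolding z_def z'_def by (simp add: algebra_simps)
  qed
  then have "((\<lambda>\<tau>. 2 * inner (z \<tau>) (z' \<tau>)) has_integral ((norm (z t))\<^sup>2 - (norm (z 0))\<^sup>2)) {0..t}"
    by (rule ode_norm_sq_integral) (use t in auto)
  moreover have "2 * inner (z \<tau>) (z' \<tau>) \<le> 0" if "\<tau> \<in> {0..t}" for \<tau>
  proof -
    have \<tau>: "\<tau> \<in> {0..T}" using that t by auto
    let ?w = "x \<tau> - y \<tau>"
    have "inner ?w (F (x \<tau>) - F (y \<tau>)) \<le> norm ?w * norm (F (x \<tau>) - F (y \<tau>))" by (rule norm_cauchy_schwarz)
    also have "\<dots> \<le> norm ?w * (L * norm ?w)" using L[OF bx[OF \<tau>] by_[OF \<tau>]] by (intro mult_left_mono) auto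
    finally have ip: "inner ?w (F (x \<tau>) - F (y \<tau>)) \<le> norm ?w * (L * norm ?w)" .
    have "inner ?w ((F (x \<tau>) - F (y \<tau>)) - L *\<^sub>R ?w) \<le> 0"
    proof -
      have "inner w (D - L *\<^sub>R w) = inner w D - norm w * (L * norm w)" for w D :: 'a
        by (simp add: inner_diff_right power2_norm_eq_inner[symmetric] power2_eq_square)
      with ip show ?thesis by simp
    qed
    then show ?thesis unfolding z_def z'_def by (simp add: mult_nonneg_nonpos)
  qed
  ultimately have "(norm (z t))\<^sup>2 - (norm (z 0))\<^sup>2 \<le> 0"
    by (rule has_integral_nonpos)
  then have "norm (z t) \<le> norm (z 0)"
    by (intro power2_le_imp_le[of "norm (z t)" "norm (z 0)"]) auto
  then have "exp (- L * t) * norm (x t - y t) \<le> norm (x0 - y0)"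
    unfolding z_def ode_sol_0[OF x] ode_sol_0[OF y] by simp
  then show ?thesis by (simp add: exp_minus field_simps)
qed

lemma ode_sol_bounded:
  fixes x :: "real \<Rightarrow> 'a::real_normed_vector"
  assumes "ode_sol F T x0 x" shows "\<exists>r. \<forall>t\<in>{0..T}. norm (x t) \<le> r"
proof -
  have "compact (x ` {0..T})" by (rule compact_continuous_image[OF ode_sol_continuous[OF assms]]) simp
  then have "bounded (x ` {0..T})" by (rule compact_imp_bounded)
  then show ?thesis unfolding bounded_iff by simp
qed

lemma ode_unique:
  fixes x y :: "real \<Rightarrow> 'a::{real_inner, banach}"
  assumes F: "loc_lip F" and x: "ode_sol F T x0 x" and y: "ode_sol F T x0 y" and t: "t \<in> {0..T}"
  shows "x t = y t"
proof -
  obtain r1 where r1: "\<forall>t\<in>{0..T}. norm (x t) \<le> r1" using ode_sol_bounded[OF x] ..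
  obtain r2 where r2: "\<forall>t\<in>{0..T}. norm (y t) \<le> r2" using ode_sol_bounded[OF y] ..
  define r where "r = max r1 r2"
  obtain L where L: "\<And>x y. norm x \<le> r \<Longrightarrow> norm y \<le> r \<Longrightarrow> norm (F x - F y) \<le> L * norm (x - y)"
    using F unfolding loc_lip_def by blast
  have "norm (x t - y t) \<le> exp (L * t) * norm (x0 - x0)"
  proof (rule ode_gronwall[OF x y _ _ L t])
    show "norm (x t) \<le> r" "norm (y t) \<le> r" if "t \<in> {0..T}" for t
      unfolding r_def using r1[rule_format, OF that] r2[rule_format, OF that] by (simp_all add: le_max_iff_disj)
  qed
  then show ?thesis by simp
qed

text \<open>Radial retraction onto the ball of radius \<open>r\<close>.\<close>

definition radial_cut :: "real \<Rightarrow> 'a::real_normed_vector \<Rightarrow> 'a" where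
  "radial_cut r x = (r / max r (norm x)) *\<^sub>R x"

lemma radial_cut_id: "0 < r \<Longrightarrow> norm x \<le> r \<Longrightarrow> radial_cut r x = x"
  by (simp add: radial_cut_def max_def)

lemma norm_radial_cut: "0 < r \<Longrightarrow> norm (radial_cut r x) \<le> r"
  by (simp add: radial_cut_def max_def field_simps)

text \<open>The constant \<open>2\<close> holds in every normed space; in an inner product space it could be \<open>1\<close>.\<close>

lemma radial_cut_lipschitz:
  assumes r: "0 < r" shows "norm (radial_cut r x - radial_cut r y) \<le> 2 * norm (x - y)"
proof -
  define mx my where "mx = max r (norm x)" and "my = max r (norm y)"
  have m: "0 < mx" "0 < my" "r \<le> mx" "r \<le> my" "norm y \<le> my" using r unfolding mx_def my_def by auto
  have "\<bar>my - mx\<bar> \<le> \<bar>norm y - norm x\<bar>" unfolding mx_def my_def by (auto simp: max_def)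
  also have "\<dots> \<le> norm (x - y)" using norm_triangle_ineq3[of y x] by (simp add: norm_minus_commute)
  finally have d: "\<bar>my - mx\<bar> \<le> norm (x - y)" .
  have eq: "radial_cut r x - radial_cut r y = (r / mx) *\<^sub>R (x - y) + (r / mx - r / my) *\<^sub>R y"
    unfolding radial_cut_def mx_def my_def by (simp add: algebra_simps)
  have "norm (radial_cut r x - radial_cut r y) \<le> norm ((r / mx) *\<^sub>R (x - y)) + norm ((r / mx - r / my) *\<^sub>R y)"
    unfolding eq by (rule norm_triangle_ineq)
  also have "norm ((r / mx) *\<^sub>R (x - y)) \<le> 1 * norm (x - y)"
  proof -
    have "0 \<le> r / mx" "r / mx \<le> 1" using m r by (auto simp: divide_le_eq_1)
    then show ?thesis unfolding norm_scaleR by (intro mult_right_mono) auto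
  qed
  also have "norm ((r / mx - r / my) *\<^sub>R y) = (r / mx) * (norm y / my) * \<bar>my - mx\<bar>"
  proof -
    have "r / mx - r / my = (r / mx) * ((my - mx) / my)" using m by (simp add: field_simps)
    then show ?thesis using m r by (simp add: abs_mult)
  qed
  also have "\<dots> \<le> (1 * 1) * norm (x - y)"
    using m r by (intro mult_mono d) auto
  finally show ?thesis by simp
qed

lemma weighted_integral_bound:
  fixes h :: "real \<Rightarrow> 'a::banach"
  assumes h: "continuous_on {0..t} h" and t: "0 \<le> t" and k: "0 < k" and C: "0 \<le> C"
    and b: "\<And>\<tau>. \<tau> \<in> {0..t} \<Longrightarrow> norm (h \<tau>) \<le> C * exp (k * \<tau>)"
  shows "norm (exp (- k * t) *\<^sub>R integral {0..t} h) \<le> C / k"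
proof -
  have "((\<lambda>\<tau>. C * exp (k * \<tau>)) has_integral (C / k * exp (k * t) - C / k * exp (k * 0))) {0..t}"
  proof (rule fundamental_theorem_of_calculus[OF t])
    fix x
    have "((\<lambda>\<tau>. C / k * exp (k * \<tau>)) has_real_derivative C * exp (k * x)) (at x within {0..t})"
      using k by (auto intro!: derivative_eq_intros)
    then show "((\<lambda>\<tau>. C / k * exp (k * \<tau>)) has_vector_derivative C * exp (k * x)) (at x within {0..t})"
      by (simp add: has_real_derivative_iff_has_vector_derivative)
  qed
  then have i: "(\<lambda>\<tau>. C * exp (k * \<tau>)) integrable_on {0..t}" "integral {0..t} (\<lambda>\<tau>. C * exp (k * \<tau>)) = C / k * (exp (k * t) - 1)"
    by (auto simp: has_integral_iff algebra_simps)
  have "norm (integral {0..t} h) \<le> C / k * (exp (k * t) - 1)"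
    unfolding i(2)[symmetric] by (rule integral_norm_bound_integral[OF integrable_continuous_real[OF h] i(1) b])
  also have "\<dots> \<le> C / k * exp (k * t)" using C k by (intro mult_left_mono) auto
  finally have "exp (- k * t) * norm (integral {0..t} h) \<le> exp (- k * t) * (C / k * exp (k * t))"
    by (intro mult_left_mono) auto
  also have "\<dots> = C / k" by (simp add: exp_minus field_simps)
  finally show ?thesis by simp
qed

lemma continuous_on_integral_max0:
  fixes h :: "real \<Rightarrow> 'a::banach"
  assumes "continuous_on UNIV h" shows "continuous_on UNIV (\<lambda>t. integral {0..max 0 t} h)"
proof (rule continuous_at_imp_continuous_on, rule ballI)
  fix t :: real
  define N where "N = \<bar>t\<bar> + 1"
  have "continuous_on {0..N} (\<lambda>t. integral {0..t} h)"
    by (rule indefinite_integral_continuous_1, rule integrable_continuous_real, rule continuous_on_subset[OF assms]) simp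
  then have "continuous_on {..N} (\<lambda>t. integral {0..max 0 t} h)"
    by (rule continuous_on_compose2) (auto simp: N_def intro!: continuous_intros)
  moreover have "t \<in> interior {..N}" unfolding N_def by auto
  ultimately show "isCont (\<lambda>t. integral {0..max 0 t} h) t" by (rule continuous_on_interior)
qed

text \<open>Picard iteration in the space of bounded continuous functions, for the unknown \<open>exp (- k t) x t\<close> with
  \<open>k = 2 L\<close>. With this weight the integral operator contracts by \<open>L / k = 1/2\<close> on the whole half line, so a single
  fixed point gives the global solution. Negative times are folded to \<open>0\<close> by \<open>max 0 t\<close>, because the function space is
  one of functions on the whole line.\<close>

theorem ode_global_lipschitz:
  fixes F :: "'a::banach \<Rightarrow> 'a"
  assumes L: "\<And>x y. norm (F x - F y) \<le> L * norm (x - y)" and L0: "0 < L"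
  obtains x where "\<And>T. 0 \<le> T \<Longrightarrow> ode_sol F T x0 x"
proof -
  define k where "k = 2 * L"
  have k: "0 < k" using L0 k_def by simp
  have Fc: "continuous_on UNIV F"
    by (rule lipschitz_on_continuous_on[of L], rule lipschitz_onI) (use L L0 in \<open>auto simp: dist_norm\<close>)
  define h where "h y \<tau> = F (exp (k * \<tau>) *\<^sub>R apply_bcontfun y \<tau>)" for y :: "real \<Rightarrow>\<^sub>C 'a" and \<tau>
  have hc: "continuous_on S (h y)" for S y
    unfolding h_def by (intro continuous_on_compose2[OF Fc] continuous_intros) auto
  define P where "P y t = exp (- k * max 0 t) *\<^sub>R (x0 + integral {0..max 0 t} (h y))" for y t
  have Pc: "P y \<in> bcontfun" for y
  proof (rule bcontfun_normI)
    show "continuous_on UNIV (P y)"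
      unfolding P_def by (intro continuous_intros continuous_on_integral_max0 hc)
    fix t :: real
    define m where "m = max 0 t"
    have m: "0 \<le> m" unfolding m_def by simp
    have "norm (h y \<tau>) \<le> (norm (F 0) + L * norm y) * exp (k * \<tau>)" if "\<tau> \<in> {0..m}" for \<tau>
    proof -
      have e1: "1 \<le> exp (k * \<tau>)" using that k by simp
      have "norm (h y \<tau>) \<le> norm (F 0) + norm (F (exp (k * \<tau>) *\<^sub>R apply_bcontfun y \<tau>) - F 0)"
        unfolding h_def by (metis add_diff_cancel_left' add.commute diff_add_cancel norm_triangle_ineq)
      also have "\<dots> \<le> norm (F 0) * exp (k * \<tau>) + L * (exp (k * \<tau>) * norm y)"
      proof (rule add_mono)
        show "norm (F 0) \<le> norm (F 0) * exp (k * \<tau>)" using e1 by (simp add: mult_le_cancel_left1)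
        have "norm (F (exp (k * \<tau>) *\<^sub>R apply_bcontfun y \<tau>) - F 0) \<le> L * (exp (k * \<tau>) * norm (apply_bcontfun y \<tau>))"
          using L[of "exp (k * \<tau>) *\<^sub>R apply_bcontfun y \<tau>" 0] by simp
        also have "\<dots> \<le> L * (exp (k * \<tau>) * norm y)" using L0 by (intro mult_left_mono norm_bounded) auto
        finally show "norm (F (exp (k * \<tau>) *\<^sub>R apply_bcontfun y \<tau>) - F 0) \<le> L * (exp (k * \<tau>) * norm y)" .
      qed
      finally show ?thesis by (simp add: algebra_simps)
    qed
    then have 1: "norm (exp (- k * m) *\<^sub>R integral {0..m} (h y)) \<le> (norm (F 0) + L * norm y) / k"
      using L0 by (intro weighted_integral_bound hc m k) auto
    have "exp (- k * m) \<le> 1" using k m by simp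
    from mult_right_mono[OF this, of "norm x0"] have 2: "norm (exp (- k * m) *\<^sub>R x0) \<le> norm x0" by simp
    have "norm (P y t) \<le> norm (exp (- k * m) *\<^sub>R x0) + norm (exp (- k * m) *\<^sub>R integral {0..m} (h y))"
      unfolding P_def m_def[symmetric] scaleR_add_right by (rule norm_triangle_ineq)
    then show "norm (P y t) \<le> norm x0 + (norm (F 0) + L * norm y) / k" using 1 2 by linarith
  qed
  have "dist (Bcontfun (P y1)) (Bcontfun (P y2)) \<le> (1/2) * dist y1 y2" for y1 y2
  proof (rule dist_bound)
    fix t :: real
    define m where "m = max 0 t"
    have m: "0 \<le> m" unfolding m_def by simp
    have b: "norm (h y1 \<tau> - h y2 \<tau>) \<le> (L * dist y1 y2) * exp (k * \<tau>)" for \<tau>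
    proof -
      have "norm (h y1 \<tau> - h y2 \<tau>) \<le> L * norm (exp (k * \<tau>) *\<^sub>R apply_bcontfun y1 \<tau> - exp (k * \<tau>) *\<^sub>R apply_bcontfun y2 \<tau>)"
        unfolding h_def by (rule L)
      also have "\<dots> = L * (exp (k * \<tau>) * dist (apply_bcontfun y1 \<tau>) (apply_bcontfun y2 \<tau>))"
        by (simp add: dist_norm flip: scaleR_diff_right)
      also have "\<dots> \<le> L * (exp (k * \<tau>) * dist y1 y2)" using L0 by (intro mult_left_mono dist_bounded) auto
      finally show ?thesis by (simp add: mult_ac)
    qed
    have "P y1 t - P y2 t = exp (- k * m) *\<^sub>R integral {0..m} (\<lambda>\<tau>. h y1 \<tau> - h y2 \<tau>)"
      unfolding P_def m_def[symmetric]
      by (subst Henstock_Kurzweil_Integration.integral_diff) (auto intro!: integrable_continuous_real hc simp: algebra_simps)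
    then have "norm (P y1 t - P y2 t) \<le> (L * dist y1 y2) / k"
      using weighted_integral_bound[OF _ m k _ b] L0 by (simp add: continuous_on_diff[OF hc hc])
    also have "\<dots> = (1/2) * dist y1 y2" using L0 unfolding k_def by simp
    finally show "dist (apply_bcontfun (Bcontfun (P y1)) t) (apply_bcontfun (Bcontfun (P y2)) t) \<le> (1/2) * dist y1 y2"
      using Pc by (simp add: Bcontfun_inverse dist_norm)
  qed
  then have "\<exists>!y. Bcontfun (P y) = y" by (intro banach_fix_type[of "1/2"]) auto
  then obtain y where y: "Bcontfun (P y) = y" by blast
  then have y': "apply_bcontfun y t = P y t" for t using Pc Bcontfun_inverse by metis
  define x where "x t = exp (k * t) *\<^sub>R apply_bcontfun y t" for t
  have hx: "h y \<tau> = F (x \<tau>)" for \<tau> by (simp add: h_def x_def)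
  have hh: "h y = (\<lambda>\<tau>. F (x \<tau>))" by (rule ext) (rule hx)
  have eq: "x t = x0 + integral {0..t} (\<lambda>\<tau>. F (x \<tau>))" if "0 \<le> t" for t
  proof -
    have "x t = exp (k * t) *\<^sub>R (exp (- k * t) *\<^sub>R (x0 + integral {0..t} (h y)))"
      using that by (simp only: x_def y' P_def max_absorb2)
    also have "\<dots> = x0 + integral {0..t} (h y)" by (simp add: exp_minus)
    finally show ?thesis unfolding hh .
  qed
  have xc: "continuous_on S (\<lambda>\<tau>. F (x \<tau>))" for S using hc[of S y] unfolding hx .
  have "ode_sol F T x0 x" if "0 \<le> T" for T
    unfolding ode_sol_def
  proof (intro conjI ballI)
    show "x 0 = x0" using eq[of 0] by simp
    fix t assume t: "t \<in> {0..T}"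
    have "((\<lambda>t. integral {0..t} (\<lambda>\<tau>. F (x \<tau>))) has_vector_derivative F (x t)) (at t within {0..T})"
      by (rule integral_has_vector_derivative[OF xc t])
    then have "((\<lambda>t. x0 + integral {0..t} (\<lambda>\<tau>. F (x \<tau>))) has_vector_derivative 0 + F (x t)) (at t within {0..T})"
      by (intro has_vector_derivative_add has_vector_derivative_const)
    then have "((\<lambda>t. x0 + integral {0..t} (\<lambda>\<tau>. F (x \<tau>))) has_vector_derivative F (x t)) (at t within {0..T})" by simp
    then show "(x has_vector_derivative F (x t)) (at t within {0..T})"
      by (rule has_vector_derivative_transform[OF t, rotated]) (auto intro: eq)
  qed
  then show thesis by (rule that)
qed

lemma ode_truncated:
  fixes F :: "'a::banach \<Rightarrow> 'a"
  assumes F: "loc_lip F" and r: "0 < r"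
  obtains x where "\<And>T. 0 \<le> T \<Longrightarrow> ode_sol (\<lambda>z. F (radial_cut r z)) T x0 x"
proof -
  obtain L where L: "L > 0" "\<And>x y. norm x \<le> r \<Longrightarrow> norm y \<le> r \<Longrightarrow> norm (F x - F y) \<le> L * norm (x - y)"
    using F unfolding loc_lip_def by blast
  have "norm (F (radial_cut r x) - F (radial_cut r y)) \<le> (L * 2) * norm (x - y)" for x y
  proof -
    have "norm (F (radial_cut r x) - F (radial_cut r y)) \<le> L * norm (radial_cut r x - radial_cut r y)"
      by (rule L(2)[OF norm_radial_cut[OF r] norm_radial_cut[OF r]])
    also have "\<dots> \<le> L * (2 * norm (x - y))"
      using L(1) by (intro mult_left_mono radial_cut_lipschitz[OF r]) simp
    finally show ?thesis by simp
  qed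
  then show thesis
    by (rule ode_global_lipschitz[of "\<lambda>z. F (radial_cut r z)" "L * 2" x0]) (use L(1) that in auto)
qed

lemma ode_sol_radial_cut:
  assumes "ode_sol (\<lambda>z. F (radial_cut r z)) T x0 x" "0 < r" "\<And>t. t \<in> {0..T} \<Longrightarrow> norm (x t) \<le> r"
  shows "ode_sol F T x0 x"
  using assms unfolding ode_sol_def by (simp add: radial_cut_id)

text \<open>Solve the equation cut off at radius \<open>2 R\<close>. The truncated field is bounded by \<open>B\<close>, so a solution that
  starts in the ball of radius \<open>R\<close> does not reach the cutoff before time \<open>R / B\<close>.\<close>

lemma ode_local:
  fixes F :: "'a::banach \<Rightarrow> 'a"
  assumes F: "loc_lip F" and R: "0 < R"
  shows "\<exists>T>0. \<forall>x0. norm x0 \<le> R \<longrightarrow> (\<exists>x. ode_sol F T x0 x \<and> (\<forall>t\<in>{0..T}. norm (x t) \<le> 2 * R))"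
proof -
  obtain L where L: "L > 0" "\<And>x y. norm x \<le> 2 * R \<Longrightarrow> norm y \<le> 2 * R \<Longrightarrow> norm (F x - F y) \<le> L * norm (x - y)"
    using F unfolding loc_lip_def by blast
  define B where "B = norm (F 0) + L * (2 * R)"
  have B0: "0 < B" unfolding B_def using L(1) R by (simp add: add_nonneg_pos)
  have B: "norm (F z) \<le> B" if "norm z \<le> 2 * R" for z
  proof -
    have "norm (F z) \<le> norm (F 0) + norm (F z - F 0)" by (metis add.commute diff_add_cancel norm_triangle_ineq)
    also have "norm (F z - F 0) \<le> L * norm z" using L(2)[of z 0] that R by simp
    also have "L * norm z \<le> L * (2 * R)" using L(1) that by simp
    finally show ?thesis unfolding B_def by simp
  qed
  have R2: "0 < 2 * R" using R by simp
  show ?thesis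
  proof (intro exI[of _ "R / B"] conjI allI impI)
    show "0 < R / B" using R B0 by simp
    fix x0 :: 'a assume x0: "norm x0 \<le> R"
    obtain x where x: "\<And>T. 0 \<le> T \<Longrightarrow> ode_sol (\<lambda>z. F (radial_cut (2 * R) z)) T x0 x"
      using ode_truncated[OF F R2] by blast
    have b: "norm (x t) \<le> 2 * R" if t: "t \<in> {0..R / B}" for t
    proof -
      have "((\<lambda>\<tau>. F (radial_cut (2 * R) (x \<tau>))) has_integral (x t - x0)) (cbox 0 t)"
        using ode_sol_integral[OF x[of t], of t] t by simp
      then have "norm (x t - x0) \<le> B * measure lborel (cbox 0 t)"
        by (rule has_integral_bound[rotated]) (use B0 B norm_radial_cut[OF R2] in auto)
      also have "\<dots> = B * t" using t by simp
      also have "\<dots> \<le> R" using t B0 by (simp add: field_simps)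
      finally have "norm (x t - x0) \<le> R" .
      moreover have "norm (x t) \<le> norm (x t - x0) + norm x0" by (metis diff_add_cancel norm_triangle_ineq)
      ultimately show ?thesis using x0 by simp
    qed
    have "ode_sol F (R / B) x0 x"
      by (rule ode_sol_radial_cut[OF x R2 b]) (use R B0 in auto)
    with b show "\<exists>x. ode_sol F (R / B) x0 x \<and> (\<forall>t\<in>{0..R / B}. norm (x t) \<le> 2 * R)" by blast
  qed
qed

text \<open>A field with \<open>\<langle>x, F x\<rangle> \<le> 0\<close> keeps this property after composition with the radial retraction, which only
  rescales the argument. Solutions of the truncated equation therefore do not leave the ball and solve the original one.\<close>

lemma ode_dissipative:
  fixes F :: "'a::{real_inner, banach} \<Rightarrow> 'a"
  assumes F: "loc_lip F" and D: "\<And>x. inner x (F x) \<le> 0"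
  obtains x where "\<And>T. 0 \<le> T \<Longrightarrow> ode_sol F T x0 x"
proof -
  \<comment> \<open>The \<open>1\<close> keeps the radius positive for \<open>x0 = 0\<close>.\<close>
  define r where "r = norm x0 + 1"
  have r: "0 < r" unfolding r_def by (simp add: add_nonneg_pos)
  obtain x where x: "\<And>T. 0 \<le> T \<Longrightarrow> ode_sol (\<lambda>z. F (radial_cut r z)) T x0 x"
    using ode_truncated[OF F r] by blast
  have b: "norm (x t) \<le> r" if "0 \<le> t" for t
  proof -
    have "((\<lambda>\<tau>. 2 * inner (x \<tau>) (F (radial_cut r (x \<tau>)))) has_integral ((norm (x t))\<^sup>2 - (norm (x 0))\<^sup>2)) {0..t}"
      by (rule ode_norm_sq_integral[of t]) (use x[OF that] that in \<open>auto simp: ode_sol_def\<close>)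
    moreover have "2 * inner z (F (radial_cut r z)) \<le> 0" for z
    proof -
      define m where "m = r / max r (norm z)"
      have m: "0 < m" unfolding m_def using r by (intro divide_pos_pos) (auto simp: less_max_iff_disj)
      have "m * inner z (F (radial_cut r z)) \<le> 0" using D[of "radial_cut r z"] unfolding radial_cut_def m_def[symmetric] by simp
      then show ?thesis using m by (simp add: mult_le_0_iff)
    qed
    ultimately have "(norm (x t))\<^sup>2 - (norm (x 0))\<^sup>2 \<le> 0"
      by (rule has_integral_nonpos)
    then have "norm (x t) \<le> norm (x 0)"
      by (intro power2_le_imp_le[of "norm (x t)" "norm (x 0)"]) auto
    then show ?thesis unfolding r_def ode_sol_0[OF x[OF order_refl]] by simp
  qed
  have "ode_sol F T x0 x" if "0 \<le> T" for T
    by (rule ode_sol_radial_cut[OF x[OF that] r b]) auto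
  then show thesis by (rule that)
qed

text \<open>The field is a linear map plus a quadratic form, with \<open>x\<^sup>2 - y\<^sup>2 = (x - y) x + y (x - y)\<close> for the
  bilinear map.\<close>

lemma loc_lip_field:
  assumes s: "0 \<le> s" shows "loc_lip (field s \<alpha>)"
  unfolding loc_lip_def
proof
  fix r :: real
  interpret K: bounded_bilinear "wconv s" by (rule bounded_bilinear_wconv[OF s])
  interpret N: bounded_linear "mul half_mult" by (rule bounded_linear_mul[OF multiplier_half])
  interpret D: bounded_linear "mul transport_mult" by (rule bounded_linear_mul[OF multiplier_transport])
  interpret M: bounded_linear "mul deriv_mult" by (rule bounded_linear_mul[OF multiplier_deriv])
  have wconv_const: "0 \<le> wconv_const s" unfolding wconv_const_def by (auto intro!: mult_nonneg_nonneg infsum_nonneg)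
  define L where "L = norm \<alpha> * wconv_const s + 1 + \<bar>r\<bar> * wconv_const s"
  have L0: "0 < L" unfolding L_def using wconv_const by (simp add: add_nonneg_pos add_pos_nonneg)
  have "norm (field s \<alpha> x - field s \<alpha> y) \<le> L * norm (x - y)" if xr: "norm x \<le> r" and yr: "norm y \<le> r" for x y
  proof -
    have e: "field s \<alpha> x - field s \<alpha> y = - (mul half_mult (wconv s \<alpha> (x - y)) + mul transport_mult (x - y) + (1/2) *\<^sub>R mul deriv_mult (wconv s (x - y) x + wconv s y (x - y)))"
    proof -
      have k: "wconv s (x - y) x + wconv s y (x - y) = wconv s x x - wconv s y y" by (simp add: K.diff_left K.diff_right)
      show ?thesis unfolding field_def k K.diff_right[of \<alpha>] N.diff D.diff M.diff
        by (simp add: scaleR_diff_right)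
    qed
    have 1: "norm (mul half_mult (wconv s \<alpha> (x - y))) \<le> norm \<alpha> * norm (x - y) * wconv_const s"
      using norm_mul_le[OF multiplier_half, of "wconv s \<alpha> (x - y)"] norm_wconv_le[OF s, of \<alpha> "x - y"] by simp
    have 2: "norm (mul transport_mult (x - y)) \<le> norm (x - y)" using norm_mul_le[OF multiplier_transport, of "x - y"] by simp
    have k1: "norm (wconv s (x - y) x) \<le> norm (x - y) * \<bar>r\<bar> * wconv_const s"
      using xr by (intro order_trans[OF norm_wconv_le[OF s]] mult_right_mono mult_left_mono wconv_const) auto
    have k2: "norm (wconv s y (x - y)) \<le> \<bar>r\<bar> * norm (x - y) * wconv_const s"
      using yr by (intro order_trans[OF norm_wconv_le[OF s]] mult_right_mono wconv_const) auto
    have 3: "norm ((1/2) *\<^sub>R mul deriv_mult (wconv s (x - y) x + wconv s y (x - y))) \<le> norm (x - y) * \<bar>r\<bar> * wconv_const s"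
      using norm_mul_le[OF multiplier_deriv, of "wconv s (x - y) x + wconv s y (x - y)"] norm_triangle_ineq[of "wconv s (x - y) x" "wconv s y (x - y)"] k1 k2
      by (simp add: algebra_simps)
    have "norm (field s \<alpha> x - field s \<alpha> y) \<le> norm (mul half_mult (wconv s \<alpha> (x - y))) + norm (mul transport_mult (x - y)) + norm ((1/2) *\<^sub>R mul deriv_mult (wconv s (x - y) x + wconv s y (x - y)))"
      unfolding e norm_minus_cancel by (intro order_trans[OF norm_triangle_ineq] add_right_mono norm_triangle_ineq)
    also have "\<dots> \<le> L * norm (x - y)" using 1 2 3 unfolding L_def by (simp add: algebra_simps)
    finally show ?thesis .
  qed
  with L0 show "\<exists>L>0. \<forall>x y. norm x \<le> r \<longrightarrow> norm y \<le> r \<longrightarrow> norm (field s \<alpha> x - field s \<alpha> y) \<le> L * norm (x - y)" by blast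
qed

definition representative :: "real \<Rightarrow> hl2 \<Rightarrow> real \<Rightarrow> real" where
  "representative s b = (SOME f. f \<in> sobolev s \<and> emb s f = b)"

lemma representative: assumes "0 \<le> s" shows "representative s b \<in> sobolev s" "emb s (representative s b) = b"
proof -
  have "\<exists>f. f \<in> sobolev s \<and> emb s f = b" by (rule L2_with_coeffs[OF assms]) blast
  from someI_ex[OF this] show "representative s b \<in> sobolev s" "emb s (representative s b) = b" unfolding representative_def by auto
qed

lemma unique_bbm_solution_representative:
  assumes s: "0 \<le> s" and a: "a \<in> sobolev s" and u0: "u0 \<in> sobolev s" and T: "0 \<le> T"
    and x: "ode_sol (field s (emb s a)) T (emb s u0) x"
  shows "unique_bbm_solution a s T u0 (\<lambda>t. representative s (x t))"
  unfolding unique_bbm_solution_def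
proof (intro conjI allI impI ballI)
  show "bbm_solution a s T u0 (\<lambda>t. representative s (x t))"
    using x by (simp add: bbm_solution_iff[OF s a u0 T] representative[OF s])
  fix w t assume w: "bbm_solution a s T u0 w" and t: "t \<in> {0..T}"
  then have w': "w t \<in> sobolev s" "ode_sol (field s (emb s a)) T (emb s u0) (\<lambda>t. emb s (w t))"
    by (auto simp: bbm_solution_iff[OF s a u0 T])
  have "emb s (w t) = emb s (representative s (x t))"
    using ode_unique[OF loc_lip_field[OF s] w'(2) x t] by (simp add: representative[OF s])
  then show "AE y in lborel. w t y = representative s (x t) y"
    using emb_eq_iff[OF w'(1) representative(1)[OF s]] by blast
qed

text \<open>The time of existence depends only on the radius \<open>R\<close>, and every solution on that interval stays in the ball of
  radius \<open>2 R\<close> by uniqueness. The Lipschitz constant of the field on this ball enters Gronwall's inequality.\<close>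

theorem bbm_local_wellposed:
  assumes s: "0 \<le> s" and a: "a \<in> sobolev s" and R: "0 < R"
  shows "\<exists>T>0.
     (\<forall>u0\<in>sobolev s. sobolev_norm s u0 \<le> R \<longrightarrow> (\<exists>u. unique_bbm_solution a s T u0 u)) \<and>
     (\<exists>L. \<forall>u0\<in>sobolev s. \<forall>w0\<in>sobolev s.
        sobolev_norm s u0 \<le> R \<longrightarrow> sobolev_norm s w0 \<le> R \<longrightarrow>
        (\<forall>u w. bbm_solution a s T u0 u \<longrightarrow> bbm_solution a s T w0 w \<longrightarrow>
           (\<forall>t\<in>{0..T}. sobolev_dist s (u t) (w t) \<le> L * sobolev_dist s u0 w0)))"
proof -
  let ?F = "field s (emb s a)"
  note F = loc_lip_field[OF s, of "emb s a"]
  obtain T where T: "0 < T" and ex: "\<And>x0. norm x0 \<le> R \<Longrightarrow> \<exists>x. ode_sol ?F T x0 x \<and> (\<forall>t\<in>{0..T}. norm (x t) \<le> 2 * R)"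
    using ode_local[OF F R] by blast
  obtain L where L: "L > 0" "\<And>x y. norm x \<le> 2 * R \<Longrightarrow> norm y \<le> 2 * R \<Longrightarrow> norm (?F x - ?F y) \<le> L * norm (x - y)"
    using F unfolding loc_lip_def by blast
  have T0: "0 \<le> T" using T by simp
  have bd: "ode_sol ?F T (emb s u0) (\<lambda>t. emb s (u t)) \<and> (\<forall>t\<in>{0..T}. u t \<in> sobolev s \<and> norm (emb s (u t)) \<le> 2 * R)"
    if u0: "u0 \<in> sobolev s" "sobolev_norm s u0 \<le> R" and u: "bbm_solution a s T u0 u" for u0 u
  proof -
    have m: "\<forall>t\<in>{0..T}. u t \<in> sobolev s" and o: "ode_sol ?F T (emb s u0) (\<lambda>t. emb s (u t))"
      using u by (auto simp: bbm_solution_iff[OF s a u0(1) T0])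
    obtain x where x: "ode_sol ?F T (emb s u0) x" "\<forall>t\<in>{0..T}. norm (x t) \<le> 2 * R"
      using ex[of "emb s u0"] u0 by (auto simp: sobolev_norm_emb)
    have "emb s (u t) = x t" if "t \<in> {0..T}" for t by (rule ode_unique[OF F o x(1) that])
    with m o x(2) show ?thesis by simp
  qed
  show ?thesis
  proof (rule exI[of _ T], intro conjI T, goal_cases)
    case 1
    show ?case
    proof (intro ballI impI)
      fix u0 assume u0: "u0 \<in> sobolev s" "sobolev_norm s u0 \<le> R"
      obtain x where x: "ode_sol ?F T (emb s u0) x"
        using ex[of "emb s u0"] u0 by (auto simp: sobolev_norm_emb)
      then show "\<exists>u. unique_bbm_solution a s T u0 u"
        using unique_bbm_solution_representative[OF s a u0(1) T0] by blast
    qed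
  next
    case 2
    show ?case
    proof (rule exI[of _ "exp (L * T)"], intro ballI impI allI)
      fix u0 w0 u w t
      assume u0: "u0 \<in> sobolev s" "sobolev_norm s u0 \<le> R" and w0: "w0 \<in> sobolev s" "sobolev_norm s w0 \<le> R"
        and u: "bbm_solution a s T u0 u" and w: "bbm_solution a s T w0 w" and t: "t \<in> {0..T}"
      note bu = bd[OF u0 u] and bw = bd[OF w0 w]
      have "norm (emb s (u t) - emb s (w t)) \<le> exp (L * t) * norm (emb s u0 - emb s w0)"
        by (rule ode_gronwall[OF conjunct1[OF bu] conjunct1[OF bw] _ _ L(2) t]) (use bu bw in auto)
      also have "\<dots> \<le> exp (L * T) * norm (emb s u0 - emb s w0)"
        using L(1) t by (intro mult_right_mono) auto
      finally show "sobolev_dist s (u t) (w t) \<le> exp (L * T) * sobolev_dist s u0 w0"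
        using bu bw t u0 w0 by (simp add: sobolev_dist_emb)
    qed
  qed
qed

section \<open>Pointwise values and the energy identity\<close>

text \<open>The Riesz representative of point evaluation on \<open>H\<^sup>1\<close>.\<close>

definition point_kernel :: "real \<Rightarrow> hl2" where
  "point_kernel x = Hl2 (\<lambda>n. complex_of_real (weight (-1) n) * cis (- (of_int n * x)))"

lemma cf_point_kernel: "cf (point_kernel x) n = complex_of_real (weight (-1) n) * cis (- (of_int n * x))"
proof -
  have "l2 (\<lambda>n. complex_of_real (weight (-1) n) * cis (- (of_int n * x)))"
    by (rule l2_mono[of "weight (-1)"]) (simp_all add: weight_m1_sq norm_mult summable_weight)
  moreover have "hermitian (\<lambda>n. complex_of_real (weight (-1) n) * cis (- (of_int n * x)))"
    by (simp add: hermitian_def cis_cnj)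
  ultimately show ?thesis unfolding point_kernel_def by (simp add: cf_Hl2)
qed

definition kernel_norm :: real where "kernel_norm = sqrt (\<Sum>\<^sub>\<infinity>n. weight (-2) n)"

lemma kernel_norm_nonneg [simp]: "0 \<le> kernel_norm" unfolding kernel_norm_def by (intro real_sqrt_ge_zero infsum_nonneg) simp

lemma norm_point_kernel: "norm (point_kernel x) = kernel_norm"
  unfolding norm_eq_l2norm l2norm_def kernel_norm_def by (simp add: cf_point_kernel norm_mult weight_m1_sq)

text \<open>A Hoelder bound with exponent \<open>1/4\<close> for \<open>cis\<close>, deliberately weaker than the Lipschitz bound: at
  frequency \<open>n\<close> its square costs only \<open>sqrt \<bar>n\<bar>\<close>, which the weights can pay for.\<close>

lemma cis_dist_sq: "(cmod (cis a - cis b))\<^sup>2 \<le> 4 * sqrt \<bar>a - b\<bar>"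
proof -
  define d where "d = a - b"
  have "(cmod (cis a - cis b))\<^sup>2 = (cos a - cos b)\<^sup>2 + (sin a - sin b)\<^sup>2" by (simp add: cmod_power2)
  also have "\<dots> = 2 - 2 * cos d"
    unfolding d_def cos_diff using sin_cos_squared_add[of a] sin_cos_squared_add[of b]
    by (simp add: power2_eq_square algebra_simps)
  also have "cos d = 1 - 2 * (sin (d / 2))\<^sup>2" using cos_double_sin[of "d/2"] by simp
  finally have e: "(cmod (cis a - cis b))\<^sup>2 = 4 * (sin (d / 2))\<^sup>2" by simp
  have "(sin (d / 2))\<^sup>2 \<le> sqrt \<bar>d\<bar>"
  proof (cases "1 \<le> \<bar>d\<bar>")
    case True
    have "(sin (d / 2))\<^sup>2 \<le> 1" by (simp add: abs_square_le_1)
    also have "1 \<le> sqrt \<bar>d\<bar>" using True by simp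
    finally show ?thesis .
  next
    case False
    have "\<bar>sin (d / 2)\<bar> \<le> \<bar>d\<bar>" using abs_sin_x_le_abs_x[of "d/2"] by simp
    then have "(sin (d / 2))\<^sup>2 \<le> \<bar>d\<bar>\<^sup>2" using power_mono[of "\<bar>sin (d/2)\<bar>" "\<bar>d\<bar>" 2] by simp
    also have sq: "\<dots> \<le> \<bar>d\<bar>"
      unfolding power2_eq_square using False mult_left_mono[of "\<bar>d\<bar>" 1 "\<bar>d\<bar>"] by linarith
    also have "\<dots> \<le> sqrt \<bar>d\<bar>" by (rule real_le_rsqrt[OF sq])
    finally show ?thesis .
  qed
  then show ?thesis unfolding e d_def by simp
qed

text \<open>After the loss of \<open>sqrt \<bar>n\<bar>\<close> the exponent \<open>- 3/2\<close> is still summable.\<close>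

lemma point_kernel_dist: "(norm (point_kernel x - point_kernel y))\<^sup>2 \<le> 4 * (\<Sum>\<^sub>\<infinity>n. weight (-3/2) n) * sqrt \<bar>x - y\<bar>"
proof -
  have "(norm (point_kernel x - point_kernel y))\<^sup>2 \<le> (\<Sum>\<^sub>\<infinity>n. (4 * sqrt \<bar>x - y\<bar>) * weight (-3/2) n)"
    unfolding norm_hl2_sq
  proof (rule infsum_mono)
    show "(\<lambda>n. (cmod (cf (point_kernel x - point_kernel y) n))\<^sup>2) summable_on UNIV" using cf_l2 by (simp only: l2_def)
    show "(\<lambda>n. (4 * sqrt \<bar>x - y\<bar>) * weight (-3/2) n) summable_on UNIV"
      by (intro summable_on_cmult_right summable_weight) simp
    fix n
    have "cf (point_kernel x - point_kernel y) n = weight (-1) n * (cis (- (of_int n * x)) - cis (- (of_int n * y)))"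
      by (simp add: cf_point_kernel algebra_simps)
    then have "(cmod (cf (point_kernel x - point_kernel y) n))\<^sup>2 = weight (-2) n * (cmod (cis (- (of_int n * x)) - cis (- (of_int n * y))))\<^sup>2"
      by (simp only: norm_mult power_mult_distrib) (simp add: weight_m1_sq)
    also have "\<dots> \<le> weight (-2) n * (4 * sqrt \<bar>- (of_int n * x) - - (of_int n * y)\<bar>)"
      by (intro mult_left_mono cis_dist_sq) simp
    also have "\<bar>- (of_int n * x) - - (of_int n * y)\<bar> = \<bar>real_of_int n\<bar> * \<bar>x - y\<bar>"
      by (simp add: abs_mult[symmetric] algebra_simps)
    also have "sqrt (\<bar>real_of_int n\<bar> * \<bar>x - y\<bar>) \<le> weight (1/2) n * sqrt \<bar>x - y\<bar>"
    proof -
      have "sqrt \<bar>real_of_int n\<bar> \<le> sqrt (weight 1 n)" by (intro real_sqrt_le_mono weight_1_abs)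
      also have "weight 1 n = (weight (1/2) n)\<^sup>2" by (simp add: power2_eq_square weight_add)
      finally have "sqrt \<bar>real_of_int n\<bar> \<le> weight (1/2) n" by simp
      then show ?thesis unfolding real_sqrt_mult by (intro mult_right_mono) auto
    qed
    also have "weight (-2) n * (4 * (weight (1/2) n * sqrt \<bar>x - y\<bar>)) = (4 * sqrt \<bar>x - y\<bar>) * (weight (-2) n * weight (1/2) n)"
      by (simp only: mult_ac)
    also have "weight (-2) n * weight (1/2) n = weight (-3/2) n" by (simp add: weight_add)
    finally show "(cmod (cf (point_kernel x - point_kernel y) n))\<^sup>2 \<le> (4 * sqrt \<bar>x - y\<bar>) * weight (-3/2) n"
      by simp
  qed
  also have "\<dots> = (4 * sqrt \<bar>x - y\<bar>) * (\<Sum>\<^sub>\<infinity>n. weight (-3/2) n)" by (rule infsum_cmult_right')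
  finally show ?thesis by (simp only: mult_ac)
qed

lemma continuous_on_point_kernel: "continuous_on S point_kernel"
proof (rule continuous_on_subset[OF _ subset_UNIV], rule continuous_at_imp_continuous_on, rule ballI)
  fix x :: real
  let ?C = "4 * (\<Sum>\<^sub>\<infinity>n. weight (-3/2) n)"
  have "((\<lambda>y. sqrt (?C * sqrt \<bar>y - x\<bar>)) \<longlongrightarrow> sqrt (?C * sqrt \<bar>x - x\<bar>)) (at x)"
    by (intro tendsto_intros)
  then have z: "((\<lambda>y. sqrt (?C * sqrt \<bar>y - x\<bar>)) \<longlongrightarrow> 0) (at x)" by simp
  have "((\<lambda>y. point_kernel y - point_kernel x) \<longlongrightarrow> 0) (at x)"
    by (rule Lim_null_comparison[OF _ z], rule always_eventually, rule allI, rule real_le_rsqrt, rule point_kernel_dist)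
  then show "isCont point_kernel x" unfolding isCont_def by (rule LIM_zero_cancel)
qed

lemma point_kernel_periodic: "point_kernel (x + 2 * pi) = point_kernel x"
proof (rule hl2_eqI)
  fix n
  have "cis (- (of_int n * (x + 2 * pi))) = cis (- (of_int n * x)) * cis (- (of_int n * (2 * pi)))"
    by (simp only: cis_mult) (simp add: algebra_simps)
  then have "cis (- (of_int n * (x + 2 * pi))) = cis (- (of_int n * x))" by (simp only: cis_full_turns mult_1_right)
  then show "cf (point_kernel (x + 2 * pi)) n = cf (point_kernel x) n" unfolding cf_point_kernel by (simp only:)
qed

text \<open>The continuous representative of the \<open>H\<^sup>1\<close> function with sequence \<open>b\<close>. As a function of \<open>b\<close> it is a
  bounded linear functional for each \<open>x\<close>, so it commutes with time derivatives and weak limits.\<close>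

definition ev :: "hl2 \<Rightarrow> real \<Rightarrow> real" where
  "ev b x = inner b (point_kernel x)"

lemma ev_bound: "\<bar>ev b x\<bar> \<le> norm b * kernel_norm"
  unfolding ev_def using Cauchy_Schwarz_ineq2[of b "point_kernel x"] by (simp add: norm_point_kernel)

lemma continuous_on_ev: "continuous_on S b \<Longrightarrow> continuous_on S x \<Longrightarrow> continuous_on S (\<lambda>z. ev (b z) (x z))"
  unfolding ev_def
  by (intro continuous_intros continuous_on_compose2[OF continuous_on_point_kernel[of UNIV]]) auto

lemma ev_periodic: "ev b (x + 2 * pi) = ev b x"
  by (simp add: ev_def point_kernel_periodic)

lemma trigsum_tendsto_ev: "(\<lambda>N. trigsum (unweight 1 b) N x) \<longlonglongrightarrow> ev b x"
proof -
  have "((\<lambda>n. inner (cf b n) (cf (point_kernel x) n)) has_sum ev b x) UNIV"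
    unfolding ev_def inner_hl2_def by (rule has_sum_infsum[OF cf_inner_summable])
  from has_sum_sym_limit[OF this]
  have "(\<lambda>N. \<Sum>n\<in>{- int N..int N}. inner (cf b n) (cf (point_kernel x) n)) \<longlonglongrightarrow> ev b x" .
  moreover have "inner (cf b n) (cf (point_kernel x) n) = Re (unweight 1 b n * cis (of_int n * x))" for n
    by (simp add: cf_point_kernel unweight_def inner_complex_def algebra_simps)
  ultimately show ?thesis unfolding trigsum_def Re_sum by simp
qed

text \<open>The partial Fourier sums converge to \<open>f\<close> in \<open>L\<^sup>2\<close> and to \<open>ev (emb 1 f)\<close> pointwise; by Fatou's
  lemma the two limits agree.\<close>

lemma ev_AE:
  assumes f: "f \<in> sobolev 1" shows "AE x in lborel. ev (emb 1 f) x = f x"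
proof -
  let ?b = "emb 1 f"
  note fL = sobolev_L2[OF f]
  have c: "unweight 1 ?b = fourier_coeff f" by (rule unweight_emb[OF f])
  let ?S = "\<lambda>N. trigsum (fourier_coeff f) N"
  have Sm[measurable]: "?S N \<in> borel_measurable circ" for N by (rule L2_torusD(3)[OF trigsum_L2])
  have em: "ev ?b \<in> borel_measurable borel"
    by (rule borel_measurable_continuous_onI, rule continuous_on_ev) (intro continuous_intros)+
  have [measurable]: "ev ?b \<in> borel_measurable circ" by (rule circ_measurable[OF em])
  have [measurable]: "f \<in> borel_measurable circ" by (rule L2_torusD(3)[OF fL])
  have "(\<integral>\<^sup>+x. ennreal ((f x - ev ?b x)\<^sup>2) \<partial>circ) = (\<integral>\<^sup>+x. liminf (\<lambda>N. ennreal ((f x - ?S N x)\<^sup>2)) \<partial>circ)"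
  proof (rule nn_integral_cong)
    fix x
    have "(\<lambda>N. ennreal ((f x - ?S N x)\<^sup>2)) \<longlonglongrightarrow> ennreal ((f x - ev ?b x)\<^sup>2)"
      using trigsum_tendsto_ev[of ?b x] unfolding c by (intro tendsto_intros)
    from lim_imp_Liminf[OF sequentially_bot this]
    show "ennreal ((f x - ev ?b x)\<^sup>2) = liminf (\<lambda>N. ennreal ((f x - ?S N x)\<^sup>2))" by simp
  qed
  also have "\<dots> \<le> liminf (\<lambda>N. \<integral>\<^sup>+x. ennreal ((f x - ?S N x)\<^sup>2) \<partial>circ)"
    by (rule nn_integral_liminf) measurable
  also have "\<dots> = liminf (\<lambda>N. ennreal (\<integral>x. (f x - ?S N x)\<^sup>2 \<partial>circ))"
    using L2_torusD(4)[OF L2_diff[OF fL trigsum_L2]] by (simp add: nn_integral_eq_integral)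
  also have "\<dots> = 0"
  proof -
    have "(\<lambda>N. ennreal (\<integral>x. (f x - ?S N x)\<^sup>2 \<partial>circ)) \<longlonglongrightarrow> ennreal 0"
      by (intro tendsto_ennrealI trigsum_tendsto fL)
    from lim_imp_Liminf[OF sequentially_bot this] show ?thesis by simp
  qed
  finally have "(\<integral>\<^sup>+x. ennreal ((f x - ev ?b x)\<^sup>2) \<partial>circ) = 0" by simp
  then have "AE x in circ. ennreal ((f x - ev ?b x)\<^sup>2) = 0"
    by (subst (asm) nn_integral_0_iff_AE) measurable
  then have "AE x in circ. ev ?b x = f x" by eventually_elim (simp add: ennreal_eq_0_iff)
  moreover have "ev ?b (x + 2 * pi) = f (x + 2 * pi) \<longleftrightarrow> ev ?b x = f x" for x
    using L2_torusD(1)[OF fL] by (simp add: ev_periodic torus_periodic_def)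
  ultimately show ?thesis by (rule circ_AE_periodic)
qed

lemma ev_sobolev: "ev b \<in> sobolev 1" and emb_ev: "emb 1 (ev b) = b"
proof -
  obtain f where f: "f \<in> sobolev 1" "emb 1 f = b" by (rule L2_with_coeffs[of 1 b]) auto
  have ae: "AE x in lborel. ev b x = f x" using ev_AE[OF f(1)] f(2) by simp
  have c: "continuous_on UNIV (ev b)" by (rule continuous_on_ev) (intro continuous_intros)+
  have L: "ev b \<in> L2_torus"
    by (rule continuous_L2[OF _ c]) (simp add: torus_periodic_def ev_periodic)
  have "fourier_coeff (ev b) n = fourier_coeff f n" for n
    by (rule fourier_coeff_cong_AE[OF ae]) (rule L2_torusD[OF L] L2_torusD[OF sobolev_L2[OF f(1)]])+
  then have cc: "fourier_coeff (ev b) = fourier_coeff f" by (rule ext)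
  show s: "ev b \<in> sobolev 1" using f(1) L unfolding sobolev_iff cc by simp
  show "emb 1 (ev b) = b" using emb_eq_iff[OF s f(1)] ae f(2) by simp
qed

text \<open>A nonempty open set is not negligible.\<close>

lemma continuous_AE_eq_imp_eq:
  fixes g h :: "real \<Rightarrow> real"
  assumes "continuous_on UNIV g" "continuous_on UNIV h" and ae: "AE x in lborel. g x = h x"
  shows "g = h"
proof (rule ccontr)
  assume "g \<noteq> h"
  have o: "open {x. g x \<noteq> h x}" by (rule open_Collect_neq[OF assms(1,2)])
  have ne: "{x. g x \<noteq> h x} \<noteq> {}" using \<open>g \<noteq> h\<close> by auto
  obtain N where N: "\<And>x. x \<in> space lborel - N \<Longrightarrow> g x = h x" "N \<in> null_sets lborel"
    using AE_E3[OF ae] by blast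
  have "negligible N" using null_sets_completionI[OF N(2)] by (simp add: negligible_iff_null_sets)
  then have "negligible {x. g x \<noteq> h x}" by (rule negligible_subset) (use N(1) in auto)
  then show False using open_not_negligible[OF o ne] by blast
qed

lemma cont_rep_ev:
  assumes "f \<in> sobolev 1" shows "cont_rep f = ev (emb 1 f)"
  unfolding cont_rep_def
proof (rule the_equality)
  have c: "continuous_on UNIV (ev (emb 1 f))" by (rule continuous_on_ev) (intro continuous_intros)+
  then show "continuous_on UNIV (ev (emb 1 f)) \<and> (AE x in lborel. ev (emb 1 f) x = f x)" using ev_AE[OF assms] by blast
  fix g assume g: "continuous_on UNIV g \<and> (AE x in lborel. g x = f x)"
  have "AE x in lborel. g x = ev (emb 1 f) x" using conjunct2[OF g] ev_AE[OF assms] by eventually_elim simp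
  then show "g = ev (emb 1 f)" using continuous_AE_eq_imp_eq[of g "ev (emb 1 f)"] g c by blast
qed

lemma L2_sobolev_0: "f \<in> L2_torus \<Longrightarrow> f \<in> sobolev 0"
  using bessel[of f] by (simp add: sobolev_iff l2_def)

lemma cf_emb_0: "f \<in> L2_torus \<Longrightarrow> cf (emb 0 f) n = fourier_coeff f n"
  by (simp add: cf_emb[OF L2_sobolev_0])

text \<open>The convolution formula at frequency \<open>0\<close>.\<close>

lemma parseval:
  assumes f: "f \<in> L2_torus" and g: "g \<in> L2_torus"
  shows "(\<integral>x. f x * g x \<partial>circ) = 2 * pi * inner (emb 0 f) (emb 0 g)"
proof -
  have s: "(\<lambda>k. fourier_coeff f k * fourier_coeff g (0 - k)) summable_on UNIV"
    by (rule conv_summable) (use bessel f g in \<open>auto simp: l2_def\<close>)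
  have "complex_of_real (\<integral>x. f x * g x \<partial>circ) = of_real (2 * pi) * (\<Sum>\<^sub>\<infinity>k. fourier_coeff f k * fourier_coeff g (0 - k))"
    unfolding fourier_coeff_zero fourier_coeff_mult[OF f g] ..
  then have "(\<integral>x. f x * g x \<partial>circ) = Re (of_real (2 * pi) * (\<Sum>\<^sub>\<infinity>k. fourier_coeff f k * fourier_coeff g (0 - k)))"
    by (metis Re_complex_of_real)
  also have "\<dots> = 2 * pi * Re (\<Sum>\<^sub>\<infinity>k. fourier_coeff f k * fourier_coeff g (0 - k))" by simp
  also have "Re (\<Sum>\<^sub>\<infinity>k. fourier_coeff f k * fourier_coeff g (0 - k)) = (\<Sum>\<^sub>\<infinity>k. Re (fourier_coeff f k * fourier_coeff g (0 - k)))"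
    by (rule infsum_Re[OF s, symmetric])
  also have "\<dots> = inner (emb 0 f) (emb 0 g)"
    unfolding inner_hl2_def
    by (intro infsum_cong) (simp add: cf_emb_0 f g fourier_coeff_minus_index inner_complex_def)
  finally show ?thesis .
qed

lemma inner_hl2_cong:
  "(\<And>n. inner (cf x n) (cf y n) = inner (cf x' n) (cf y' n)) \<Longrightarrow> inner x y = inner x' y'"
  by (simp add: inner_hl2_def)

lemma inner_of_real_mult: "inner (complex_of_real r * z) w = r * inner z w" "inner z (complex_of_real r * w) = r * inner z w"
  by (simp_all add: inner_complex_def algebra_simps)

text \<open>The symbol \<open>\<i> n / (1 + n\<^sup>2)\<close> is skew.\<close>

lemma transport_energy:
  "inner b (mul transport_mult b) = 0"
proof -
  have "inner (cf b n) (cf (mul transport_mult b) n) = inner (cf 0 n) (cf 0 n)" for n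
    by (simp add: cf_mul[OF multiplier_transport] transport_mult_def inner_complex_def)
  then have "inner b (mul transport_mult b) = inner (0::hl2) 0" by (rule inner_hl2_cong)
  then show ?thesis by simp
qed

lemma damping_energy:
  assumes a: "a \<in> sobolev 1" and f: "f \<in> sobolev 1" and af: "(\<lambda>x. a x * f x) \<in> L2_torus"
  shows "2 * pi * inner (emb 1 f) (mul half_mult (wconv 1 (emb 1 a) (emb 1 f))) = (\<integral>x. a x * (f x)\<^sup>2 \<partial>circ)"
proof -
  have "inner (emb 1 f) (mul half_mult (wconv 1 (emb 1 a) (emb 1 f))) = inner (emb 0 f) (emb 0 (\<lambda>x. a x * f x))"
  proof (rule inner_hl2_cong)
    fix n
    have "cf (wconv 1 (emb 1 a) (emb 1 f)) n = fourier_coeff (\<lambda>x. a x * f x) n"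
      using coeff_mult_wconv[of 1 a f n] a f by simp
    then show "inner (cf (emb 1 f) n) (cf (mul half_mult (wconv 1 (emb 1 a) (emb 1 f))) n) = inner (cf (emb 0 f) n) (cf (emb 0 (\<lambda>x. a x * f x)) n)"
      by (simp add: cf_mul[OF multiplier_half] cf_emb[OF f] cf_emb_0[OF sobolev_L2[OF f]] cf_emb_0[OF af] inner_of_real_mult weight_add mult.assoc[symmetric])
  qed
  then show ?thesis
    using parseval[OF sobolev_L2[OF f] af] by (simp add: power2_eq_square mult_ac)
qed

text \<open>With \<open>f\<close> the function of \<open>b\<close> and \<open>h = f'\<close> in \<open>L\<^sup>2\<close>, this is
  \<open>\<integral> f (f\<^sup>2)' = 0\<close>. Put \<open>I = \<integral> f\<^sup>2 h\<close>. Integration by parts gives \<open>- I\<close>, and the Leibniz rule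
  \<open>(f\<^sup>2)' = 2 f h\<close> gives \<open>2 I\<close>. Both are read off from coefficients, since \<open>h\<close> has only the regularity of
  \<open>L\<^sup>2\<close>.\<close>

lemma cubic_energy: "inner b (mul deriv_mult (wconv 1 b b)) = 0"
proof -
  define f where "f = ev b"
  have f1: "f \<in> sobolev 1" and eb: "emb 1 f = b" unfolding f_def by (rule ev_sobolev emb_ev)+
  have fL: "f \<in> L2_torus" by (rule sobolev_L2[OF f1])
  have fb: "\<bar>f x\<bar> \<le> norm b * kernel_norm" for x unfolding f_def by (rule ev_bound)
  obtain h where h: "h \<in> sobolev 0" "emb 0 h = mul deriv_mult b" by (rule L2_with_coeffs[of 0 "mul deriv_mult b"]) auto
  have hL: "h \<in> L2_torus" by (rule sobolev_L2[OF h(1)])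
  have ffL: "(\<lambda>x. f x * f x) \<in> L2_torus" and fhL: "(\<lambda>x. f x * h x) \<in> L2_torus"
    by (rule bounded_mult_L2[OF _ L2_torusD(1,2)[OF fL] fb], rule fL hL)+
  have hn: "fourier_coeff h n = \<i> * of_int n * fourier_coeff f n" for n
  proof -
    have "fourier_coeff h n = deriv_mult n * cf (emb 1 f) n"
      using cf_emb_0[OF hL, of n] unfolding h(2) eb by (simp add: cf_mul[OF multiplier_deriv])
    also have "\<dots> = \<i> * of_int n * (complex_of_real (weight (-1) n * weight 1 n) * fourier_coeff f n)"
      by (simp add: cf_emb[OF f1] deriv_mult_def mult_ac)
    finally show ?thesis by (simp add: weight_add)
  qed
  have Kn: "cf (wconv 1 b b) n = fourier_coeff (\<lambda>x. f x * f x) n" for n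
    using coeff_mult_wconv[of 1 f f n] f1 by (simp add: eb)
  have bn: "cf b n = complex_of_real (weight 1 n) * fourier_coeff f n" for n
    using cf_emb[OF f1, of n] by (simp add: eb)
  have term_: "inner (cf b n) (cf (mul deriv_mult (wconv 1 b b)) n) = inner (fourier_coeff f n) (\<i> * of_int n * fourier_coeff (\<lambda>x. f x * f x) n)" for n
  proof -
    have g: "inner (complex_of_real r * c) (complex_of_real q * z) = (r * q) * inner c z" for r q c z
      by (simp add: inner_of_real_mult)
    have kn: "cf (mul deriv_mult (wconv 1 b b)) n = complex_of_real (weight (-1) n) * (\<i> * of_int n * fourier_coeff (\<lambda>x. f x * f x) n)"
      by (simp add: cf_mul[OF multiplier_deriv] deriv_mult_def Kn mult_ac)
    have "inner (cf b n) (cf (mul deriv_mult (wconv 1 b b)) n) = (weight 1 n * weight (-1) n) * inner (fourier_coeff f n) (\<i> * of_int n * fourier_coeff (\<lambda>x. f x * f x) n)"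
      unfolding bn kn by (rule g)
    then show ?thesis by (simp add: weight_add)
  qed
  define I where "I = inner (emb 0 (\<lambda>x. f x * f x)) (emb 0 h)"
  have 1: "inner b (mul deriv_mult (wconv 1 b b)) = inner (- emb 0 (\<lambda>x. f x * f x)) (emb 0 h)"
  proof (rule inner_hl2_cong)
    fix n
    have "inner z (\<i> * of_int n * w) = inner (- w) (\<i> * of_int n * z)" for z w :: complex
      by (simp add: inner_complex_def algebra_simps)
    then show "inner (cf b n) (cf (mul deriv_mult (wconv 1 b b)) n) = inner (cf (- emb 0 (\<lambda>x. f x * f x)) n) (cf (emb 0 h) n)"
      unfolding term_ by (simp only: cf_uminus cf_emb_0[OF ffL] cf_emb_0[OF hL] hn)
  qed
  \<comment> \<open>The Leibniz rule for coefficients: \<open>n = k + (n - k)\<close> under the convolution sum.\<close>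
  have leib: "\<i> * of_int n * fourier_coeff (\<lambda>x. f x * f x) n = 2 * fourier_coeff (\<lambda>x. f x * h x) n" for n
  proof -
    let ?c = "fourier_coeff f" and ?d = "fourier_coeff h"
    have lc: "l2 ?c" "l2 ?d" using bessel fL hL by (auto simp: l2_def)
    have "2 * fourier_coeff (\<lambda>x. f x * h x) n = fourier_coeff (\<lambda>x. f x * h x) n + fourier_coeff (\<lambda>x. h x * f x) n"
      by (simp add: mult.commute)
    also have "\<dots> = (\<Sum>\<^sub>\<infinity>k. ?c k * ?d (n - k)) + (\<Sum>\<^sub>\<infinity>k. ?d k * ?c (n - k))"
      by (simp only: fourier_coeff_mult[OF fL hL] fourier_coeff_mult[OF hL fL])
    also have "\<dots> = (\<Sum>\<^sub>\<infinity>k. ?c k * ?d (n - k) + ?d k * ?c (n - k))"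
      by (rule infsum_add[symmetric]; rule conv_summable lc; rule lc)
    also have "\<dots> = (\<Sum>\<^sub>\<infinity>k. (\<i> * of_int n) * (?c k * ?c (n - k)))"
      unfolding hn by (simp add: algebra_simps)
    also have "\<dots> = \<i> * of_int n * (\<Sum>\<^sub>\<infinity>k. ?c k * ?c (n - k))" by (rule infsum_cmult_right')
    finally show ?thesis by (simp only: fourier_coeff_mult[OF fL fL])
  qed
  have 2: "inner b (mul deriv_mult (wconv 1 b b)) = inner (2 *\<^sub>R emb 0 f) (emb 0 (\<lambda>x. f x * h x))"
  proof (rule inner_hl2_cong)
    fix n
    have "inner z (2 * w) = inner (complex_of_real 2 * z) w" for z w :: complex
      by (simp add: inner_complex_def algebra_simps)
    then show "inner (cf b n) (cf (mul deriv_mult (wconv 1 b b)) n) = inner (cf (2 *\<^sub>R emb 0 f) n) (cf (emb 0 (\<lambda>x. f x * h x)) n)"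
      unfolding term_ leib by (simp only: cf_scaleR cf_emb_0[OF fL] cf_emb_0[OF fhL])
  qed
  have "2 * pi * inner (emb 0 f) (emb 0 (\<lambda>x. f x * h x)) = 2 * pi * I"
    unfolding I_def parseval[OF fL fhL, symmetric] parseval[OF ffL hL, symmetric] by (simp only: mult.assoc)
  then have "inner (emb 0 f) (emb 0 (\<lambda>x. f x * h x)) = I" by simp
  with 1 2 show ?thesis unfolding I_def by simp
qed

lemma torus_smooth_facts:
  assumes "torus_smooth a"
  shows "torus_periodic a" "continuous_on UNIV a" "a \<in> borel_measurable borel" "\<exists>A. \<forall>x. \<bar>a x\<bar> \<le> A"
proof -
  show p: "torus_periodic a" using assms by (simp add: torus_smooth_def)
  have "a field_differentiable (at x)" for x
    using assms unfolding torus_smooth_def by (metis funpow_0)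
  then show c: "continuous_on UNIV a"
    by (intro continuous_at_imp_continuous_on ballI field_differentiable_imp_continuous_at)
  show "a \<in> borel_measurable borel" by (rule borel_measurable_continuous_onI[OF c])
  have "compact (a ` {0..2*pi})" by (rule compact_continuous_image[OF continuous_on_subset[OF c]]) auto
  then have "bounded (a ` {0..2*pi})" by (rule compact_imp_bounded)
  then obtain A where "\<forall>y\<in>a ` {0..2*pi}. norm y \<le> A" unfolding bounded_iff by blast
  then have A: "\<bar>a x\<bar> \<le> A" if "x \<in> {0..2*pi}" for x using that by simp
  have "\<bar>a x\<bar> \<le> A" for x
  proof -
    obtain k :: int where k: "x - of_int k * (2 * pi) \<in> {0..2 * pi}" by (rule reduce_to_period)
    from A[OF k] show ?thesis using torus_periodic_int[OF p, of "x - of_int k * (2 * pi)" k] by simp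
  qed
  then show "\<exists>A. \<forall>x. \<bar>a x\<bar> \<le> A" by blast
qed

definition dissip :: "(real \<Rightarrow> real) \<Rightarrow> hl2 \<Rightarrow> real" where
  "dissip a b = (\<integral>x. a x * (ev b x)\<^sup>2 \<partial>circ)"

lemma smooth_mult_L2:
  assumes "torus_smooth a" "f \<in> L2_torus" shows "(\<lambda>x. a x * f x) \<in> L2_torus"
proof -
  obtain A where "\<And>x. \<bar>a x\<bar> \<le> A" using torus_smooth_facts(4)[OF assms(1)] by blast
  then show ?thesis by (rule bounded_mult_L2[OF assms(2) torus_smooth_facts(1,3)[OF assms(1)]])
qed

text \<open>In \<open>H\<^sup>1\<close> the inner product with \<open>(1 - \<partial>\<^sub>x\<^sup>2)\<^sup>-\<^sup>1 f\<close> is the \<open>L\<^sup>2\<close> inner product with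
  \<open>f\<close>. The factor \<open>2 pi\<close> comes from the normalisation of the coefficients.\<close>

lemma energy_identity:
  assumes a: "torus_smooth a"
  shows "2 * pi * inner b (field 1 (emb 1 a) b) = - dissip a b"
proof -
  have "2 * pi * inner b (mul half_mult (wconv 1 (emb 1 a) b)) = dissip a b"
    using damping_energy[OF smooth_sobolev[OF a] ev_sobolev smooth_mult_L2[OF a sobolev_L2[OF ev_sobolev]], of b]
    by (simp add: emb_ev dissip_def)
  then show ?thesis
    unfolding field_def by (simp add: inner_add_right inner_minus_right inner_diff_right transport_energy cubic_energy)
qed

lemma dissip_nonneg: "(\<And>x. 0 \<le> a x) \<Longrightarrow> 0 \<le> dissip a b"
  unfolding dissip_def by (intro Bochner_Integration.integral_nonneg mult_nonneg_nonneg) auto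

lemma field_dissipative:
  assumes "torus_smooth a" "\<And>x. 0 \<le> a x"
  shows "inner b (field 1 (emb 1 a) b) \<le> 0"
proof -
  have "2 * pi * inner b (field 1 (emb 1 a) b) \<le> 0"
    using energy_identity[OF assms(1), of b] dissip_nonneg[of a b] assms(2) by simp
  then show ?thesis using pi_gt_zero unfolding mult_le_0_iff by linarith
qed

lemma energy_nonincreasing:
  assumes a: "torus_smooth a" "\<And>x. 0 \<le> a x" and x: "ode_sol (field 1 (emb 1 a)) T x0 x"
    and t: "0 \<le> t1" "t1 \<le> t2" "t2 \<le> T"
  shows "norm (x t2) \<le> norm (x t1)"
proof -
  have "((\<lambda>t. 2 * inner (x t) (field 1 (emb 1 a) (x t))) has_integral ((norm (x t2))\<^sup>2 - (norm (x t1))\<^sup>2)) {t1..t2}"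
    by (rule ode_norm_sq_integral[of T, OF _ t]) (use x in \<open>simp add: ode_sol_def\<close>)
  then have "(norm (x t2))\<^sup>2 - (norm (x t1))\<^sup>2 \<le> 0"
    by (rule has_integral_nonpos) (simp add: field_dissipative[OF a])
  then show ?thesis by (intro power2_le_imp_le[of "norm (x t2)" "norm (x t1)"]) auto
qed

lemma bbm_global_flow:
  assumes a: "torus_smooth a" "\<And>x. 0 \<le> a x"
  obtains x where "\<And>T. 0 \<le> T \<Longrightarrow> ode_sol (field 1 (emb 1 a)) T x0 x"
  by (rule ode_dissipative[OF loc_lip_field[of 1] field_dissipative[OF a]]) auto

theorem bbm_global_wellposed:
  assumes a: "torus_smooth a" "\<And>x. 0 \<le> a x" and u0: "u0 \<in> sobolev 1"
  shows "\<exists>u. (\<forall>T>0. unique_bbm_solution a 1 T u0 u) \<and>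
     (\<forall>t1 t2. 0 \<le> t1 \<longrightarrow> t1 \<le> t2 \<longrightarrow> (sobolev_norm 1 (u t2))\<^sup>2 \<le> (sobolev_norm 1 (u t1))\<^sup>2)"
proof -
  obtain x where x: "\<And>T. 0 \<le> T \<Longrightarrow> ode_sol (field 1 (emb 1 a)) T (emb 1 u0) x"
    using bbm_global_flow[OF a] by blast
  have "\<forall>T>0. unique_bbm_solution a 1 T u0 (\<lambda>t. representative 1 (x t))"
    using unique_bbm_solution_representative[OF _ smooth_sobolev[OF a(1)] u0 _ x] by simp
  moreover have "(sobolev_norm 1 (representative 1 (x t2)))\<^sup>2 \<le> (sobolev_norm 1 (representative 1 (x t1)))\<^sup>2" if "0 \<le> t1" "t1 \<le> t2" for t1 t2
    using energy_nonincreasing[OF a x that order_refl] that by (simp add: sobolev_norm_emb representative)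
  ultimately show ?thesis by blast
qed

section \<open>Weak convergence\<close>

text \<open>The representative is the minimiser of \<open>J x = \<bar>x\<bar>\<^sup>2 - 2 l x\<close>. Minimising sequences are Cauchy by
  the parallelogram identity, and the first variation of \<open>J\<close> at the minimiser vanishes.\<close>

lemma riesz_representation:
  fixes l :: "'a::{real_inner, complete_space} \<Rightarrow> real"
  assumes "bounded_linear l"
  obtains w where "\<And>x. l x = inner x w"
proof -
  interpret l: bounded_linear l by fact
  obtain C where C: "\<And>x. \<bar>l x\<bar> \<le> norm x * C" using l.bounded by auto
  define J where "J x = (norm x)\<^sup>2 - 2 * l x" for x
  have lower: "- C\<^sup>2 \<le> J x" for x
  proof -
    have "2 * l x \<le> 2 * (norm x * C)" using C[of x] by linarith
    moreover have "0 \<le> (norm x - C)\<^sup>2" by simp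
    ultimately show ?thesis unfolding J_def by (simp add: power2_diff)
  qed
  define m where "m = Inf (range J)"
  have bdd: "bdd_below (range J)" by (rule bdd_belowI2[of _ "- C\<^sup>2"]) (rule lower)
  have m: "m \<le> J x" for x unfolding m_def by (rule cINF_lower[OF bdd]) simp
  have "\<exists>x. J x < m + 1 / real (Suc n)" for n
    using cInf_lessD[of "range J" "m + 1 / real (Suc n)"] unfolding m_def by auto
  then obtain X where X: "\<And>n. J (X n) < m + 1 / real (Suc n)" by metis
  \<comment> \<open>The parallelogram identity for the functional \<open>J\<close>; its linear part cancels.\<close>
  have par: "(norm (x - y))\<^sup>2 = 2 * J x + 2 * J y - 4 * J ((1/2) *\<^sub>R (x + y))" for x y
    unfolding J_def by (simp add: power2_norm_eq_inner inner_diff inner_add l.add l.scaleR inner_commute algebra_simps)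
  have "Cauchy X"
  proof (rule metric_CauchyI)
    fix e :: real assume e: "0 < e"
    obtain N where N: "4 / real (Suc N) < e\<^sup>2"
    proof -
      obtain N where "1 / real (Suc N) < e\<^sup>2 / 4"
        using nat_approx_posE[of "e\<^sup>2 / 4"] e by auto
      then show thesis using that[of N] by simp
    qed
    have "dist (X i) (X j) < e" if "i \<ge> N" "j \<ge> N" for i j
    proof -
      have a: "1 / real (Suc k) \<le> 1 / real (Suc N)" if "k \<ge> N" for k
        using that by (intro divide_left_mono) auto
      have "(norm (X i - X j))\<^sup>2 \<le> 2 * J (X i) + 2 * J (X j) - 4 * m"
        unfolding par using m[of "(1/2) *\<^sub>R (X i + X j)"] by linarith
      also have "\<dots> < 4 * (1 / real (Suc N))" using X[of i] X[of j] a[OF that(1)] a[OF that(2)] by linarith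
      finally have "(norm (X i - X j))\<^sup>2 < e\<^sup>2" using N by simp
      then show ?thesis using e unfolding dist_norm by (rule power2_less_imp_less[OF _ less_imp_le])
    qed
    then show "\<exists>N. \<forall>i\<ge>N. \<forall>j\<ge>N. dist (X i) (X j) < e" by blast
  qed
  then obtain w where w: "X \<longlonglongrightarrow> w" using Cauchy_convergent convergent_def by blast
  have "(\<lambda>n. J (X n)) \<longlonglongrightarrow> J w" unfolding J_def by (intro tendsto_intros l.tendsto w)
  moreover have "(\<lambda>n. m + 1 / real (Suc n)) \<longlonglongrightarrow> m + 0"
    by (intro tendsto_intros LIMSEQ_Suc[OF lim_1_over_n])
  ultimately have "J w \<le> m + 0"
    by (rule LIMSEQ_le) (use X in \<open>auto intro: less_imp_le\<close>)
  then have Jw: "J w \<le> J x" for x using m[of x] by simp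
  have "l h = inner h w" for h
  proof -
    define q where "q = inner h w - l h"
    have "0 \<le> 2 * t * q + t\<^sup>2 * (norm h)\<^sup>2" for t
    proof -
      have "J (w + t *\<^sub>R h) = J w + 2 * t * q + t\<^sup>2 * (norm h)\<^sup>2"
        unfolding J_def q_def power2_norm_eq_inner
        by (simp add: l.add l.scaleR inner_add inner_commute algebra_simps power2_eq_square)
      then show ?thesis using Jw[of "w + t *\<^sub>R h"] by linarith
    qed
    \<comment> \<open>Nearly the minimising \<open>t = - q / \<bar>h\<bar>\<^sup>2\<close>; the \<open>1\<close> avoids a case distinction for \<open>h = 0\<close>.\<close>
    from this[of "- q / ((norm h)\<^sup>2 + 1)"] have "q = 0"
    proof -
      define d where "d = (norm h)\<^sup>2 + 1"
      have d: "1 \<le> d" unfolding d_def by simp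
      have "0 \<le> 2 * (- q / d) * q + (- q / d)\<^sup>2 * (d - 1)"
        using \<open>0 \<le> 2 * (- q / ((norm h)\<^sup>2 + 1)) * q + _\<close> unfolding d_def by simp
      then have "0 \<le> (2 * (- q / d) * q + (- q / d)\<^sup>2 * (d - 1)) * d\<^sup>2" using d by simp
      also have "\<dots> = - q\<^sup>2 * (d + 1)" using d by (simp add: power2_eq_square field_simps)
      finally have "q\<^sup>2 * (d + 1) \<le> 0" by simp
      then show "q = 0" using d by (simp add: mult_le_0_iff)
    qed
    then show ?thesis unfolding q_def by simp
  qed
  then show thesis by (rule that)
qed

text \<open>A multiplier that tends to zero at infinity is a compact operator: for a bounded family that converges
  coefficientwise, finitely many frequencies converge and the others are uniformly small.\<close>

lemma mul_tendsto:
  assumes b: "\<forall>\<^sub>F i in F. norm (x i) \<le> R" and c: "\<And>n. ((\<lambda>i. cf (x i) n) \<longlongrightarrow> cf y n) F"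
    and m: "multiplier C \<mu>" and d: "\<And>e. 0 < e \<Longrightarrow> \<exists>N::nat. \<forall>n. int N < \<bar>n\<bar> \<longrightarrow> cmod (\<mu> n) \<le> e"
  shows "((\<lambda>i. mul \<mu> (x i)) \<longlongrightarrow> mul \<mu> y) F"
proof (rule tendstoI)
  fix e :: real assume e: "0 < e"
  define B where "B = \<bar>R\<bar> + norm y + 1"
  have B: "1 \<le> B" unfolding B_def by simp
  have C: "0 \<le> C" by (rule multiplier_nonneg[OF m])
  \<comment> \<open>High frequencies contribute at most \<open>d * B = e / 2\<close>.\<close>
  define d where "d = e / (2 * B)"
  have d0: "0 < d" using e B unfolding d_def by simp
  obtain N where N: "\<And>n. int N < \<bar>n\<bar> \<Longrightarrow> cmod (\<mu> n) \<le> d" using d[OF d0] by blast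
  let ?I = "{- int N..int N}"
  have "((\<lambda>i. C\<^sup>2 * (\<Sum>n\<in>?I. (cmod (cf (x i) n - cf y n))\<^sup>2)) \<longlongrightarrow> C\<^sup>2 * (\<Sum>n\<in>?I. (cmod (cf y n - cf y n))\<^sup>2)) F"
    by (intro tendsto_intros c)
  then have "((\<lambda>i. C\<^sup>2 * (\<Sum>n\<in>?I. (cmod (cf (x i) n - cf y n))\<^sup>2)) \<longlongrightarrow> 0) F" by simp
  moreover have "0 < (e/2)\<^sup>2" using e by simp
  ultimately have "\<forall>\<^sub>F i in F. C\<^sup>2 * (\<Sum>n\<in>?I. (cmod (cf (x i) n - cf y n))\<^sup>2) < (e/2)\<^sup>2"
    by (rule order_tendstoD(2))
  with b show "\<forall>\<^sub>F i in F. dist (mul \<mu> (x i)) (mul \<mu> y) < e"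
  proof eventually_elim
    case (elim i)
    let ?z = "x i - y"
    have zB: "norm ?z \<le> B" using elim(1) norm_triangle_ineq4[of "x i" y] unfolding B_def by simp
    have "norm (mul \<mu> (x i) - mul \<mu> y) \<le> sqrt ((e/2)\<^sup>2 + (e/2)\<^sup>2)"
    proof (rule norm_hl2_leI)
      fix G :: "int set" assume G: "finite G"
      have "(\<Sum>n\<in>G. (cmod (cf (mul \<mu> (x i) - mul \<mu> y) n))\<^sup>2) = (\<Sum>n\<in>G. (cmod (\<mu> n))\<^sup>2 * (cmod (cf ?z n))\<^sup>2)"
        by (intro sum.cong) (simp_all add: cf_mul[OF m] power_mult_distrib[symmetric] norm_mult[symmetric] algebra_simps)
      also have "\<dots> \<le> (\<Sum>n\<in>G. (if n \<in> ?I then C\<^sup>2 * (cmod (cf ?z n))\<^sup>2 else 0) + d\<^sup>2 * (cmod (cf ?z n))\<^sup>2)"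
      proof (rule sum_mono)
        fix n
        show "(cmod (\<mu> n))\<^sup>2 * (cmod (cf ?z n))\<^sup>2 \<le> (if n \<in> ?I then C\<^sup>2 * (cmod (cf ?z n))\<^sup>2 else 0) + d\<^sup>2 * (cmod (cf ?z n))\<^sup>2"
        proof (cases "n \<in> ?I")
          case True
          have "(cmod (\<mu> n))\<^sup>2 \<le> C\<^sup>2" using m unfolding multiplier_def by (intro power_mono) auto
          from mult_right_mono[OF this, of "(cmod (cf ?z n))\<^sup>2"] True show ?thesis by (simp add: add_increasing2)
        next
          case False
          then have "int N < \<bar>n\<bar>" by auto
          from N[OF this] have "(cmod (\<mu> n))\<^sup>2 \<le> d\<^sup>2" by (intro power_mono) auto
          from mult_right_mono[OF this, of "(cmod (cf ?z n))\<^sup>2"] False show ?thesis by auto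
        qed
      qed
      also have "\<dots> = (\<Sum>n\<in>G \<inter> ?I. C\<^sup>2 * (cmod (cf ?z n))\<^sup>2) + d\<^sup>2 * (\<Sum>n\<in>G. (cmod (cf ?z n))\<^sup>2)"
        using G by (simp only: sum.distrib sum.inter_restrict[OF G] sum_distrib_left)
      also have "\<dots> \<le> (e/2)\<^sup>2 + (e/2)\<^sup>2"
      proof (rule add_mono)
        have "(\<Sum>n\<in>G \<inter> ?I. C\<^sup>2 * (cmod (cf ?z n))\<^sup>2) \<le> (\<Sum>n\<in>?I. C\<^sup>2 * (cmod (cf ?z n))\<^sup>2)"
          by (rule sum_mono2) auto
        also have "\<dots> = C\<^sup>2 * (\<Sum>n\<in>?I. (cmod (cf (x i) n - cf y n))\<^sup>2)" by (simp only: sum_distrib_left cf_minus)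
        also have "\<dots> \<le> (e/2)\<^sup>2" using elim(2) by simp
        finally show "(\<Sum>n\<in>G \<inter> ?I. C\<^sup>2 * (cmod (cf ?z n))\<^sup>2) \<le> (e/2)\<^sup>2" .
        have "d\<^sup>2 * (\<Sum>n\<in>G. (cmod (cf ?z n))\<^sup>2) \<le> d\<^sup>2 * B\<^sup>2"
        proof (rule mult_left_mono)
          have "(\<Sum>n\<in>G. (cmod (cf ?z n))\<^sup>2) \<le> (norm ?z)\<^sup>2" by (rule cf_sq_sum_le[OF G])
          also have "\<dots> \<le> B\<^sup>2" using zB by (intro power_mono) auto
          finally show "(\<Sum>n\<in>G. (cmod (cf ?z n))\<^sup>2) \<le> B\<^sup>2" .
        qed simp
        also have "\<dots> = (e/2)\<^sup>2" using B unfolding d_def by (simp add: power_mult_distrib[symmetric])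
        finally show "d\<^sup>2 * (\<Sum>n\<in>G. (cmod (cf ?z n))\<^sup>2) \<le> (e/2)\<^sup>2" .
      qed
      finally show "(\<Sum>n\<in>G. (cmod (cf (mul \<mu> (x i) - mul \<mu> y) n))\<^sup>2) \<le> (sqrt ((e/2)\<^sup>2 + (e/2)\<^sup>2))\<^sup>2" by simp
    qed simp
    also have "\<dots> < e"
    proof (rule real_less_lsqrt)
      show "(e/2)\<^sup>2 + (e/2)\<^sup>2 < e\<^sup>2" using e by (simp add: power2_eq_square)
    qed (use e in auto)
    finally show ?case unfolding dist_norm .
  qed
qed

lemma weight_decays:
  assumes "s < 0" "0 < e" shows "\<exists>N::nat. \<forall>n. int N < \<bar>n\<bar> \<longrightarrow> cmod (complex_of_real (weight s n)) \<le> e"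
proof -
  have "((\<lambda>x::real. x powr s) \<longlongrightarrow> 0) at_top" using assms(1) by (rule tendsto_neg_powr[OF _ filterlim_ident])
  from order_tendstoD(2)[OF this assms(2)] obtain X where X: "\<And>x. x \<ge> X \<Longrightarrow> x powr s < e"
    unfolding eventually_at_top_linorder by blast
  define N where "N = nat \<lceil>max X 0\<rceil>"
  have "cmod (complex_of_real (weight s n)) \<le> e" if "int N < \<bar>n\<bar>" for n
  proof -
    have n: "X \<le> \<bar>real_of_int n\<bar>" "0 < \<bar>real_of_int n\<bar>" using that unfolding N_def by linarith+
    have "weight s n \<le> (\<bar>real_of_int n\<bar>\<^sup>2) powr (s/2)"
      unfolding weight_def using assms(1) n by (intro powr_mono2') auto
    also have "\<bar>real_of_int n\<bar>\<^sup>2 = \<bar>real_of_int n\<bar> powr 2" using n by simp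
    also have "(\<bar>real_of_int n\<bar> powr 2) powr (s/2) = \<bar>real_of_int n\<bar> powr s" by (simp only: powr_powr) simp
    also have "\<dots> \<le> e" using X[OF n(1)] by simp
    finally show ?thesis by simp
  qed
  then show ?thesis by blast
qed

lemma weight_mul_tendsto:
  assumes "\<forall>\<^sub>F i in F. norm (x i) \<le> R" "\<And>n. ((\<lambda>i. cf (x i) n) \<longlongrightarrow> cf y n) F" "s < 0"
  shows "((\<lambda>i. mul (\<lambda>n. weight s n) (x i)) \<longlongrightarrow> mul (\<lambda>n. weight s n) y) F"
  by (rule mul_tendsto[OF assms(1,2), of 1])
     (use assms(3) in \<open>auto simp: multiplier_def hermitian_weight weight_le_1 intro: weight_decays[unfolded norm_of_real abs_of_nonneg[OF weight_nonneg]]\<close>)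

text \<open>The truncations are finite rank multipliers, so \<open>mul_tendsto\<close> applies to them.\<close>

definition freq_cut :: "nat \<Rightarrow> int \<Rightarrow> complex" where
  "freq_cut N n = (if \<bar>n\<bar> \<le> int N then 1 else 0)"

lemma multiplier_freq_cut: "multiplier 1 (freq_cut N)"
  by (simp add: multiplier_def hermitian_def freq_cut_def)

lemma freq_cut_tendsto: "(\<lambda>N. mul (freq_cut N) w) \<longlonglongrightarrow> w"
proof -
  have e: "(norm (w - mul (freq_cut N) w))\<^sup>2 = (norm w)\<^sup>2 - (\<Sum>n\<in>{- int N..int N}. (cmod (cf w n))\<^sup>2)" for N
  proof -
    let ?f = "\<lambda>n. (cmod (cf w n))\<^sup>2" and ?I = "{- int N..int N}"
    have s: "?f summable_on UNIV" using cf_l2[of w] by (simp add: l2_def)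
    have "(norm (w - mul (freq_cut N) w))\<^sup>2 = (\<Sum>\<^sub>\<infinity>n. (cmod (cf (w - mul (freq_cut N) w) n))\<^sup>2)" by (rule norm_hl2_sq)
    also have "\<dots> = infsum ?f (UNIV - ?I)"
      by (rule infsum_cong_neutral) (auto simp: cf_mul[OF multiplier_freq_cut] freq_cut_def)
    also have "\<dots> = infsum ?f UNIV - infsum ?f ?I"
      by (rule infsum_Diff[OF s]) auto
    finally show ?thesis by (simp add: norm_hl2_sq)
  qed
  have "(\<lambda>N. (norm w)\<^sup>2 - (\<Sum>n\<in>{- int N..int N}. (cmod (cf w n))\<^sup>2)) \<longlonglongrightarrow> (norm w)\<^sup>2 - (norm w)\<^sup>2"
    unfolding norm_hl2_sq using cf_l2[of w]
    by (intro tendsto_diff tendsto_const has_sum_sym_limit has_sum_infsum) (simp add: l2_def)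
  then have "(\<lambda>N. (norm (w - mul (freq_cut N) w))\<^sup>2) \<longlonglongrightarrow> 0" unfolding e by simp
  then have "(\<lambda>N. sqrt ((norm (w - mul (freq_cut N) w))\<^sup>2)) \<longlonglongrightarrow> sqrt 0" by (intro tendsto_intros)
  then have "(\<lambda>N. norm (w - mul (freq_cut N) w)) \<longlonglongrightarrow> 0" by simp
  then have "(\<lambda>N. w - mul (freq_cut N) w) \<longlonglongrightarrow> 0" by (rule tendsto_norm_zero_cancel)
  from tendsto_diff[OF tendsto_const[of w] this] show ?thesis by simp
qed

lemma inner_mul_freq_cut: "inner (mul (freq_cut N) z) w = inner z (mul (freq_cut N) w)"
  by (rule inner_hl2_cong) (simp add: cf_mul[OF multiplier_freq_cut] freq_cut_def)

text \<open>For bounded families coefficientwise convergence is weak convergence: replace \<open>w\<close> by a truncation, to which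
  finitely many coefficients of \<open>x i\<close> contribute.\<close>

lemma weak_tendsto:
  assumes b: "\<forall>\<^sub>F i in F. norm (x i) \<le> R" and c: "\<And>n. ((\<lambda>i. cf (x i) n) \<longlongrightarrow> cf y n) F"
  shows "((\<lambda>i. inner (x i) w) \<longlongrightarrow> inner y w) F"
proof (rule tendstoI)
  fix e :: real assume e: "0 < e"
  define B where "B = \<bar>R\<bar> + norm y + 1"
  have B: "1 \<le> B" unfolding B_def by simp
  have "0 < e / (2 * B)" using e B by simp
  from LIMSEQ_D[OF freq_cut_tendsto[of w] this]
  obtain N where N: "norm (mul (freq_cut N) w - w) < e / (2 * B)" by blast
  have "((\<lambda>i. mul (freq_cut N) (x i)) \<longlongrightarrow> mul (freq_cut N) y) F"
    by (rule mul_tendsto[OF b c multiplier_freq_cut]) (rule exI[of _ N], simp add: freq_cut_def)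
  then have "((\<lambda>i. inner (mul (freq_cut N) (x i)) w) \<longlongrightarrow> inner (mul (freq_cut N) y) w) F"
    by (intro tendsto_intros)
  then have "\<forall>\<^sub>F i in F. dist (inner (mul (freq_cut N) (x i)) w) (inner (mul (freq_cut N) y) w) < e / 2"
    by (rule tendstoD) (use e in simp)
  with b show "\<forall>\<^sub>F i in F. dist (inner (x i) w) (inner y w) < e"
  proof eventually_elim
    case (elim i)
    let ?z = "x i - y"
    have zB: "norm ?z \<le> B" using elim(1) norm_triangle_ineq4[of "x i" y] unfolding B_def by simp
    have "\<bar>inner ?z (mul (freq_cut N) w - w)\<bar> \<le> norm ?z * norm (mul (freq_cut N) w - w)" by (rule Cauchy_Schwarz_ineq2)
    also have "\<dots> \<le> B * (e / (2 * B))" using zB N B by (intro mult_mono) auto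
    also have "\<dots> = e / 2" using B by simp
    finally have 1: "\<bar>inner ?z (mul (freq_cut N) w - w)\<bar> \<le> e / 2" .
    have "inner (x i) w - inner y w = (inner (mul (freq_cut N) (x i)) w - inner (mul (freq_cut N) y) w) - inner ?z (mul (freq_cut N) w - w)"
      by (simp add: inner_mul_freq_cut inner_diff_left inner_diff_right)
    then show ?case using 1 elim(2) unfolding dist_real_def by linarith
  qed
qed

text \<open>The coefficient sequences lie in a product of countably many discs, which is compact and metrizable. The limit is
  square summable because the bounds on finite sums pass to the limit.\<close>

lemma bounded_sequence_weakly_compact:
  fixes x :: "nat \<Rightarrow> hl2"
  assumes b: "\<And>n. norm (x n) \<le> R"
  obtains r y where "strict_mono r" "\<And>k. (\<lambda>n. cf (x (r n)) k) \<longlonglongrightarrow> cf y k"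
proof -
  define S where "S = (PiE UNIV (\<lambda>k::int. cball (0::complex) R))"
  have "compactin (product_topology (\<lambda>k::int. euclidean) UNIV) S"
    unfolding S_def compactin_PiE by simp
  then have "compact S" by (simp add: euclidean_product_topology)
  then have "seq_compact S" by (simp add: compact_eq_seq_compact_metric)
  then have "(\<forall>n. cf (x n) \<in> S) \<longrightarrow> (\<exists>l\<in>S. \<exists>r. strict_mono r \<and> ((\<lambda>n. cf (x n)) \<circ> r) \<longlonglongrightarrow> l)"
    unfolding seq_compact_def by (rule spec)
  moreover have "\<forall>n. cf (x n) \<in> S"
    unfolding S_def using order_trans[OF cf_le_norm b] by auto
  ultimately obtain c r where r: "strict_mono r" and lim: "((\<lambda>n. cf (x n)) \<circ> r) \<longlonglongrightarrow> c"
    by (elim impE bexE exE conjE) auto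
  have ck: "(\<lambda>n. cf (x (r n)) k) \<longlonglongrightarrow> c k" for k
  proof -
    have "continuous_on UNIV (\<lambda>f::int \<Rightarrow> complex. f k)" by (rule continuous_on_product_coordinates)
    then have "isCont (\<lambda>f::int \<Rightarrow> complex. f k) c" by (rule continuous_on_interior) simp
    from isCont_tendsto_compose[OF this lim] show ?thesis by (simp add: o_def)
  qed
  have h: "hermitian c"
    unfolding hermitian_def
  proof
    fix k
    have "(\<lambda>n. cf (x (r n)) (- k)) \<longlonglongrightarrow> cnj (c k)"
      using tendsto_cnj[OF ck[of k]] by (simp add: hermitianD[OF cf_hermitian])
    then show "c (- k) = cnj (c k)" using ck LIMSEQ_unique by blast
  qed
  have "l2 c"
    unfolding l2_def
  proof (rule nonneg_bdd_above_summable_on)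
    show "bdd_above (sum (\<lambda>n. (cmod (c n))\<^sup>2) ` {F. F \<subseteq> UNIV \<and> finite F})"
    proof (rule bdd_aboveI2)
      fix F :: "int set" assume "F \<in> {F. F \<subseteq> UNIV \<and> finite F}"
      then have F: "finite F" by simp
      show "(\<Sum>k\<in>F. (cmod (c k))\<^sup>2) \<le> R\<^sup>2"
      proof (rule LIMSEQ_le_const2)
        show "(\<lambda>n. \<Sum>k\<in>F. (cmod (cf (x (r n)) k))\<^sup>2) \<longlonglongrightarrow> (\<Sum>k\<in>F. (cmod (c k))\<^sup>2)"
          by (intro tendsto_intros ck)
        have "(\<Sum>k\<in>F. (cmod (cf (x (r n)) k))\<^sup>2) \<le> R\<^sup>2" for n
          by (rule order_trans[OF cf_sq_sum_le[OF F] power_mono[OF b norm_ge_zero]])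
        then show "\<exists>N. \<forall>n\<ge>N. (\<Sum>k\<in>F. (cmod (cf (x (r n)) k))\<^sup>2) \<le> R\<^sup>2" by blast
      qed
    qed
  qed simp
  then show thesis using that[OF r, of "Hl2 c"] ck by (simp add: cf_Hl2 h)
qed

lemma weak_limit_inner:
  assumes w: "sobolev_weak_limit 1 f f0 F"
  shows "((\<lambda>i. inner (emb 1 (f i)) y) \<longlongrightarrow> inner (emb 1 f0) y) F"
proof -
  have "sobolev_functional 1 (\<lambda>g. inner (emb 1 g) y)"
    unfolding sobolev_functional_def
  proof (intro conjI ballI allI exI)
    fix f g :: "real \<Rightarrow> real" and c d assume "f \<in> sobolev 1" "g \<in> sobolev 1"
    then show "inner (emb 1 (\<lambda>x. c * f x + d * g x)) y = c * inner (emb 1 f) y + d * inner (emb 1 g) y"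
      by (simp add: sobolev_lincomb inner_add_left)
  next
    fix f :: "real \<Rightarrow> real" assume "f \<in> sobolev 1"
    then show "\<bar>inner (emb 1 f) y\<bar> \<le> norm y * sobolev_norm 1 f"
      using Cauchy_Schwarz_ineq2[of "emb 1 f" y] by (simp add: sobolev_norm_emb mult.commute)
  qed
  then show ?thesis using w unfolding sobolev_weak_limit_def by blast
qed

lemma inner_two_point:
  assumes v: "hermitian v" "\<And>k. k \<noteq> n \<Longrightarrow> k \<noteq> - n \<Longrightarrow> v k = 0"
  shows "l2 v" "inner x (Hl2 v) = (\<Sum>k\<in>{n, - n}. inner (cf x k) (v k))"
proof -
  show l: "l2 v"
    unfolding l2_def by (rule summable_on_cong_neutral[THEN iffD1, OF _ _ _ summable_on_finite[of "{n, - n}"]]) (use v in auto)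
  have "inner x (Hl2 v) = infsum (\<lambda>k. inner (cf x k) (v k)) {n, - n}"
    unfolding inner_hl2_def cf_Hl2[OF v(1) l] by (rule infsum_cong_neutral) (use v in auto)
  then show "inner x (Hl2 v) = (\<Sum>k\<in>{n, - n}. inner (cf x k) (v k))" by simp
qed

text \<open>The real and the imaginary part of a coefficient are real linear functionals, so weak convergence controls them.
  They are represented by the sequences of a cosine and a sine.\<close>

lemma cf_from_inner: "\<exists>p q. \<forall>x. cf x n = Complex (inner x p) (inner x q)"
proof -
  define v where "v k = (if k = n then 1/2 else 0) + (if k = - n then 1/2 else (0::complex))" for k
  define w where "w k = (if k = n then \<i>/2 else 0) + (if k = - n then - \<i>/2 else (0::complex))" for k
  have hv: "hermitian v" and hw: "hermitian w" unfolding hermitian_def v_def w_def by auto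
  have z: "v k = 0" "w k = 0" if "k \<noteq> n" "k \<noteq> - n" for k using that by (auto simp: v_def w_def)
  have c: "cf x (- n) = cnj (cf x n)" for x by (rule hermitianD[OF cf_hermitian])
  have c0: "Im (cf x 0) = 0" for x using hermitianD[OF cf_hermitian, of x 0] by (simp add: complex_eq_iff)
  have e: "inner x (Hl2 v) = (\<Sum>k\<in>{n, - n}. inner (cf x k) (v k))"
    "inner x (Hl2 w) = (\<Sum>k\<in>{n, - n}. inner (cf x k) (w k))" for x
    by (rule inner_two_point(2)[OF hv], rule z, assumption+) (rule inner_two_point(2)[OF hw], rule z, assumption+)
  have "inner x (Hl2 v) = Re (cf x n)" for x
    unfolding e
    by (cases "n = 0") (auto simp: c v_def inner_complex_def)
  moreover have "inner x (Hl2 w) = Im (cf x n)" for x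
    unfolding e
    by (cases "n = 0") (auto simp: c w_def inner_complex_def c0)
  ultimately have "cf x n = Complex (inner x (Hl2 v)) (inner x (Hl2 w))" for x
    by (simp add: complex_eq_iff)
  then show ?thesis by blast
qed

lemma weak_limit_cf:
  assumes "sobolev_weak_limit 1 f f0 F"
  shows "((\<lambda>i. cf (emb 1 (f i)) n) \<longlongrightarrow> cf (emb 1 f0) n) F"
proof -
  obtain p q where pq: "\<And>x. cf x n = Complex (inner x p) (inner x q)" using cf_from_inner by blast
  show ?thesis unfolding pq by (intro tendsto_Complex weak_limit_inner assms)
qed

text \<open>A bounded functional on functions factors through \<open>hl2\<close>, because it vanishes on differences of norm zero.\<close>

lemma sobolev_functional_rep:
  assumes l: "sobolev_functional 1 l"
  obtains w where "\<And>f. f \<in> sobolev 1 \<Longrightarrow> l f = inner (emb 1 f) w"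
proof -
  obtain C where lin: "\<And>f g c d. f \<in> sobolev 1 \<Longrightarrow> g \<in> sobolev 1 \<Longrightarrow> l (\<lambda>x. c * f x + d * g x) = c * l f + d * l g"
    and C: "\<And>f. f \<in> sobolev 1 \<Longrightarrow> \<bar>l f\<bar> \<le> C * sobolev_norm 1 f"
    using l unfolding sobolev_functional_def by blast
  have eq: "l f = l g" if f: "f \<in> sobolev 1" and g: "g \<in> sobolev 1" and e: "emb 1 f = emb 1 g" for f g
  proof -
    have "\<bar>l (\<lambda>x. 1 * f x + (-1) * g x)\<bar> \<le> C * norm (emb 1 (\<lambda>x. 1 * f x + (-1) * g x))"
      using C[OF sobolev_lincomb(1)[OF f g]] sobolev_norm_emb[OF sobolev_lincomb(1)[OF f g]] by metis
    also have "\<dots> = 0" unfolding sobolev_lincomb(2)[OF f g] e by simp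
    finally show ?thesis unfolding lin[OF f g] by simp
  qed
  have s: "representative 1 b \<in> sobolev 1" "emb 1 (representative 1 b) = b" for b by (rule representative, simp)+
  have "bounded_linear (\<lambda>b. l (representative 1 b))"
  proof (rule bounded_linear_intro)
    fix b c :: hl2 and r :: real
    have "l (representative 1 (b + c)) = l (\<lambda>x. 1 * representative 1 b x + 1 * representative 1 c x)"
      by (rule eq) (simp_all only: s sobolev_lincomb[OF s(1) s(1)] scaleR_one)
    then have "l (representative 1 (b + c)) = 1 * l (representative 1 b) + 1 * l (representative 1 c)" by (simp only: lin[OF s(1) s(1)])
    then show "l (representative 1 (b + c)) = l (representative 1 b) + l (representative 1 c)" by simp
    have "l (representative 1 (r *\<^sub>R b)) = l (\<lambda>x. r * representative 1 b x + 0 * representative 1 b x)"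
      by (rule eq) (simp_all only: s sobolev_lincomb[OF s(1) s(1)] scaleR_zero_left add_0_right)
    then show "l (representative 1 (r *\<^sub>R b)) = r *\<^sub>R l (representative 1 b)" by (simp only: lin[OF s(1) s(1)]) simp
    show "norm (l (representative 1 b)) \<le> norm b * C"
      using C[OF s(1)[of b]] sobolev_norm_emb[OF s(1)[of b]] by (simp add: s mult.commute)
  qed
  then obtain w where w: "\<And>b. l (representative 1 b) = inner b w" by (rule riesz_representation) blast
  have "l f = inner (emb 1 f) w" if "f \<in> sobolev 1" for f
    using eq[OF that s(1)[of "emb 1 f"]] s(2) w by simp
  then show thesis by (rule that)
qed

lemma weak_limitI:
  assumes f: "\<forall>\<^sub>F i in F. f i \<in> sobolev 1 \<and> norm (emb 1 (f i)) \<le> R" and f0: "f0 \<in> sobolev 1"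
    and c: "\<And>n. ((\<lambda>i. cf (emb 1 (f i)) n) \<longlongrightarrow> cf (emb 1 f0) n) F"
  shows "sobolev_weak_limit 1 f f0 F"
  unfolding sobolev_weak_limit_def
proof (intro conjI allI impI f0)
  fix l assume "sobolev_functional 1 l"
  then obtain w where w: "\<And>f. f \<in> sobolev 1 \<Longrightarrow> l f = inner (emb 1 f) w" by (rule sobolev_functional_rep) blast
  have "((\<lambda>i. inner (emb 1 (f i)) w) \<longlongrightarrow> inner (emb 1 f0) w) F"
    by (rule weak_tendsto[OF _ c]) (use f in \<open>auto elim: eventually_mono\<close>)
  moreover have "\<forall>\<^sub>F i in F. inner (emb 1 (f i)) w = l (f i)"
    using f by eventually_elim (simp add: w)
  ultimately show "((\<lambda>i. l (f i)) \<longlongrightarrow> l f0) F"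
    unfolding w[OF f0] by (rule Lim_transform_eventually)
qed

section \<open>Weak limits along a trajectory\<close>

lemma unweight_mul_half: "unweight 0 (mul half_mult x) = unweight 1 x"
  by (rule ext) (simp add: unweight_def cf_mul[OF multiplier_half])

lemma wconv_project: "wconv 0 (mul half_mult x) (mul half_mult y) = mul half_mult (wconv 1 x y)"
  by (rule hl2_eqI) (simp add: cf_mul[OF multiplier_half] cf_wconv unweight_mul_half)

text \<open>The \<open>H\<^sup>1\<close> equation, seen in \<open>L\<^sup>2\<close>, is the \<open>L\<^sup>2\<close> equation. Thus \<open>H\<^sup>1\<close> trajectories
  can be compared in the \<open>L\<^sup>2\<close> norm, in which the field is Lipschitz as well.\<close>

lemma field_project: "mul half_mult (field 1 \<alpha> b) = field 0 (mul half_mult \<alpha>) (mul half_mult b)"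
  by (rule hl2_eqI) (simp add: cf_mul[OF multiplier_half] cf_field wconv_project algebra_simps)

definition flow :: "(real \<Rightarrow> real) \<Rightarrow> hl2 \<Rightarrow> (real \<Rightarrow> hl2) \<Rightarrow> bool" where
  "flow a x0 x \<longleftrightarrow> (\<forall>T\<ge>0. ode_sol (field 1 (emb 1 a)) T x0 x)"

lemma flowD: "flow a x0 x \<Longrightarrow> 0 \<le> T \<Longrightarrow> ode_sol (field 1 (emb 1 a)) T x0 x"
  by (simp add: flow_def)

lemma flow_0: "flow a x0 x \<Longrightarrow> x 0 = x0"
  by (rule ode_sol_0[OF flowD[OF _ order_refl]])

lemma flow_derivative:
  "flow a x0 x \<Longrightarrow> t \<in> {0..T} \<Longrightarrow> (x has_vector_derivative field 1 (emb 1 a) (x t)) (at t within {0..T})"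
  using flowD[of a x0 x T] by (auto simp: ode_sol_def)

lemma flow_continuous: "flow a x0 x \<Longrightarrow> continuous_on {0..T} x"
  unfolding continuous_on_eq_continuous_within
  using has_vector_derivative_continuous[OF flow_derivative] by blast

lemma flow_shift:
  assumes x: "flow a x0 x" and c: "0 \<le> c" shows "flow a (x c) (\<lambda>t. x (c + t))"
  unfolding flow_def ode_sol_def
proof (intro allI impI conjI ballI)
  fix T t :: real assume T: "0 \<le> T" and t: "t \<in> {0..T}"
  have i: "(\<lambda>t. c + t) ` {0..T} \<subseteq> {0..c + T}" using c T by auto
  have "(x has_vector_derivative field 1 (emb 1 a) (x (c + t))) (at (c + t) within (\<lambda>t. c + t) ` {0..T})"
    by (rule has_vector_derivative_within_subset[OF flow_derivative[OF x] i]) (use t c in auto)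
  moreover have "((\<lambda>t. c + t) has_vector_derivative 0 + 1) (at t within {0..T})"
    by (intro has_vector_derivative_add has_vector_derivative_const has_vector_derivative_id)
  ultimately have "((x \<circ> (\<lambda>t. c + t)) has_vector_derivative (0 + 1) *\<^sub>R field 1 (emb 1 a) (x (c + t))) (at t within {0..T})"
    by (intro vector_diff_chain_within)
  then show "((\<lambda>t. x (c + t)) has_vector_derivative field 1 (emb 1 a) (x (c + t))) (at t within {0..T})"
    by (simp add: o_def)
qed simp

lemma flow_low:
  assumes x: "flow a x0 x" and T: "0 \<le> T"
  shows "ode_sol (field 0 (mul half_mult (emb 1 a))) T (mul half_mult x0) (\<lambda>t. mul half_mult (x t))"
  unfolding ode_sol_def
proof (intro conjI ballI)
  show "mul half_mult (x 0) = mul half_mult x0" by (simp add: flow_0[OF x])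
  fix t assume "t \<in> {0..T}"
  from bounded_linear.has_vector_derivative[OF bounded_linear_mul[OF multiplier_half] flow_derivative[OF x this]]
  show "((\<lambda>t. mul half_mult (x t)) has_vector_derivative field 0 (mul half_mult (emb 1 a)) (mul half_mult (x t))) (at t within {0..T})"
    by (simp add: field_project)
qed

lemma emb_0_ev: "emb 0 (ev b) = mul half_mult b"
  using sobolev_mono(2)[of 0 1 "ev b"] by (simp add: ev_sobolev emb_ev)

lemma ev_L2: "ev b \<in> L2_torus" by (rule sobolev_L2[OF ev_sobolev])

lemma integral_ev_sq: "(\<integral>x. (ev b x)\<^sup>2 \<partial>circ) = 2 * pi * (norm (mul half_mult b))\<^sup>2"
  using parseval[OF ev_L2 ev_L2, of b b] by (simp add: emb_0_ev power2_norm_eq_inner power2_eq_square[of "ev b _"])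

lemma ev_add: "ev (b + c) x = ev b x + ev c x" and ev_diff: "ev (b - c) x = ev b x - ev c x"
  by (simp_all add: ev_def inner_add_left inner_diff_left)

text \<open>The dissipation is quadratic, and continuous already in the \<open>L\<^sup>2\<close> norm.\<close>

lemma dissip_lipschitz:
  assumes a: "torus_smooth a" and A: "\<And>x. \<bar>a x\<bar> \<le> A"
  shows "\<bar>dissip a b - dissip a c\<bar> \<le> 2 * pi * A * norm (mul half_mult (b + c)) * norm (mul half_mult (b - c))"
proof -
  have A0: "0 \<le> A" using A[of 0] abs_ge_zero order_trans by blast
  let ?f = "\<lambda>x. a x * ev (b + c) x"
  have fL: "?f \<in> L2_torus" by (rule smooth_mult_L2[OF a ev_L2])
  have ai: "integrable circ (\<lambda>x. a x * (ev b x)\<^sup>2)" for b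
    using L2_mult_integrable[OF smooth_mult_L2[OF a ev_L2] ev_L2, of b b] by (simp add: power2_eq_square mult.assoc)
  have "dissip a b - dissip a c = (\<integral>x. a x * (ev b x)\<^sup>2 - a x * (ev c x)\<^sup>2 \<partial>circ)"
    unfolding dissip_def by (rule Bochner_Integration.integral_diff[OF ai ai, symmetric])
  also have "\<dots> = (\<integral>x. ?f x * ev (b - c) x \<partial>circ)"
    by (intro Bochner_Integration.integral_cong) (auto simp: ev_add ev_diff power2_eq_square algebra_simps)
  finally have "\<bar>dissip a b - dissip a c\<bar> \<le> (\<integral>x. \<bar>?f x * ev (b - c) x\<bar> \<partial>circ)"
    by (simp only: integral_abs_bound)
  also have "\<dots> \<le> sqrt (\<integral>x. (?f x)\<^sup>2 \<partial>circ) * sqrt (\<integral>x. (ev (b - c) x)\<^sup>2 \<partial>circ)"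
    by (rule L2_abs_integral[OF fL ev_L2])
  also have "\<dots> \<le> sqrt (A\<^sup>2 * (2 * pi * (norm (mul half_mult (b + c)))\<^sup>2)) * sqrt (2 * pi * (norm (mul half_mult (b - c)))\<^sup>2)"
    unfolding integral_ev_sq
  proof (intro mult_right_mono real_sqrt_le_mono)
    have "(\<integral>x. (?f x)\<^sup>2 \<partial>circ) \<le> (\<integral>x. A\<^sup>2 * (ev (b + c) x)\<^sup>2 \<partial>circ)"
    proof (rule integral_mono)
      show "integrable circ (\<lambda>x. (?f x)\<^sup>2)" by (rule L2_torusD(4)[OF fL])
      show "integrable circ (\<lambda>x. A\<^sup>2 * (ev (b + c) x)\<^sup>2)" using L2_torusD(4)[OF ev_L2] by simp
      fix x
      have "(a x)\<^sup>2 \<le> A\<^sup>2" using power_mono[OF A[of x], of 2] by simp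
      then show "(?f x)\<^sup>2 \<le> A\<^sup>2 * (ev (b + c) x)\<^sup>2" unfolding power_mult_distrib by (rule mult_right_mono) simp
    qed
    also have "\<dots> = A\<^sup>2 * (2 * pi * (norm (mul half_mult (b + c)))\<^sup>2)" by (simp add: integral_ev_sq)
    finally show "(\<integral>x. (?f x)\<^sup>2 \<partial>circ) \<le> A\<^sup>2 * (2 * pi * (norm (mul half_mult (b + c)))\<^sup>2)" .
  qed simp
  also have "\<dots> = 2 * pi * A * norm (mul half_mult (b + c)) * norm (mul half_mult (b - c))"
  proof -
    have "sqrt (A\<^sup>2 * (2 * pi * p\<^sup>2)) * sqrt (2 * pi * q\<^sup>2) = 2 * pi * A * p * q" if "0 \<le> p" "0 \<le> q" for p q
    proof -
      have "sqrt (A\<^sup>2 * (2 * pi * p\<^sup>2)) * sqrt (2 * pi * q\<^sup>2) = sqrt ((2 * pi * A * p * q)\<^sup>2)"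
        unfolding real_sqrt_mult[symmetric] by (rule arg_cong[of _ _ sqrt]) (simp only: power2_eq_square mult_ac)
      then show ?thesis using that A0 by simp
    qed
    then show ?thesis by simp
  qed
  finally show ?thesis .
qed

text \<open>A nonnegative integrand with integral zero vanishes almost everywhere, and the functions are continuous.\<close>

lemma dissip_zero:
  assumes a: "torus_smooth a" "\<And>x. 0 \<le> a x" and z: "dissip a b = 0"
  shows "a x * ev b x = 0"
proof -
  have ai: "integrable circ (\<lambda>x. a x * (ev b x)\<^sup>2)"
    using L2_mult_integrable[OF smooth_mult_L2[OF a(1) ev_L2] ev_L2, of b b] by (simp add: power2_eq_square mult.assoc)
  have "AE x in circ. a x * (ev b x)\<^sup>2 = 0"
    using z unfolding dissip_def by (subst (asm) integral_nonneg_eq_0_iff_AE[OF ai]) (use a(2) in auto)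
  then have "AE x in circ. a x * ev b x = 0" by eventually_elim simp
  moreover have "a (x + 2 * pi) * ev b (x + 2 * pi) = 0 \<longleftrightarrow> a x * ev b x = 0" for x
    using torus_smooth_facts(1)[OF a(1)] by (simp add: ev_periodic torus_periodic_def)
  ultimately have "AE x in lborel. a x * ev b x = 0" by (rule circ_AE_periodic)
  then have "(\<lambda>x. a x * ev b x) = (\<lambda>x. 0)"
    by (intro continuous_AE_eq_imp_eq continuous_on_mult torus_smooth_facts(2)[OF a(1)] continuous_on_ev continuous_on_const continuous_on_id)
  then show ?thesis by (rule fun_cong)
qed

lemma field_undamped:
  assumes a: "torus_smooth a" and z: "\<And>x. a x * ev b x = 0"
  shows "field 1 (emb 1 a) b = field 1 (emb 1 (\<lambda>_. 0)) b"
proof -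
  have "wconv 1 (emb 1 a) b = 0"
  proof (rule hl2_eqI)
    fix n
    have "cf (wconv 1 (emb 1 a) (emb 1 (ev b))) n = fourier_coeff (\<lambda>x. a x * ev b x) n"
      using coeff_mult_wconv[OF _ smooth_sobolev[OF a] ev_sobolev, of n b] by simp
    also have "\<dots> = 0" unfolding z by (simp add: fourier_coeff_circ)
    finally show "cf (wconv 1 (emb 1 a) b) n = cf 0 n" by (simp add: emb_ev)
  qed
  moreover have "wconv 1 (emb 1 (\<lambda>_. 0)) b = 0"
    by (simp add: emb_zero bounded_bilinear.zero_left[OF bounded_bilinear_wconv])
  ultimately show ?thesis unfolding field_def by simp
qed

lemma flow_norm_antimono:
  assumes a: "torus_smooth a" "\<And>x. 0 \<le> a x" and x: "flow a x0 x" and t: "0 \<le> s" "s \<le> t"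
  shows "norm (x t) \<le> norm (x s)"
  by (rule energy_nonincreasing[OF a flowD[OF x] t order_refl]) (use t in simp)

lemma flow_norm_le:
  assumes a: "torus_smooth a" "\<And>x. 0 \<le> a x" and x: "flow a x0 x" and t: "0 \<le> t"
  shows "norm (x t) \<le> norm x0"
  using flow_norm_antimono[OF a x order_refl t] by (simp add: flow_0[OF x])

text \<open>The time integral of the energy identity. The factor is \<open>pi\<close> and not \<open>2 pi\<close> because the derivative of
  the squared norm brings a \<open>2\<close>.\<close>

lemma flow_dissip_integral:
  assumes a: "torus_smooth a" and x: "flow a x0 x" and T: "0 \<le> T"
  shows "((\<lambda>t. dissip a (x t)) has_integral pi * ((norm x0)\<^sup>2 - (norm (x T))\<^sup>2)) {0..T}"
    and "continuous_on {0..T} (\<lambda>t. dissip a (x t))"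
proof -
  have e: "- pi * (2 * inner b (field 1 (emb 1 a) b)) = dissip a b" for b
    using energy_identity[OF a, of b] by simp
  have "((\<lambda>t. 2 * inner (x t) (field 1 (emb 1 a) (x t))) has_integral ((norm (x T))\<^sup>2 - (norm (x 0))\<^sup>2)) {0..T}"
    by (rule ode_norm_sq_integral[OF flow_derivative[OF x] order_refl T order_refl])
  from has_integral_mult_right[OF this, of "- pi"]
  show "((\<lambda>t. dissip a (x t)) has_integral pi * ((norm x0)\<^sup>2 - (norm (x T))\<^sup>2)) {0..T}"
    unfolding e flow_0[OF x] by (simp add: algebra_simps)
  have "continuous_on {0..T} (\<lambda>t. - pi * (2 * inner (x t) (field 1 (emb 1 a) (x t))))"
    by (intro continuous_intros continuous_on_field flow_continuous[OF x]) auto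
  then show "continuous_on {0..T} (\<lambda>t. dissip a (x t))" unfolding e .
qed

text \<open>The energy is nonincreasing and bounded below, hence convergent.\<close>

lemma flow_tail_dissip:
  assumes a: "torus_smooth a" "\<And>x. 0 \<le> a x" and x: "flow a x0 x" and T: "0 \<le> T"
    and tn: "\<And>n. 0 \<le> tn n" "filterlim tn at_top sequentially"
  shows "(\<lambda>n. (norm (x (tn n)))\<^sup>2 - (norm (x (tn n + T)))\<^sup>2) \<longlonglongrightarrow> 0"
proof -
  define E where "E s = (norm (x s))\<^sup>2" for s
  define m where "m = Inf (E ` {0..})"
  have bdd: "bdd_below (E ` {0..})" by (rule bdd_belowI2[of _ 0]) (simp add: E_def)
  have m: "m \<le> E s" if "0 \<le> s" for s unfolding m_def by (rule cINF_lower[OF bdd]) (use that in simp)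
  have anti: "E t \<le> E s" if "0 \<le> s" "s \<le> t" for s t
    unfolding E_def by (intro power_mono flow_norm_antimono[OF a x that]) simp
  have nn: "0 \<le> E (tn n) - E (tn n + T)" for n using anti[of "tn n" "tn n + T"] tn(1) T by simp
  have "(\<lambda>n. E (tn n) - E (tn n + T)) \<longlonglongrightarrow> 0"
  proof (rule LIMSEQ_I)
    fix r :: real assume r: "0 < r"
    obtain s where s: "0 \<le> s" "E s < m + r"
      using cInf_lessD[of "E ` {0..}" "m + r"] r unfolding m_def by auto
    have "\<forall>\<^sub>F n in sequentially. s \<le> tn n" using tn(2) by (rule filterlim_at_top[THEN iffD1, rule_format])
    then obtain N where N: "\<And>n. n \<ge> N \<Longrightarrow> s \<le> tn n" unfolding eventually_sequentially by blast
    have "norm (E (tn n) - E (tn n + T) - 0) < r" if "n \<ge> N" for n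
    proof -
      have "E (tn n) \<le> E s" by (rule anti[OF s(1) N[OF that]])
      moreover have "m \<le> E (tn n + T)" using m tn(1)[of n] T by simp
      ultimately show ?thesis using s(2) nn[of n] by simp
    qed
    then show "\<exists>N. \<forall>n\<ge>N. norm (E (tn n) - E (tn n + T) - 0) < r" by blast
  qed
  then show ?thesis unfolding E_def .
qed

text \<open>LaSalle's principle for a trajectory whose limit point is only weak in \<open>H\<^sup>1\<close>. In \<open>L\<^sup>2\<close> the convergence
  \<open>x (tn n) \<rightarrow> y0\<close> is strong and, by Gronwall, uniform over the time interval \<open>[0, T]\<close> that follows. The dissipation
  of \<open>y\<close> on \<open>[0, T]\<close> is therefore the limit of the dissipations of \<open>x\<close> on \<open>[tn n, tn n + T]\<close>, which is
  zero.\<close>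

theorem omega_limit_dissip:
  assumes a: "torus_smooth a" "\<And>x. 0 \<le> a x" and x: "flow a x0 x" and y: "flow a y0 y"
    and tn: "\<And>n. 0 \<le> tn n" "filterlim tn at_top sequentially"
    and lim: "\<And>k. (\<lambda>n. cf (x (tn n)) k) \<longlonglongrightarrow> cf y0 k" and t: "0 \<le> t"
  shows "dissip a (y t) = 0"
proof -
  \<comment> \<open>Any interval that contains \<open>t\<close> will do; a positive length is needed to conclude from a zero integral.\<close>
  define T where "T = t + 1"
  have T: "0 < T" "t \<in> {0..T}" using t unfolding T_def by auto
  define R where "R = max (norm x0) (norm y0)"
  have R0: "0 \<le> R" unfolding R_def by (simp add: le_max_iff_disj)
  have bx: "norm (mul half_mult (x s)) \<le> R" if "0 \<le> s" for s
    using norm_mul_le[OF multiplier_half, of "x s"] flow_norm_le[OF a x that] unfolding R_def by simp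
  have by_: "norm (mul half_mult (y s)) \<le> R" if "0 \<le> s" for s
    using norm_mul_le[OF multiplier_half, of "y s"] flow_norm_le[OF a y that] unfolding R_def by simp
  let ?F = "field 0 (mul half_mult (emb 1 a))"
  obtain L where L: "L > 0" "\<And>x y. norm x \<le> R \<Longrightarrow> norm y \<le> R \<Longrightarrow> norm (?F x - ?F y) \<le> L * norm (x - y)"
    using loc_lip_field[OF order_refl, of "mul half_mult (emb 1 a)"] unfolding loc_lip_def by blast
  define d where "d n = exp (L * T) * norm (mul half_mult (x (tn n)) - mul half_mult y0)" for n
  have d0: "d \<longlonglongrightarrow> 0"
  proof -
    have "(\<lambda>n. mul half_mult (x (tn n))) \<longlonglongrightarrow> mul half_mult y0"
      by (rule weight_mul_tendsto[where R=R]) (use flow_norm_le[OF a x tn(1)] lim in \<open>auto simp: R_def le_max_iff_disj\<close>)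
    then have "(\<lambda>n. exp (L * T) * norm (mul half_mult (x (tn n)) - mul half_mult y0)) \<longlonglongrightarrow> exp (L * T) * norm (mul half_mult y0 - mul half_mult y0)"
      by (intro tendsto_intros)
    then show ?thesis unfolding d_def by simp
  qed
  have close: "norm (mul half_mult (y s) - mul half_mult (x (tn n + s))) \<le> d n" if s: "s \<in> {0..T}" for n s
  proof -
    have "norm (mul half_mult (x (tn n + s)) - mul half_mult (y s)) \<le> exp (L * s) * norm (mul half_mult (x (tn n)) - mul half_mult y0)"
      by (rule ode_gronwall[OF flow_low[OF flow_shift[OF x tn(1)]] flow_low[OF y] _ _ L(2) s]) (use bx by_ tn(1)[of n] T in auto)
    also have "\<dots> \<le> d n" unfolding d_def using L(1) s by (intro mult_right_mono) auto
    finally show ?thesis by (simp add: norm_minus_commute)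
  qed
  obtain A where A: "\<And>x. \<bar>a x\<bar> \<le> A" using torus_smooth_facts(4)[OF a(1)] by blast
  have A0: "0 \<le> A" using A[of 0] abs_ge_zero order_trans by blast
  define M where "M = 2 * pi * A * (2 * R)"
  have dd: "\<bar>dissip a (y s) - dissip a (x (tn n + s))\<bar> \<le> M * d n" if s: "s \<in> {0..T}" for n s
  proof -
    have l: "mul half_mult (y s + x (tn n + s)) = mul half_mult (y s) + mul half_mult (x (tn n + s))"
      "mul half_mult (y s - x (tn n + s)) = mul half_mult (y s) - mul half_mult (x (tn n + s))"
      using bounded_linear_mul[OF multiplier_half] by (simp_all add: linear_simps)
    have "norm (mul half_mult (y s + x (tn n + s))) \<le> 2 * R"
      unfolding l using norm_triangle_ineq[of "mul half_mult (y s)" "mul half_mult (x (tn n + s))"] bx[of "tn n + s"] by_[of s] s tn(1)[of n] by simp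
    then have "2 * pi * A * norm (mul half_mult (y s + x (tn n + s))) * norm (mul half_mult (y s - x (tn n + s))) \<le> (2 * pi * A * (2 * R)) * d n"
      using close[OF s] A0 R0 unfolding l by (intro mult_mono mult_nonneg_nonneg) auto
    with dissip_lipschitz[OF a(1) A, of "y s" "x (tn n + s)"] show ?thesis unfolding M_def by linarith
  qed
  let ?I = "\<lambda>n. pi * ((norm (x (tn n)))\<^sup>2 - (norm (x (tn n + T)))\<^sup>2)"
  define J where "J = pi * ((norm y0)\<^sup>2 - (norm (y T))\<^sup>2)"
  have J: "((\<lambda>t. dissip a (y t)) has_integral J) {0..T}"
    unfolding J_def using T by (intro flow_dissip_integral a y) simp
  have I: "((\<lambda>s. dissip a (x (tn n + s))) has_integral ?I n) {0..T}" for n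
    using T by (intro flow_dissip_integral(1)[OF a(1) flow_shift[OF x tn(1)]]) simp
  have "J \<le> ?I n + M * d n * T" for n
  proof -
    have "((\<lambda>s. dissip a (x (tn n + s)) + M * d n) has_integral (?I n + M * d n * T)) {0..T}"
      using has_integral_add[OF I[of n] has_integral_const_real[of "M * d n" 0 T]] T by (simp add: mult.commute)
    then show ?thesis
    proof (rule has_integral_le[OF J])
      fix s assume "s \<in> {0..T}"
      from dd[OF this, of n] show "dissip a (y s) \<le> dissip a (x (tn n + s)) + M * d n" by linarith
    qed
  qed
  moreover have "(\<lambda>n. ?I n + M * d n * T) \<longlonglongrightarrow> pi * 0 + M * 0 * T"
    using T by (intro tendsto_intros flow_tail_dissip[OF a x _ tn] d0) simp
  ultimately have "J \<le> pi * 0 + M * 0 * T" by (intro LIMSEQ_le_const) auto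
  moreover have "0 \<le> J" by (rule has_integral_nonneg[OF J]) (use dissip_nonneg[of a] a(2) in auto)
  ultimately have "((\<lambda>t. dissip a (y t)) has_integral 0) (cbox 0 T)" using J by simp
  then show ?thesis
    using flow_dissip_integral(2)[OF a(1) y, of T] T dissip_nonneg[of a] a(2)
    by (intro has_integral_0_cbox_imp_0[of 0 T "\<lambda>t. dissip a (y t)" t]) auto
qed

text \<open>Where the damping does no work it exerts no force: \<open>a v\<^sup>2 = 0\<close> implies \<open>a v = 0\<close>.\<close>

corollary omega_limit_undamped:
  assumes a: "torus_smooth a" "\<And>x. 0 \<le> a x" and x: "flow a x0 x"
    and tn: "\<And>n. 0 \<le> tn n" "filterlim tn at_top sequentially"
    and lim: "\<And>k. (\<lambda>n. cf (x (tn n)) k) \<longlonglongrightarrow> cf y0 k"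
  obtains y where "flow (\<lambda>_. 0) y0 y" "\<And>t x. 0 \<le> t \<Longrightarrow> a x * ev (y t) x = 0"
proof -
  obtain y where y: "flow a y0 y" using bbm_global_flow[OF a, of y0] unfolding flow_def by blast
  have z: "a x * ev (y t) x = 0" if "0 \<le> t" for t x
    by (rule dissip_zero[OF a omega_limit_dissip[OF a assms(3) y tn lim that]])
  have "flow (\<lambda>_. 0) y0 y"
    unfolding flow_def
  proof (intro allI impI)
    fix T :: real assume T: "0 \<le> T"
    have "field 1 (emb 1 a) (y t) = field 1 (emb 1 (\<lambda>_. 0)) (y t)" if "t \<in> {0..T}" for t
      by (rule field_undamped[OF a(1) z]) (use that in simp)
    then show "ode_sol (field 1 (emb 1 (\<lambda>_. 0))) T y0 y"
      using flowD[OF y T] unfolding ode_sol_def by simp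
  qed
  then show thesis using z by (rule that)
qed

lemma bbm_solution_flow:
  assumes a: "a \<in> sobolev 1" and u0: "u0 \<in> sobolev 1" and u: "\<forall>T>0. bbm_solution a 1 T u0 u"
  shows "flow a (emb 1 u0) (\<lambda>t. emb 1 (u t))" "\<And>t. 0 \<le> t \<Longrightarrow> u t \<in> sobolev 1"
proof -
  have *: "(\<forall>t\<in>{0..T}. u t \<in> sobolev 1) \<and> ode_sol (field 1 (emb 1 a)) T (emb 1 u0) (\<lambda>t. emb 1 (u t))" if "0 < T" for T
    using u that bbm_solution_iff[of 1 a u0 T u] a u0 by simp
  show "u t \<in> sobolev 1" if "0 \<le> t" for t using *[of "t + 1"] that by simp
  show "flow a (emb 1 u0) (\<lambda>t. emb 1 (u t))"
    unfolding flow_def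
  proof (intro allI impI)
    fix T :: real assume T: "0 \<le> T"
    have o: "ode_sol (field 1 (emb 1 a)) (T + 1) (emb 1 u0) (\<lambda>t. emb 1 (u t))" using *[of "T + 1"] T by simp
    show "ode_sol (field 1 (emb 1 a)) T (emb 1 u0) (\<lambda>t. emb 1 (u t))"
      unfolding ode_sol_def
    proof (intro conjI ballI)
      show "emb 1 (u 0) = emb 1 u0" by (rule ode_sol_0[OF o])
      fix t assume "t \<in> {0..T}"
      then show "((\<lambda>t. emb 1 (u t)) has_vector_derivative field 1 (emb 1 a) (emb 1 (u t))) (at t within {0..T})"
        using o unfolding ode_sol_def by (intro has_vector_derivative_within_subset[of _ _ _ "{0..T + 1}" "{0..T}"]) auto
    qed
  qed
qed

theorem weak_limit_vanishes:
  assumes a: "torus_smooth a" "\<And>x. 0 \<le> a x" and pos: "\<And>x. x \<in> \<omega> \<Longrightarrow> 0 < a x"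
    and u0: "u0 \<in> sobolev 1" and u: "\<forall>T>0. bbm_solution a 1 T u0 u"
    and tn: "\<And>n. 0 \<le> tn n" "filterlim tn at_top sequentially"
    and w: "sobolev_weak_limit 1 (\<lambda>n. u (tn n)) v0 sequentially"
  shows "\<exists>v. (\<forall>T>0. unique_bbm_solution (\<lambda>_. 0) 1 T v0 v) \<and> (\<exists>T>0. vanishes_on \<omega> T v)"
proof -
  have v0: "v0 \<in> sobolev 1" using w by (simp add: sobolev_weak_limit_def)
  obtain y where y: "flow (\<lambda>_. 0) (emb 1 v0) y" and z: "\<And>t x. 0 \<le> t \<Longrightarrow> a x * ev (y t) x = 0"
    using omega_limit_undamped[OF a bbm_solution_flow(1)[OF smooth_sobolev[OF a(1)] u0 u] tn weak_limit_cf[OF w]] by blast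
  have "\<forall>T>0. unique_bbm_solution (\<lambda>_. 0) 1 T v0 (\<lambda>t. representative 1 (y t))"
    using unique_bbm_solution_representative[OF _ sobolev_zero v0 _ flowD[OF y]] by simp
  moreover have "vanishes_on \<omega> 1 (\<lambda>t. representative 1 (y t))"
    unfolding vanishes_on_def
  proof (intro ballI)
    fix x t :: real assume x: "x \<in> \<omega>" and t: "t \<in> {0<..<1}"
    have "a x * ev (y t) x = 0" using z t by simp
    then have "ev (y t) x = 0" using pos[OF x] by simp
    then show "cont_rep (representative 1 (y t)) x = 0" by (simp add: cont_rep_ev representative)
  qed
  ultimately show ?thesis by (intro exI[of _ "\<lambda>t. representative 1 (y t)"] conjI exI[of _ 1]) auto
qed

section \<open>The potential of an undamped solution\<close>

text \<open>The primitive of \<open>q\<close> is periodic since the mean of \<open>q\<close> is zero, and it has the same coefficients as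
  \<open>p\<close> except for the mean. By uniqueness of coefficients and continuity, \<open>p\<close> differs from it by a constant.\<close>

lemma deriv_from_coeffs:
  fixes p q :: "real \<Rightarrow> real"
  assumes p: "torus_periodic p" "continuous_on UNIV p" and q: "torus_periodic q" "continuous_on UNIV q"
    and eq: "\<And>n. fourier_coeff q n = \<i> * of_int n * fourier_coeff p n"
  shows "(p has_real_derivative q x) (at x)"
proof -
  define P where "P x = (if 0 \<le> x then integral {0..x} q else - integral {x..0} q)" for x
  have P': "(P has_real_derivative q x) (at x)" for x
  proof -
    define N where "N = \<bar>x\<bar> + 1"
    have c: "continuous_on {- N..N} q" by (rule continuous_on_subset[OF q(2)]) simp
    have i: "q integrable_on {u..v}" for u v by (intro integrable_continuous_real continuous_on_subset[OF q(2)]) simp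
    have x: "x \<in> {- N..N}" unfolding N_def by auto
    have e: "P t = integral {- N..t} q - integral {- N..0} q" if "t \<in> {- N..N}" for t
    proof (cases "0 \<le> t")
      case True
      then show ?thesis using Henstock_Kurzweil_Integration.integral_combine[of "- N" 0 t q] i that unfolding P_def by (simp add: N_def)
    next
      case False
      then show ?thesis using Henstock_Kurzweil_Integration.integral_combine[of "- N" t 0 q] i that unfolding P_def by simp
    qed
    have "((\<lambda>t. integral {- N..t} q - integral {- N..0} q) has_vector_derivative q x - 0) (at x within {- N..N})"
      by (intro has_vector_derivative_diff has_vector_derivative_const integral_has_vector_derivative c x)
    then have "((\<lambda>t. integral {- N..t} q - integral {- N..0} q) has_vector_derivative q x) (at x within {- N..N})"
      by simp
    then have "(P has_vector_derivative q x) (at x within {- N..N})"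
      by (rule has_vector_derivative_transform[OF x, rotated]) (rule e)
    then have "(P has_real_derivative q x) (at x within {- N..N})"
      by (simp add: has_real_derivative_iff_has_vector_derivative)
    moreover have "at x within {- N..N} = at x"
      by (rule at_within_interior) (simp add: N_def, arith)
    ultimately show ?thesis by simp
  qed
  have Pc: "continuous_on UNIV P" using P' by (rule DERIV_continuous_on)
  have "q integrable_on {0..2*pi}" by (intro integrable_continuous_real continuous_on_subset[OF q(2)]) simp
  have q0: "integral {0..2*pi} q = 0"
  proof -
    have "complex_of_real (integral\<^sup>L circ q) = 0" unfolding fourier_coeff_zero eq by simp
    then have "(LINT x:{0..2*pi}|lborel. q x) = 0" by (simp add: circ_integral)
    moreover have "set_integrable lborel {0..2*pi} q"
      by (rule borel_integrable_atLeastAtMost') (rule continuous_on_subset[OF q(2)], simp)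
    ultimately show ?thesis using set_borel_integral_eq_integral(2) by metis
  qed
  have Pp: "torus_periodic P"
  proof -
    have "((\<lambda>x. P (x + 2 * pi) - P x) has_real_derivative q (x + 2 * pi) - q x) (at x)" for x
      using P'[of "x + 2 * pi"] by (intro DERIV_diff P') (simp add: DERIV_shift)
    then have "((\<lambda>x. P (x + 2 * pi) - P x) has_real_derivative 0) (at x)" for x
      using q(1) unfolding torus_periodic_def by simp
    then have "P (x + 2 * pi) - P x = P (0 + 2 * pi) - P 0" for x
      by (rule DERIV_isconst_all[rule_format]) 
    then show ?thesis using q0 unfolding torus_periodic_def by (simp add: P_def)
  qed
  have PL: "P \<in> L2_torus" and pL: "p \<in> L2_torus" by (rule continuous_L2[OF Pp Pc] continuous_L2[OF p])+
  define c where "c = Re (fourier_coeff (\<lambda>x. P x - p x) 0)"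
  have dL: "(\<lambda>x. P x - p x) \<in> L2_torus" by (rule L2_diff[OF PL pL])
  have co: "fourier_coeff (\<lambda>x. P x - p x) n = fourier_coeff P n - fourier_coeff p n" for n
    using fourier_coeff_lincomb[OF L2_integrable[OF PL] L2_integrable[OF pL], of 1 "-1" n] by simp
  have cL: "(\<lambda>x. c) \<in> L2_torus" by simp
  have "AE x in lborel. P x - p x = c"
  proof (rule fourier_unique[OF dL cL])
    fix n
    have c1: "fourier_coeff (\<lambda>x. c) n = c * (if n = 0 then 1 else 0)"
      using fourier_coeff_lincomb[OF L2_integrable[OF const_L2[of 1]] L2_integrable[OF const_L2[of 1]], of c 0 n] by (simp add: fourier_coeff_const)
    show "fourier_coeff (\<lambda>x. P x - p x) n = fourier_coeff (\<lambda>x. c) n"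
    proof (cases "n = 0")
      case True
      have "cnj (fourier_coeff (\<lambda>x. P x - p x) 0) = fourier_coeff (\<lambda>x. P x - p x) 0"
        using fourier_coeff_minus_index[of "\<lambda>x. P x - p x" 0] by simp
      then have "Im (fourier_coeff (\<lambda>x. P x - p x) 0) = 0" by (simp add: complex_eq_iff)
      then show ?thesis unfolding c1 using True by (simp add: c_def complex_eq_iff)
    next
      case False
      have "fourier_coeff q n = \<i> * of_int n * fourier_coeff P n" by (rule fourier_coeff_deriv[OF Pp P' q(2)])
      with eq[of n] False have "fourier_coeff P n = fourier_coeff p n" by simp
      then show ?thesis unfolding c1 co using False by simp
    qed
  qed
  then have "(\<lambda>x. P x - p x) = (\<lambda>x. c)"
    by (intro continuous_AE_eq_imp_eq continuous_on_diff Pc p(2) continuous_on_const)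
  then have "p x = P x - c" for x by (metis add_diff_cancel_left' diff_add_cancel fun_cong add.commute)
  then have "p = (\<lambda>x. P x - c)" by (rule ext)
  moreover have "((\<lambda>x. P x - c) has_real_derivative q x - 0) (at x)" by (intro DERIV_diff P' DERIV_const)
  ultimately show ?thesis by simp
qed

text \<open>The flux \<open>v + v\<^sup>2/2\<close> of the undamped equation \<open>(1 - \<partial>\<^sub>x\<^sup>2) v\<^sub>t = - (v + v\<^sup>2/2)\<^sub>x\<close>.\<close>

definition flux :: "hl2 \<Rightarrow> real \<Rightarrow> real" where
  "flux b x = ev b x + (ev b x)\<^sup>2 / 2"

text \<open>The function \<open>g\<close> with \<open>g - g'' = v + v\<^sup>2/2\<close>. Its coefficients carry the factor
  \<open>weight (- 2)\<close>, and its sequence in \<open>H\<^sup>1\<close> has \<open>weight 1\<close> in addition, which leaves the single factor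
  \<open>weight (- 1)\<close> of \<open>half_mult\<close>.\<close>

definition potential :: "hl2 \<Rightarrow> hl2" where
  "potential b = mul half_mult (emb 0 (flux b))"

text \<open>The time derivative of an undamped solution at the state \<open>b\<close>.\<close>

abbreviation rate :: "hl2 \<Rightarrow> hl2" where
  "rate b \<equiv> field 1 (emb 1 (\<lambda>_. 0)) b"

lemma ev_continuous: "continuous_on S (ev b)"
  by (rule continuous_on_ev) (intro continuous_intros)+

lemma flux_continuous: "continuous_on S (flux b)"
  unfolding flux_def by (intro continuous_intros ev_continuous) simp

lemma flux_periodic: "torus_periodic (flux b)"
  by (simp add: flux_def torus_periodic_def ev_periodic)

lemma ev_torus_periodic: "torus_periodic (ev b)"
  by (simp add: torus_periodic_def ev_periodic)

lemma flux_L2: "flux b \<in> L2_torus"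
  by (rule continuous_L2[OF flux_periodic flux_continuous])

lemma ev_sq_L2: "(\<lambda>x. ev b x * ev b x) \<in> L2_torus"
  by (rule continuous_L2) (auto simp: torus_periodic_def ev_periodic intro!: continuous_intros ev_continuous)

lemma fourier_ev: "fourier_coeff (ev b) = unweight 1 b"
  using unweight_emb[OF ev_sobolev, of b] by (simp add: emb_ev)

lemma fourier_ev_sq: "fourier_coeff (\<lambda>x. ev b x * ev b x) n = cf (wconv 1 b b) n"
  using coeff_mult_wconv[OF _ ev_sobolev ev_sobolev, of n b b] by (simp add: emb_ev)

lemma fourier_flux: "fourier_coeff (flux b) n = unweight 1 b n + cf (wconv 1 b b) n / 2"
proof -
  have "fourier_coeff (flux b) n = fourier_coeff (\<lambda>x. 1 * ev b x + (1/2) * (ev b x * ev b x)) n"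
    by (rule arg_cong[of _ _ "\<lambda>f. fourier_coeff f n"]) (simp add: flux_def power2_eq_square fun_eq_iff)
  also have "\<dots> = unweight 1 b n + cf (wconv 1 b b) n / 2"
    unfolding fourier_coeff_lincomb[OF L2_integrable[OF ev_L2] L2_integrable[OF ev_sq_L2]] fourier_ev fourier_ev_sq by simp
  finally show ?thesis .
qed

lemma fourier_potential: "fourier_coeff (ev (potential b)) n = weight (-2) n * fourier_coeff (flux b) n"
proof -
  have "weight (-1) n * (weight (-1) n * z) = weight (-2) n * z" for z :: complex
    by (simp add: mult.assoc[symmetric] weight_add flip: of_real_mult)
  then show ?thesis
    unfolding fourier_ev by (simp add: unweight_def potential_def cf_mul[OF multiplier_half] cf_emb_0[OF flux_L2])
qed

lemma fourier_rate: "fourier_coeff (ev (rate b)) n = - (\<i> * of_int n * fourier_coeff (ev (potential b)) n)"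
proof -
  have K0: "wconv 1 (emb 1 (\<lambda>_. 0)) b = 0"
    by (simp add: emb_zero bounded_bilinear.zero_left[OF bounded_bilinear_wconv])
  have g: "weight (-1) n * (weight (-1) n * z) = weight (-2) n * z" for z :: complex
    by (simp add: mult.assoc[symmetric] weight_add flip: of_real_mult)
  have "fourier_coeff (ev (rate b)) n = weight (-1) n * cf (rate b) n" by (simp add: fourier_ev unweight_def)
  also have "\<dots> = - (weight (-1) n * (transport_mult n * cf b n) + weight (-1) n * (deriv_mult n * cf (wconv 1 b b) n / 2))"
    by (simp add: cf_field K0 algebra_simps)
  also have "weight (-1) n * (transport_mult n * cf b n) = \<i> * of_int n * (weight (-2) n * unweight 1 b n)"
    by (simp add: transport_mult_def unweight_def mult_ac)
  also have "weight (-1) n * (deriv_mult n * cf (wconv 1 b b) n / 2) = \<i> * of_int n * (weight (-1) n * (weight (-1) n * (cf (wconv 1 b b) n / 2)))"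
    by (simp add: deriv_mult_def mult_ac)
  finally show ?thesis unfolding g fourier_potential fourier_flux by (simp add: algebra_simps)
qed

lemma fourier_minus_rate: "fourier_coeff (\<lambda>x. - ev (rate b) x) n = \<i> * of_int n * fourier_coeff (ev (potential b)) n"
  using fourier_coeff_lincomb[OF L2_integrable[OF ev_L2] L2_integrable[OF ev_L2], of "-1" "rate b" 0 "rate b" n] by (simp add: fourier_rate)

text \<open>The undamped equation in the form \<open>v\<^sub>t = - g\<^sub>x\<close>.\<close>

lemma potential_deriv: "(ev (potential b) has_real_derivative - ev (rate b) x) (at x)"
  by (rule deriv_from_coeffs[OF _ _ _ _ fourier_minus_rate])
     (auto intro!: ev_torus_periodic ev_continuous continuous_intros simp: torus_periodic_def ev_periodic)

lemma potential_deriv2: "((\<lambda>x. - ev (rate b) x) has_real_derivative ev (potential b) x - flux b x) (at x)"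
proof (rule deriv_from_coeffs)
  fix n
  note 1 = fourier_minus_rate[of b n]
  have 2: "fourier_coeff (\<lambda>x. ev (potential b) x - flux b x) n = fourier_coeff (ev (potential b)) n - fourier_coeff (flux b) n"
    using fourier_coeff_lincomb[OF L2_integrable[OF ev_L2] L2_integrable[OF flux_L2], of 1 "potential b" "-1" b n] by simp
  have 3: "fourier_coeff (flux b) n = (1 + (of_int n)\<^sup>2) * fourier_coeff (ev (potential b)) n"
  proof -
    have "complex_of_real (weight 2 n) * (weight (-2) n * fourier_coeff (flux b) n) = fourier_coeff (flux b) n"
      by (simp add: mult.assoc[symmetric] weight_add flip: of_real_mult)
    then show ?thesis unfolding fourier_potential by (simp add: weight_2)
  qed
  show "fourier_coeff (\<lambda>x. ev (potential b) x - flux b x) n = \<i> * of_int n * fourier_coeff (\<lambda>x. - ev (rate b) x) n"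
    unfolding 1 2 3 by (simp add: power2_eq_square algebra_simps)
qed (auto intro!: ev_torus_periodic ev_continuous continuous_intros flux_continuous simp: torus_periodic_def ev_periodic flux_def)

lemma sq_deriv:
  fixes f :: "real \<Rightarrow> real"
  assumes "(f has_real_derivative f') (at x)"
  shows "((\<lambda>x. (f x)\<^sup>2) has_real_derivative 2 * f x * f') (at x)"
  using assms by (auto intro!: derivative_eq_intros)

text \<open>Here \<open>(v + v\<^sup>2/2) v\<^sub>t = - (g - g\<^sub>x\<^sub>x) g\<^sub>x = \<partial>\<^sub>x (g\<^sub>x\<^sup>2 - g\<^sup>2) / 2\<close> is integrated by parts against
  \<open>exp (- k x)\<close>. The period starts at a zero of \<open>g\<close> and \<open>g\<^sub>x\<close>, so the weight, which is not periodic, produces no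
  boundary term. The case \<open>k = 0\<close> gives a conserved quantity and \<open>k = 4\<close> a Lyapunov function.\<close>

lemma flux_identity:
  assumes c: "ev (potential b) c = 0" "ev (rate b) c = 0" and S: "S = {c..c + 2 * pi}"
  shows "integral S (\<lambda>x. flux b x * ev (rate b) x * exp (- k * x)) =
     k / 2 * integral S (\<lambda>x. ((ev (rate b) x)\<^sup>2 - (ev (potential b) x)\<^sup>2) * exp (- k * x))"
proof -
  let ?g = "ev (potential b)" and ?q = "\<lambda>x. - ev (rate b) x"
  define H where "H x = - (1/2) * (((?g x)\<^sup>2 - (?q x)\<^sup>2) * exp (- k * x))" for x
  define h where "h x = flux b x * ev (rate b) x * exp (- k * x) - k / 2 * (((ev (rate b) x)\<^sup>2 - (?g x)\<^sup>2) * exp (- k * x))" for x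
  have H': "(H has_real_derivative h x) (at x)" for x
  proof -
    have e: "((\<lambda>x. exp (- k * x)) has_real_derivative - k * exp (- k * x)) (at x)"
      by (auto intro!: derivative_eq_intros)
    have s: "((\<lambda>x. (?g x)\<^sup>2 - (?q x)\<^sup>2) has_real_derivative 2 * ?g x * ?q x - 2 * ?q x * (?g x - flux b x)) (at x)"
      by (intro DERIV_diff sq_deriv potential_deriv potential_deriv2)
    have "(H has_real_derivative - (1/2) * ((2 * ?g x * ?q x - 2 * ?q x * (?g x - flux b x)) * exp (- k * x) + (- k * exp (- k * x)) * ((?g x)\<^sup>2 - (?q x)\<^sup>2))) (at x)"
      unfolding H_def by (intro DERIV_cmult DERIV_mult s e)
    then show ?thesis by (rule DERIV_cong) (simp add: h_def field_simps power2_eq_square)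
  qed
  have "(h has_integral (H (c + 2 * pi) - H c)) {c..c + 2 * pi}"
    by (rule fundamental_theorem_of_calculus)
       (use H' in \<open>auto simp: has_real_derivative_iff_has_vector_derivative[symmetric] intro: has_field_derivative_at_within\<close>)
  moreover have "H (c + 2 * pi) = 0" "H c = 0" unfolding H_def ev_periodic c by simp_all
  ultimately have 0: "integral S h = 0" unfolding S by (simp add: integral_unique)
  have i1: "(\<lambda>x. flux b x * ev (rate b) x * exp (- k * x)) integrable_on S"
    unfolding S by (intro integrable_continuous_real continuous_intros flux_continuous ev_continuous)
  have i2: "(\<lambda>x. k / 2 * (((ev (rate b) x)\<^sup>2 - (?g x)\<^sup>2) * exp (- k * x))) integrable_on S"
    unfolding S by (intro integrable_continuous_real continuous_intros flux_continuous ev_continuous)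
  have "integral S h = integral S (\<lambda>x. flux b x * ev (rate b) x * exp (- k * x)) - integral S (\<lambda>x. k / 2 * (((ev (rate b) x)\<^sup>2 - (?g x)\<^sup>2) * exp (- k * x)))"
    unfolding h_def by (rule Henstock_Kurzweil_Integration.integral_diff[OF i1 i2])
  with 0 show ?thesis by simp
qed

text \<open>The difference of the two sides is \<open>\<integral> (g\<^sub>x - 2 g)\<^sup>2 exp (- 4 x)\<close>: completing the square leaves the exact
  derivative \<open>(2 g\<^sup>2 exp (- 4 x))\<^sub>x\<close>, whose integral vanishes since \<open>g\<close> is zero at both ends. In general the
  weight \<open>exp (- k x)\<close> yields \<open>k\<^sup>2/4\<close> as Hardy constant; \<open>k = 4\<close> makes it \<open>4\<close>, which exceeds the \<open>1\<close>
  to be subtracted.\<close>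

lemma hardy:
  assumes c: "ev (potential b) c = 0" and S: "S = {c..c + 2 * pi}"
  shows "3 * integral S (\<lambda>x. (ev (potential b) x)\<^sup>2 * exp (- 4 * x)) \<le>
     integral S (\<lambda>x. ((ev (rate b) x)\<^sup>2 - (ev (potential b) x)\<^sup>2) * exp (- 4 * x))"
proof -
  let ?g = "ev (potential b)" and ?q = "\<lambda>x. - ev (rate b) x"
  define H where "H x = 2 * ((?g x)\<^sup>2 * exp (- 4 * x))" for x
  define h where "h x = (4 * ?g x * ?q x - 8 * (?g x)\<^sup>2) * exp (- 4 * x)" for x
  have H': "(H has_real_derivative h x) (at x)" for x
  proof -
    have e: "((\<lambda>x::real. exp (- 4 * x)) has_real_derivative - 4 * exp (- 4 * x)) (at x)"
      by (auto intro!: derivative_eq_intros)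
    have s: "((\<lambda>x. (?g x)\<^sup>2) has_real_derivative 2 * ?g x * ?q x) (at x)"
      by (intro sq_deriv potential_deriv)
    have "(H has_real_derivative 2 * ((2 * ?g x * ?q x) * exp (- 4 * x) + (- 4 * exp (- 4 * x)) * (?g x)\<^sup>2)) (at x)"
      unfolding H_def by (intro DERIV_cmult DERIV_mult s e)
    then show ?thesis by (rule DERIV_cong) (simp add: h_def algebra_simps)
  qed
  have "(h has_integral (H (c + 2 * pi) - H c)) {c..c + 2 * pi}"
    by (rule fundamental_theorem_of_calculus)
       (use H' in \<open>auto simp: has_real_derivative_iff_has_vector_derivative[symmetric] intro: has_field_derivative_at_within\<close>)
  moreover have "H (c + 2 * pi) = 0" "H c = 0" unfolding H_def ev_periodic c by simp_all
  ultimately have h0: "(h has_integral 0) S" unfolding S by simp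
  have i1: "(\<lambda>x. (?g x)\<^sup>2 * exp (- 4 * x)) integrable_on S" and i2: "(\<lambda>x. ((ev (rate b) x)\<^sup>2 - (?g x)\<^sup>2) * exp (- 4 * x)) integrable_on S"
    unfolding S by (intro integrable_continuous_real continuous_intros ev_continuous)+
  have "((\<lambda>x. 3 * ((?g x)\<^sup>2 * exp (- 4 * x)) + h x) has_integral (3 * integral S (\<lambda>x. (?g x)\<^sup>2 * exp (- 4 * x)) + 0)) S"
    by (intro has_integral_add has_integral_mult_right integrable_integral i1 h0)
  moreover have "((\<lambda>x. ((ev (rate b) x)\<^sup>2 - (?g x)\<^sup>2) * exp (- 4 * x)) has_integral integral S (\<lambda>x. ((ev (rate b) x)\<^sup>2 - (?g x)\<^sup>2) * exp (- 4 * x))) S"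
    by (rule integrable_integral[OF i2])
  ultimately have "3 * integral S (\<lambda>x. (?g x)\<^sup>2 * exp (- 4 * x)) + 0 \<le> integral S (\<lambda>x. ((ev (rate b) x)\<^sup>2 - (?g x)\<^sup>2) * exp (- 4 * x))"
  proof (rule has_integral_le)
    fix x
    have "0 \<le> (?q x - 2 * ?g x)\<^sup>2 * exp (- 4 * x)" by simp
    also have "\<dots> = ((ev (rate b) x)\<^sup>2 - (?g x)\<^sup>2) * exp (- 4 * x) - (3 * ((?g x)\<^sup>2 * exp (- 4 * x)) + h x)"
      unfolding h_def by (simp add: power2_eq_square algebra_simps)
    finally show "3 * ((?g x)\<^sup>2 * exp (- 4 * x)) + h x \<le> ((ev (rate b) x)\<^sup>2 - (?g x)\<^sup>2) * exp (- 4 * x)" by simp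
  qed
  then show ?thesis by simp
qed

lemma integral_period:
  fixes h :: "real \<Rightarrow> real"
  assumes h: "continuous_on UNIV h" "torus_periodic h" and c: "0 \<le> c"
  shows "integral {c..c + 2 * pi} h = integral\<^sup>L circ h"
proof -
  have i: "h integrable_on {u..v}" for u v by (intro integrable_continuous_real continuous_on_subset[OF h(1)]) simp
  have "integral {0..c} h + integral {c..c + 2 * pi} h = integral {0..c + 2 * pi} h"
    by (rule Henstock_Kurzweil_Integration.integral_combine) (use c i in auto)
  also have "\<dots> = integral {0..2 * pi} h + integral {2 * pi..c + 2 * pi} h"
    by (rule Henstock_Kurzweil_Integration.integral_combine[symmetric]) (use c i in auto)
  also have "integral {2 * pi..c + 2 * pi} h = integral {0..c} (h \<circ> (+) (2 * pi))"
    using integral_shift_Icc_real[of 0 c h "2 * pi"] by simp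
  also have "h \<circ> (+) (2 * pi) = h" using h(2) by (auto simp: torus_periodic_def fun_eq_iff add.commute[of "2 * pi"])
  finally have "integral {c..c + 2 * pi} h = integral {0..2 * pi} h" by simp
  also have "\<dots> = (LINT x:{0..2*pi}|lborel. h x)"
    by (rule set_borel_integral_eq_integral(2)[symmetric], rule borel_integrable_atLeastAtMost', rule continuous_on_subset[OF h(1)]) simp
  finally show ?thesis by (simp add: circ_integral)
qed

section \<open>Unique continuation from all positive times\<close>

lemma torus_smooth_zero: "torus_smooth (\<lambda>_. 0)"
proof -
  have "(deriv ^^ k) (\<lambda>_. 0) = (\<lambda>_::real. 0::real)" for k
    by (induction k) simp_all
  then show ?thesis by (simp add: torus_smooth_def torus_periodic_def)
qed

text \<open>The energy identity with \<open>a = 0\<close>.\<close>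

lemma undamped_norm:
  assumes y: "flow (\<lambda>_. 0) y0 y" and t: "0 \<le> t" shows "norm (y t) = norm y0"
proof -
  have "dissip (\<lambda>_. 0) b = 0" for b by (simp add: dissip_def)
  then have "((\<lambda>t. 0::real) has_integral pi * ((norm y0)\<^sup>2 - (norm (y t))\<^sup>2)) {0..t}"
    using flow_dissip_integral(1)[OF torus_smooth_zero y t] by simp
  then have "pi * ((norm y0)\<^sup>2 - (norm (y t))\<^sup>2) = 0" using has_integral_0 has_integral_unique by blast
  then show ?thesis by simp
qed

text \<open>On \<open>\<omega>\<close> the time derivative \<open>v\<^sub>t = - g\<^sub>x\<close> vanishes with \<open>v\<close>. Since \<open>\<omega>\<close> is open this can be
  differentiated in \<open>x\<close>, and \<open>g = g\<^sub>x\<^sub>x + v + v\<^sup>2/2 = 0\<close>.\<close>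

lemma vanishing_boundary:
  assumes y: "flow (\<lambda>_. 0) y0 y" and \<omega>: "open \<omega>"
    and z: "\<And>t x. 0 \<le> t \<Longrightarrow> x \<in> \<omega> \<Longrightarrow> ev (y t) x = 0" and t: "0 \<le> t" and x: "x \<in> \<omega>"
  shows "ev (rate (y t)) x = 0" "ev (potential (y t)) x = 0"
proof -
  have r: "ev (rate (y t)) x = 0" if x: "x \<in> \<omega>" for x
  proof -
    have tt: "t \<in> {0..t + 1}" using t by simp
    have D1: "((\<lambda>s. ev (y s) x) has_vector_derivative ev (rate (y t)) x) (at t within {0..t + 1})"
      unfolding ev_def by (rule bounded_linear.has_vector_derivative[OF bounded_linear_inner_left flow_derivative[OF y tt]])
    have D2: "((\<lambda>s. ev (y s) x) has_vector_derivative 0) (at t within {0..t + 1})"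
      by (rule has_vector_derivative_transform[OF tt _ has_vector_derivative_const[of 0]]) (simp add: z x)
    show ?thesis
      by (rule vector_derivative_unique_within_closed_interval[OF _ _ D1[folded cbox_interval] D2[folded cbox_interval]]) (use t in auto)
  qed
  from x show "ev (rate (y t)) x = 0" by (rule r)
  have "((\<lambda>x. - ev (rate (y t)) x) has_real_derivative 0) (at x)"
    by (rule has_field_derivative_transform_within_open[OF DERIV_const \<omega> x]) (simp add: r)
  from DERIV_unique[OF potential_deriv2[of "y t" x] this]
  have "ev (potential (y t)) x - flux (y t) x = 0" .
  then show "ev (potential (y t)) x = 0" using z[OF t x] by (simp add: flux_def)
qed

text \<open>For \<open>k = 0\<close> this is a Hamiltonian of the undamped equation.\<close>

definition weighted_hamiltonian :: "real \<Rightarrow> real \<Rightarrow> hl2 \<Rightarrow> real" where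
  "weighted_hamiltonian k c b = integral {c..c + 2 * pi} (\<lambda>x. ((ev b x)\<^sup>2 / 2 + (ev b x) ^ 3 / 6) * exp (- k * x))"

lemma weighted_hamiltonian_derivative:
  assumes y: "flow (\<lambda>_. 0) y0 y" and t: "t \<in> {0..T}"
  shows "((\<lambda>t. weighted_hamiltonian k c (y t)) has_vector_derivative
     integral {c..c + 2 * pi} (\<lambda>x. flux (y t) x * ev (rate (y t)) x * exp (- k * x))) (at t within {0..T})"
proof -
  let ?f = "\<lambda>t x. ((ev (y t) x)\<^sup>2 / 2 + (ev (y t) x) ^ 3 / 6) * exp (- k * x)"
  let ?fx = "\<lambda>t x. flux (y t) x * ev (rate (y t)) x * exp (- k * x)"
  have yc: "continuous_on ({0..T} \<times> S) (\<lambda>z. y (fst z))" for S :: "real set"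
    by (rule continuous_on_compose2[OF flow_continuous[OF y]]) (auto intro!: continuous_intros)
  have rc: "continuous_on ({0..T} \<times> S) (\<lambda>z. rate (y (fst z)))" for S :: "real set"
    by (rule continuous_on_field[OF _ yc]) simp
  have "((\<lambda>t. integral (cbox c (c + 2 * pi)) (?f t)) has_vector_derivative integral (cbox c (c + 2 * pi)) (?fx t)) (at t within {0..T})"
  proof (rule leibniz_rule_vector_derivative)
    fix s x :: real assume s: "s \<in> {0..T}"
    have v: "((\<lambda>s. ev (y s) x) has_real_derivative ev (rate (y s)) x) (at s within {0..T})"
      unfolding has_real_derivative_iff_has_vector_derivative ev_def
      by (rule bounded_linear.has_vector_derivative[OF bounded_linear_inner_left flow_derivative[OF y s]])
    have "((\<lambda>s. ?f s x) has_real_derivative ?fx s x) (at s within {0..T})"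
      by (rule derivative_eq_intros v refl | simp add: flux_def field_simps power2_eq_square power3_eq_cube)+
    then show "((\<lambda>s. ?f s x) has_vector_derivative ?fx s x) (at s within {0..T})"
      by (simp add: has_real_derivative_iff_has_vector_derivative)
  next
    fix s assume "s \<in> {0..T}"
    show "?f s integrable_on cbox c (c + 2 * pi)"
      by (intro integrable_continuous continuous_intros ev_continuous) simp_all
  next
    show "continuous_on ({0..T} \<times> cbox c (c + 2 * pi)) (\<lambda>(t, x). ?fx t x)"
      unfolding flux_def split_beta
      by (intro continuous_intros continuous_on_ev yc rc) simp_all
  qed (use t in auto)
  then show ?thesis unfolding weighted_hamiltonian_def by simp
qed

lemma weighted_hamiltonian_bound:
  assumes b: "\<And>x. \<bar>ev b x\<bar> \<le> M" and k: "0 \<le> k" and c: "0 \<le> c"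
  shows "\<bar>weighted_hamiltonian k c b\<bar> \<le> (M\<^sup>2 / 2 + M ^ 3 / 6) * (2 * pi)"
proof -
  have M0: "0 \<le> M" using b[of 0] abs_ge_zero order_trans by blast
  have "norm (weighted_hamiltonian k c b) \<le> (M\<^sup>2 / 2 + M ^ 3 / 6) * (c + 2 * pi - c)"
    unfolding weighted_hamiltonian_def
  proof (rule integral_bound)
    show "continuous_on {c..c + 2 * pi} (\<lambda>x. ((ev b x)\<^sup>2 / 2 + (ev b x) ^ 3 / 6) * exp (- k * x))"
      by (intro continuous_intros ev_continuous) simp_all
    fix x assume "x \<in> {c..c + 2 * pi}"
    then have x: "0 \<le> x" using c by simp
    have "\<bar>(ev b x)\<^sup>2 / 2 + (ev b x) ^ 3 / 6\<bar> \<le> \<bar>ev b x\<bar>\<^sup>2 / 2 + \<bar>ev b x\<bar> ^ 3 / 6"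
      by (rule order_trans[OF abs_triangle_ineq]) (simp add: power_abs)
    also have "\<dots> \<le> M\<^sup>2 / 2 + M ^ 3 / 6" by (intro add_mono divide_right_mono power_mono b) auto
    finally have "\<bar>(ev b x)\<^sup>2 / 2 + (ev b x) ^ 3 / 6\<bar> * exp (- k * x) \<le> (M\<^sup>2 / 2 + M ^ 3 / 6) * 1"
      using k x M0 by (intro mult_mono) (auto intro!: add_nonneg_nonneg)
    then show "norm (((ev b x)\<^sup>2 / 2 + (ev b x) ^ 3 / 6) * exp (- k * x)) \<le> M\<^sup>2 / 2 + M ^ 3 / 6"
      by (simp add: abs_mult)
  qed simp
  then show ?thesis by simp
qed

lemma potential_lower:
  assumes c: "0 \<le> c"
  shows "exp (- 4 * (c + 2 * pi)) * (2 * pi) * (norm (mul half_mult (potential b)))\<^sup>2 \<le>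
     integral {c..c + 2 * pi} (\<lambda>x. (ev (potential b) x)\<^sup>2 * exp (- 4 * x))"
proof -
  let ?g = "ev (potential b)"
  have "exp (- 4 * (c + 2 * pi)) * (2 * pi) * (norm (mul half_mult (potential b)))\<^sup>2 = exp (- 4 * (c + 2 * pi)) * integral {c..c + 2 * pi} (\<lambda>x. (?g x)\<^sup>2)"
    by (subst integral_period[OF _ _ c]) (auto intro!: continuous_intros ev_continuous simp: integral_ev_sq torus_periodic_def ev_periodic)
  also have "\<dots> = integral {c..c + 2 * pi} (\<lambda>x. exp (- 4 * (c + 2 * pi)) * (?g x)\<^sup>2)" by simp
  also have "\<dots> \<le> integral {c..c + 2 * pi} (\<lambda>x. (?g x)\<^sup>2 * exp (- 4 * x))"
  proof (rule integral_le)
    fix x assume "x \<in> {c..c + 2 * pi}"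
    then have "exp (- 4 * (c + 2 * pi)) \<le> exp (- 4 * x)" by simp
    from mult_right_mono[OF this, of "(?g x)\<^sup>2"] show "exp (- 4 * (c + 2 * pi)) * (?g x)\<^sup>2 \<le> (?g x)\<^sup>2 * exp (- 4 * x)"
      by (simp only: mult.commute) simp
  qed (intro integrable_continuous_real continuous_intros ev_continuous)+
  finally show ?thesis .
qed

text \<open>If \<open>g\<close> stayed away from zero in \<open>L\<^sup>2\<close>, then by the flux identity and Hardy's inequality the weighted
  Hamiltonian would grow at least linearly, although it is bounded along the trajectory.\<close>

lemma potential_recurs:
  assumes y: "flow (\<lambda>_. 0) y0 y" and \<omega>: "open \<omega>"
    and z: "\<And>t x. 0 \<le> t \<Longrightarrow> x \<in> \<omega> \<Longrightarrow> ev (y t) x = 0" and c: "c \<in> \<omega>" "0 \<le> c"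
    and e: "0 < e" and N: "0 \<le> N"
  shows "\<exists>t\<ge>N. norm (mul half_mult (potential (y t))) < e"
proof (rule ccontr)
  assume "\<not> ?thesis"
  then have ge: "e \<le> norm (mul half_mult (potential (y t)))" if "N \<le> t" for t using that by force
  \<comment> \<open>The factor \<open>6\<close> is \<open>3\<close> from Hardy's inequality times \<open>k / 2 = 2\<close> from the flux identity.\<close>
  define \<eta> where "\<eta> = 6 * (exp (- 4 * (c + 2 * pi)) * (2 * pi) * e\<^sup>2)"
  have \<eta>: "0 < \<eta>" unfolding \<eta>_def using e by simp
  define M where "M = norm y0 * kernel_norm"
  define B where "B = (M\<^sup>2 / 2 + M ^ 3 / 6) * (2 * pi)"
  have evb: "\<bar>ev (y t) x\<bar> \<le> M" if "0 \<le> t" for t x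
    using ev_bound[of "y t" x] undamped_norm[OF y that] unfolding M_def by simp
  have B: "\<bar>weighted_hamiltonian 4 c (y t)\<bar> \<le> B" if "0 \<le> t" for t
    unfolding B_def by (rule weighted_hamiltonian_bound[OF evb[OF that] _ c(2)]) simp
  define D where "D t = integral {c..c + 2 * pi} (\<lambda>x. flux (y t) x * ev (rate (y t)) x * exp (- 4 * x))" for t
  have Dge: "\<eta> \<le> D t" if t: "N \<le> t" for t
  proof -
    have t0: "0 \<le> t" using t N by simp
    note g0 = vanishing_boundary(2)[OF y \<omega> z t0 c(1)]
    note r0 = vanishing_boundary(1)[OF y \<omega> z t0 c(1)]
    have "e\<^sup>2 \<le> (norm (mul half_mult (potential (y t))))\<^sup>2" using ge[OF t] e by (intro power_mono) auto
    then have "\<eta> \<le> 6 * (exp (- 4 * (c + 2 * pi)) * (2 * pi) * (norm (mul half_mult (potential (y t))))\<^sup>2)"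
      unfolding \<eta>_def by (intro mult_left_mono) auto
    also have "\<dots> \<le> 6 * integral {c..c + 2 * pi} (\<lambda>x. (ev (potential (y t)) x)\<^sup>2 * exp (- 4 * x))"
      by (intro mult_left_mono potential_lower c) simp
    also have "\<dots> \<le> 2 * integral {c..c + 2 * pi} (\<lambda>x. ((ev (rate (y t)) x)\<^sup>2 - (ev (potential (y t)) x)\<^sup>2) * exp (- 4 * x))"
      using hardy[OF g0 refl] by linarith
    also have "\<dots> = D t" unfolding D_def using flux_identity[OF g0 r0 refl, of 4] by simp
    finally show ?thesis .
  qed
  \<comment> \<open>Until time \<open>T\<close> the quantity would grow by \<open>2 * B + 1\<close>, too much for one that is bounded by \<open>B\<close>.\<close>
  define T where "T = N + (2 * B + 1) / \<eta>"
  have B0: "0 \<le> B" using B[of 0] by simp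
  have NT: "N \<le> T" unfolding T_def using \<eta> B0 by simp
  have I1: "(D has_integral (weighted_hamiltonian 4 c (y T) - weighted_hamiltonian 4 c (y N))) {N..T}"
  proof (rule fundamental_theorem_of_calculus[OF NT])
    fix t assume t: "t \<in> {N..T}"
    have "((\<lambda>t. weighted_hamiltonian 4 c (y t)) has_vector_derivative D t) (at t within {0..T})"
      unfolding D_def by (rule weighted_hamiltonian_derivative[OF y]) (use t N in simp)
    then show "((\<lambda>t. weighted_hamiltonian 4 c (y t)) has_vector_derivative D t) (at t within {N..T})"
      by (rule has_vector_derivative_within_subset) (use N in auto)
  qed
  have I2: "((\<lambda>t. \<eta>) has_integral (\<eta> * (T - N))) {N..T}"
    using has_integral_const_real[of \<eta> N T] NT by (simp add: mult.commute)
  have "\<eta> * (T - N) \<le> weighted_hamiltonian 4 c (y T) - weighted_hamiltonian 4 c (y N)"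
    by (rule has_integral_le[OF I2 I1]) (use Dge in simp)
  moreover have "\<eta> * (T - N) = 2 * B + 1" unfolding T_def using \<eta> by simp
  ultimately show False using B[of T] B[of N] NT N by linarith
qed

lemma hamiltonian_conserved:
  assumes y: "flow (\<lambda>_. 0) y0 y" and \<omega>: "open \<omega>"
    and z: "\<And>t x. 0 \<le> t \<Longrightarrow> x \<in> \<omega> \<Longrightarrow> ev (y t) x = 0" and c: "c \<in> \<omega>" and T: "0 \<le> T"
  shows "weighted_hamiltonian 0 c (y T) = weighted_hamiltonian 0 c y0"
proof -
  have "((\<lambda>t. 0::real) has_integral (weighted_hamiltonian 0 c (y T) - weighted_hamiltonian 0 c (y 0))) {0..T}"
  proof (rule fundamental_theorem_of_calculus[OF T])
    fix t assume t: "t \<in> {0..T}"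
    have t0: "0 \<le> t" using t by simp
    have "integral {c..c + 2 * pi} (\<lambda>x. flux (y t) x * ev (rate (y t)) x * exp (- 0 * x)) = 0"
      using flux_identity[OF vanishing_boundary(2,1)[OF y \<omega> z t0 c] refl, of 0] by simp
    then show "((\<lambda>t. weighted_hamiltonian 0 c (y t)) has_vector_derivative 0) (at t within {0..T})"
      using weighted_hamiltonian_derivative[OF y t, of 0 c] by simp
  qed
  then have "weighted_hamiltonian 0 c (y T) - weighted_hamiltonian 0 c (y 0) = 0" using has_integral_0 has_integral_unique by blast
  then show ?thesis by (simp add: flow_0[OF y])
qed

definition rough_kernel :: "real \<Rightarrow> hl2" where
  "rough_kernel x = Hl2 (\<lambda>n. complex_of_real (weight (-3/4) n) * cis (- (of_int n * x)))"

definition rough_kernel_norm :: real where "rough_kernel_norm = sqrt (\<Sum>\<^sub>\<infinity>n. weight (-3/2) n)"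

text \<open>Point evaluation remains bounded in the norm of \<open>H\<^sup>s\<close> for \<open>s = 3/4\<close>, because \<open>- 3/4\<close> is still a square summable
  exponent. The remaining \<open>- 1/4\<close> is a multiplier that tends to zero, so that weak convergence in \<open>H\<^sup>1\<close> implies
  uniform convergence.\<close>

lemma ev_bound_quarter: "\<bar>ev b x\<bar> \<le> norm (mul (\<lambda>n. weight (-1/4) n) b) * rough_kernel_norm"
proof -
  define p :: real where "p = -3/4"
  have sq: "(weight p n)\<^sup>2 = weight (-3/2) n" for n by (simp add: power2_eq_square weight_add p_def)
  have "l2 (\<lambda>n. complex_of_real (weight p n) * cis (- (of_int n * x)))"
  proof (rule l2_mono[of "weight p"])
    show "(\<lambda>n. (weight p n)\<^sup>2) summable_on UNIV" unfolding sq by (rule summable_weight) simp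
  qed (simp add: norm_mult)
  moreover have "hermitian (\<lambda>n. complex_of_real (weight p n) * cis (- (of_int n * x)))"
    by (simp add: hermitian_def cis_cnj)
  ultimately have ck: "cf (rough_kernel x) n = complex_of_real (weight p n) * cis (- (of_int n * x))" for n
    unfolding rough_kernel_def p_def[symmetric] by (simp add: cf_Hl2)
  have m: "multiplier 1 (\<lambda>n. complex_of_real (weight (-1/4) n))" by (simp add: multiplier_def hermitian_weight weight_le_1)
  have "ev b x = inner (mul (\<lambda>n. weight (-1/4) n) b) (rough_kernel x)"
    unfolding ev_def
  proof (rule inner_hl2_cong)
    fix n
    have "weight (-1/4) n * weight p n = weight (-1) n" by (simp add: weight_add p_def)
    then show "inner (cf b n) (cf (point_kernel x) n) = inner (cf (mul (\<lambda>n. weight (-1/4) n) b) n) (cf (rough_kernel x) n)"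
      unfolding cf_point_kernel ck cf_mul[OF m] inner_of_real_mult by (simp only: mult.assoc[symmetric] mult.commute[of "weight p n"])
  qed
  moreover have "norm (rough_kernel x) = rough_kernel_norm"
    unfolding norm_eq_l2norm l2norm_def rough_kernel_norm_def by (simp add: ck norm_mult sq)
  ultimately show ?thesis using Cauchy_Schwarz_ineq2[of "mul (\<lambda>n. weight (-1/4) n) b" "rough_kernel x"] by simp
qed

lemma ev_zero_imp_zero: assumes "\<And>x. ev b x = 0" shows "b = 0"
proof -
  have "ev b = (\<lambda>_. 0)" using assms by (rule ext)
  then have "emb 1 (ev b) = 0" by (simp add: emb_zero)
  then show ?thesis by (simp add: emb_ev)
qed

text \<open>A continuous function with values in \<open>{0, - 2}\<close> is constant.\<close>

lemma stationary_zero: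
  assumes p: "\<And>n. fourier_coeff (flux w) n = 0" and c: "ev w c = 0"
  shows "w = 0"
proof (rule ev_zero_imp_zero)
  fix x
  have "AE x in lborel. flux w x = (\<lambda>_. 0) x"
    by (rule fourier_unique[OF flux_L2]) (use p in \<open>simp_all add: fourier_coeff_circ\<close>)
  then have "flux w = (\<lambda>_. 0)"
    by (intro continuous_AE_eq_imp_eq flux_continuous continuous_on_const)
  then have m: "ev w x * (ev w x + 2) = 0" for x
    using fun_cong[of "flux w" "\<lambda>_. 0" x] unfolding flux_def by (simp add: power2_eq_square field_simps)
  show "ev w x = 0"
  proof (rule ccontr)
    assume "ev w x \<noteq> 0"
    then have x: "ev w x = -2" using m[of x] by simp
    have "connected (range (ev w))" by (rule connected_continuous_image[OF ev_continuous connected_UNIV])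
    then have i: "is_interval (range (ev w))" by (simp add: is_interval_connected_1)
    have "ev w x \<in> range (ev w)" "ev w c \<in> range (ev w)" by auto
    then have "-1 \<in> range (ev w)"
      using i unfolding is_interval_1 x c by (metis neg_le_0_iff_le neg_le_iff_le one_le_numeral zero_le_one)
    then obtain v where "ev w v = -1" by auto
    with m[of v] show False by simp
  qed
qed

text \<open>The flux depends only on the function in \<open>L\<^sup>2\<close>, in which weakly convergent sequences of \<open>H\<^sup>1\<close> converge
  strongly. Hence the quadratic term passes to weak limits.\<close>

lemma flux_coeff_low:
  "fourier_coeff (flux b) n = cf (mul half_mult b) n + complex_of_real (weight 1 n) * cf (wconv 0 (mul half_mult b) (mul half_mult b)) n / 2"
proof -
  have "complex_of_real (weight 1 n) * (weight (-1) n * z) = z" for z :: complex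
    by (simp add: mult.assoc[symmetric] weight_add flip: of_real_mult)
  then show ?thesis
    unfolding fourier_flux wconv_project cf_mul[OF multiplier_half] by (simp add: unweight_def)
qed

lemma flux_coeff_tendsto:
  assumes b: "\<And>n. norm (x n) \<le> R" and c: "\<And>k. (\<lambda>n. cf (x n) k) \<longlonglongrightarrow> cf w k"
  shows "(\<lambda>n. fourier_coeff (flux (x n)) k) \<longlonglongrightarrow> fourier_coeff (flux w) k"
proof -
  have l: "(\<lambda>n. mul half_mult (x n)) \<longlonglongrightarrow> mul half_mult w"
    by (rule weight_mul_tendsto[where R=R]) (use b c in auto)
  have "(\<lambda>n. wconv 0 (mul half_mult (x n)) (mul half_mult (x n))) \<longlonglongrightarrow> wconv 0 (mul half_mult w) (mul half_mult w)"
    by (rule bounded_bilinear.tendsto[OF bounded_bilinear_wconv l l]) simp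
  then show ?thesis
    unfolding flux_coeff_low
    by (intro tendsto_intros bounded_linear.tendsto[OF bounded_linear_cf] l) simp_all
qed

text \<open>The quiet times of \<open>potential_recurs\<close> have a weak limit point, which is stationary and hence zero. The
  Hamiltonian and the norm are conserved, so smallness at one time carries back to time zero.\<close>

theorem unique_continuation:
  assumes y: "flow (\<lambda>_. 0) y0 y" and \<omega>: "open \<omega>"
    and z: "\<And>t x. 0 \<le> t \<Longrightarrow> x \<in> \<omega> \<Longrightarrow> ev (y t) x = 0" and c: "c \<in> \<omega>" "0 \<le> c"
  shows "y0 = 0"
proof -
  have "\<exists>t\<ge>real n. norm (mul half_mult (potential (y t))) < 1 / real (Suc n)" for n
    by (rule potential_recurs[OF y \<omega> z c]) auto
  then obtain tn where tn: "\<And>n. real n \<le> tn n" "\<And>n. norm (mul half_mult (potential (y (tn n)))) < 1 / real (Suc n)"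
    by metis
  have tn0: "0 \<le> tn n" for n using tn(1)[of n] by linarith
  have bd: "norm (y (tn n)) \<le> norm y0" for n using undamped_norm[OF y tn0] by simp
  obtain r w where r: "strict_mono r" and w: "\<And>k. (\<lambda>n. cf (y (tn (r n))) k) \<longlonglongrightarrow> cf w k"
    using bounded_sequence_weakly_compact[of "\<lambda>n. y (tn n)", OF bd] by blast
  have pot0: "(\<lambda>n. mul half_mult (potential (y (tn (r n))))) \<longlonglongrightarrow> 0"
  proof (rule Lim_null_comparison)
    show "\<forall>\<^sub>F n in sequentially. norm (mul half_mult (potential (y (tn (r n))))) \<le> 1 / real (Suc (r n))"
      by (rule always_eventually, rule allI, rule less_imp_le, rule tn(2))
    show "(\<lambda>n. 1 / real (Suc (r n))) \<longlonglongrightarrow> 0"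
      using LIMSEQ_subseq_LIMSEQ[OF LIMSEQ_Suc[OF lim_1_over_n] r] by (simp add: o_def)
  qed
  have "fourier_coeff (flux w) k = 0" for k
  proof -
    have "(\<lambda>n. cf (mul half_mult (potential (y (tn (r n))))) k) \<longlonglongrightarrow> cf 0 k"
      by (rule bounded_linear.tendsto[OF bounded_linear_cf pot0])
    then have "(\<lambda>n. weight 2 k * cf (mul half_mult (potential (y (tn (r n))))) k) \<longlonglongrightarrow> weight 2 k * cf 0 k"
      by (intro tendsto_intros)
    moreover have "weight 2 k * cf (mul half_mult (potential b)) k = fourier_coeff (flux b) k" for b
    proof -
      have "complex_of_real (weight 2 k) * (weight (-1) k * (weight (-1) k * z)) = z" for z :: complex
        by (simp add: mult.assoc[symmetric] weight_add flip: of_real_mult)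
      then show ?thesis by (simp add: potential_def cf_mul[OF multiplier_half] cf_emb_0[OF flux_L2])
    qed
    ultimately have "(\<lambda>n. fourier_coeff (flux (y (tn (r n)))) k) \<longlonglongrightarrow> 0" by simp
    with flux_coeff_tendsto[OF bd w] show ?thesis using LIMSEQ_unique by blast
  qed
  moreover have "ev w c = 0"
  proof -
    have "(\<lambda>n. inner (y (tn (r n))) (point_kernel c)) \<longlonglongrightarrow> inner w (point_kernel c)"
      by (rule weak_tendsto[where R="norm y0", OF _ w]) (use bd in auto)
    moreover have "inner (y (tn (r n))) (point_kernel c) = 0" for n using z[OF tn0 c(1)] by (simp add: ev_def)
    ultimately show ?thesis by (simp add: ev_def LIMSEQ_const_iff)
  qed
  ultimately have "w = 0" by (rule stationary_zero)
  have "(\<lambda>n. mul (\<lambda>k. weight (-1/4) k) (y (tn (r n)))) \<longlonglongrightarrow> mul (\<lambda>k. weight (-1/4) k) 0"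
    using w unfolding \<open>w = 0\<close> by (intro weight_mul_tendsto[where R="norm y0"]) (use bd in auto)
  moreover have "mul (\<lambda>k. complex_of_real (weight (-1/4) k)) 0 = 0"
    by (rule linear_0, rule bounded_linear.linear, rule bounded_linear_mul[of 1])
       (simp add: multiplier_def hermitian_weight weight_le_1)
  ultimately have q0: "(\<lambda>n. norm (mul (\<lambda>k. weight (-1/4) k) (y (tn (r n)))) * rough_kernel_norm) \<longlonglongrightarrow> 0"
    using tendsto_mult_right[OF tendsto_norm, of _ 0 sequentially rough_kernel_norm] by fastforce
  define S where "S n = norm (mul (\<lambda>k. weight (-1/4) k) (y (tn (r n)))) * rough_kernel_norm" for n
  have S0: "S \<longlonglongrightarrow> 0" using q0 unfolding S_def .
  have evS: "\<bar>ev (y (tn (r n))) x\<bar> \<le> S n" for n x unfolding S_def by (rule ev_bound_quarter)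
  have Lc: "weighted_hamiltonian 0 c (y (tn (r n))) = weighted_hamiltonian 0 c y0" for n by (rule hamiltonian_conserved[OF y \<omega> z c(1) tn0])
  have "weighted_hamiltonian 0 c y0 = 0"
  proof -
    have "(\<lambda>n. ((S n)\<^sup>2 / 2 + (S n) ^ 3 / 6) * (2 * pi)) \<longlonglongrightarrow> (0\<^sup>2 / 2 + 0 ^ 3 / 6) * (2 * pi)"
      by (intro tendsto_intros S0) simp_all
    then have s: "(\<lambda>n. ((S n)\<^sup>2 / 2 + (S n) ^ 3 / 6) * (2 * pi)) \<longlonglongrightarrow> 0" by simp
    have le: "\<bar>weighted_hamiltonian 0 c y0\<bar> \<le> ((S n)\<^sup>2 / 2 + (S n) ^ 3 / 6) * (2 * pi)" for n
      using weighted_hamiltonian_bound[OF evS order_refl c(2), of n] unfolding Lc .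
    have "\<bar>weighted_hamiltonian 0 c y0\<bar> \<le> 0" by (rule LIMSEQ_le_const[OF s]) (use le in blast)
    then show ?thesis by simp
  qed
  have "\<forall>\<^sub>F n in sequentially. S n < 1" using order_tendstoD(2)[OF S0, of 1] by simp
  then obtain n where n: "S n < 1" unfolding eventually_sequentially by blast
  define b where "b = y (tn (r n))"
  have eb: "\<bar>ev b x\<bar> \<le> 1" for x using evS[of n x] n unfolding b_def by linarith
  \<comment> \<open>\<open>v\<^sup>2/2 + v\<^sup>3/6 \<ge> v\<^sup>2/3\<close> as soon as \<open>v \<ge> - 1\<close>.\<close>
  have "(1/3) * integral {c..c + 2 * pi} (\<lambda>x. (ev b x)\<^sup>2) = integral {c..c + 2 * pi} (\<lambda>x. (1/3) * (ev b x)\<^sup>2)" by simp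
  also have "\<dots> \<le> integral {c..c + 2 * pi} (\<lambda>x. ((ev b x)\<^sup>2 / 2 + (ev b x) ^ 3 / 6) * exp (- 0 * x))"
  proof (rule integral_le)
    show "(\<lambda>x. (1/3) * (ev b x)\<^sup>2) integrable_on {c..c + 2 * pi}"
      by (intro integrable_continuous_real continuous_intros ev_continuous)
    show "(\<lambda>x. ((ev b x)\<^sup>2 / 2 + (ev b x) ^ 3 / 6) * exp (- 0 * x)) integrable_on {c..c + 2 * pi}"
      by (intro integrable_continuous_real continuous_intros ev_continuous) simp_all
    fix x
    have "0 \<le> (ev b x)\<^sup>2 * ((1 + ev b x) / 6)" using eb[of x] by (intro mult_nonneg_nonneg) auto
    then show "(1/3) * (ev b x)\<^sup>2 \<le> ((ev b x)\<^sup>2 / 2 + (ev b x) ^ 3 / 6) * exp (- 0 * x)"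
      by (simp add: power2_eq_square power3_eq_cube field_simps)
  qed
  also have "\<dots> = weighted_hamiltonian 0 c b" unfolding weighted_hamiltonian_def ..
  also have "\<dots> = 0" using Lc[of n] \<open>weighted_hamiltonian 0 c y0 = 0\<close> unfolding b_def by simp
  finally have "integral {c..c + 2 * pi} (\<lambda>x. (ev b x)\<^sup>2) \<le> 0" by simp
  moreover have "integral {c..c + 2 * pi} (\<lambda>x. (ev b x)\<^sup>2) = 2 * pi * (norm (mul half_mult b))\<^sup>2"
    by (subst integral_period[OF _ _ c(2)]) (auto intro!: continuous_intros ev_continuous simp: integral_ev_sq torus_periodic_def ev_periodic)
  ultimately have "norm (mul half_mult b) = 0" by (auto simp: mult_le_0_iff dest: leD)
  then have mb: "mul half_mult b = 0" by simp
  have "cf b k = 0" for k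
    using cf_mul[OF multiplier_half, of b k] unfolding mb by simp
  then have "b = 0" by (intro hl2_eqI) simp
  then show "y0 = 0" using undamped_norm[OF y tn0, of "r n"] unfolding b_def by simp
qed

section \<open>Stabilization\<close>

text \<open>A nonnegative starting point makes \<open>exp (- k x) \<le> 1\<close> on the period that follows.\<close>

lemma torus_open_nonneg_point:
  assumes "torus_open \<omega>" "\<omega> \<noteq> {}" obtains c where "c \<in> \<omega>" "0 \<le> c"
proof -
  obtain x where x: "x \<in> \<omega>" using assms(2) by blast
  obtain k :: int where k: "x - of_int k * (2 * pi) \<in> {0..2 * pi}" by (rule reduce_to_period)
  have "torus_periodic (\<lambda>z. z \<in> \<omega>)" using assms(1) by (simp add: torus_open_def)
  from torus_periodic_int[OF this, of "x - of_int k * (2 * pi)" k]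
  have "x - of_int k * (2 * pi) \<in> \<omega>" using x by simp
  then show thesis using that k by simp
qed

theorem omega_limit_zero:
  assumes a: "torus_smooth a" "\<And>x. 0 \<le> a x" and \<omega>: "torus_open \<omega>" "\<omega> \<noteq> {}" and pos: "\<And>x. x \<in> \<omega> \<Longrightarrow> 0 < a x"
    and x: "flow a x0 x" and tn: "\<And>n. 0 \<le> tn n" "filterlim tn at_top sequentially"
    and lim: "\<And>k. (\<lambda>n. cf (x (tn n)) k) \<longlonglongrightarrow> cf y0 k"
  shows "y0 = 0"
proof -
  obtain y where y: "flow (\<lambda>_. 0) y0 y" and z: "\<And>t x. 0 \<le> t \<Longrightarrow> a x * ev (y t) x = 0"
    using omega_limit_undamped[OF a x tn lim] by blast
  obtain c where c: "c \<in> \<omega>" "0 \<le> c" by (rule torus_open_nonneg_point[OF \<omega>])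
  have o: "open \<omega>" using \<omega>(1) by (simp add: torus_open_def)
  have z': "ev (y t) x = 0" if "0 \<le> t" "x \<in> \<omega>" for t x
    using z[OF that(1), of x] pos[OF that(2)] by simp
  show ?thesis by (rule unique_continuation[OF y o z' c])
qed

text \<open>Otherwise a coefficient would stay away from zero along a sequence of times, and weak compactness of the bounded
  trajectory would produce a nonzero limit point.\<close>

theorem flow_weakly_null:
  assumes a: "torus_smooth a" "\<And>x. 0 \<le> a x" and \<omega>: "torus_open \<omega>" "\<omega> \<noteq> {}" and pos: "\<And>x. x \<in> \<omega> \<Longrightarrow> 0 < a x"
    and x: "flow a x0 x"
  shows "((\<lambda>t. cf (x t) k) \<longlongrightarrow> 0) at_top"
proof (rule ccontr)
  assume "\<not> ?thesis"
  then obtain e where e: "0 < e" and ne: "\<not> (\<forall>\<^sub>F t in at_top. dist (cf (x t) k) 0 < e)"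
    unfolding tendsto_iff by blast
  have "\<exists>t\<ge>real n. e \<le> cmod (cf (x t) k)" for n
    using ne unfolding eventually_at_top_linorder by (auto simp: not_less)
  then obtain tn where tn: "\<And>n. real n \<le> tn n" "\<And>n. e \<le> cmod (cf (x (tn n)) k)" by metis
  have tn0: "0 \<le> tn n" for n using tn(1)[of n] by linarith
  have bd: "norm (x (tn n)) \<le> norm x0" for n by (rule flow_norm_le[OF a x tn0])
  obtain r y0 where r: "strict_mono r" and lim: "\<And>k. (\<lambda>n. cf (x (tn (r n))) k) \<longlonglongrightarrow> cf y0 k"
    using bounded_sequence_weakly_compact[of "\<lambda>n. x (tn n)", OF bd] by blast
  have inf: "filterlim (\<lambda>n. tn (r n)) at_top sequentially"
  proof (rule filterlim_at_top_mono[OF filterlim_real_sequentially], rule always_eventually, rule allI)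
    fix n
    have "real n \<le> real (r n)" using seq_suble[OF r, of n] by simp
    with tn(1)[of "r n"] show "real n \<le> tn (r n)" by linarith
  qed
  have "y0 = 0" by (rule omega_limit_zero[OF a \<omega> pos x tn0 inf lim])
  then have "(\<lambda>n. cmod (cf (x (tn (r n))) k)) \<longlonglongrightarrow> cmod (cf 0 k)" using lim[of k] by (intro tendsto_norm) simp
  moreover have "\<exists>N. \<forall>n\<ge>N. e \<le> cmod (cf (x (tn (r n))) k)" using tn(2) by blast
  ultimately have "e \<le> cmod (cf 0 k)" by (rule LIMSEQ_le_const)
  then show False using e by simp
qed

text \<open>The inclusion of \<open>H\<^sup>1\<close> in \<open>H\<^sup>s\<close> is the multiplier \<open>weight (s - 1)\<close>, which tends to zero at infinity for
  \<open>s < 1\<close> and therefore turns weak convergence into strong convergence.\<close>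

theorem bbm_weak_stabilization:
  assumes a: "torus_smooth a" "\<And>x. 0 \<le> a x" and \<omega>: "torus_open \<omega>" "\<omega> \<noteq> {}" and pos: "\<And>x. x \<in> \<omega> \<Longrightarrow> 0 < a x"
    and u0: "u0 \<in> sobolev 1" and u: "\<forall>T>0. bbm_solution a 1 T u0 u"
  shows "sobolev_weak_limit 1 u (\<lambda>_. 0) at_top"
    and "s < 1 \<Longrightarrow> ((\<lambda>t. sobolev_norm s (u t)) \<longlongrightarrow> 0) at_top"
proof -
  note x = bbm_solution_flow[OF smooth_sobolev[OF a(1)] u0 u]
  have null: "((\<lambda>t. cf (emb 1 (u t)) k) \<longlongrightarrow> 0) at_top" for k
    by (rule flow_weakly_null[OF a \<omega> pos x(1)])
  have bd: "\<forall>\<^sub>F t in at_top. u t \<in> sobolev 1 \<and> norm (emb 1 (u t)) \<le> norm (emb 1 u0)"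
    using eventually_ge_at_top[of 0] by eventually_elim (use x(2) flow_norm_le[OF a x(1)] in auto)
  show "sobolev_weak_limit 1 u (\<lambda>_. 0) at_top"
    by (rule weak_limitI[OF bd sobolev_zero]) (use null in \<open>simp add: emb_zero\<close>)
  assume s: "s < 1"
  have m: "multiplier 1 (\<lambda>n. complex_of_real (weight (s - 1) n))" using s by (simp add: multiplier_def hermitian_weight weight_le_1)
  have "((\<lambda>t. mul (\<lambda>n. weight (s - 1) n) (emb 1 (u t))) \<longlongrightarrow> mul (\<lambda>n. weight (s - 1) n) 0) at_top"
    by (rule weight_mul_tendsto[where R="norm (emb 1 u0)"]) (use null bd s in \<open>auto elim: eventually_mono\<close>)
  moreover have "mul (\<lambda>n. complex_of_real (weight (s - 1) n)) 0 = 0"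
    by (rule linear_0, rule bounded_linear.linear, rule bounded_linear_mul[OF m])
  ultimately have "((\<lambda>t. mul (\<lambda>n. weight (s - 1) n) (emb 1 (u t))) \<longlongrightarrow> 0) at_top" by simp
  from tendsto_norm[OF this] have n: "((\<lambda>t. norm (mul (\<lambda>n. weight (s - 1) n) (emb 1 (u t)))) \<longlongrightarrow> 0) at_top" by simp
  have "\<forall>\<^sub>F t in at_top. norm (mul (\<lambda>n. weight (s - 1) n) (emb 1 (u t))) = sobolev_norm s (u t)"
    using bd
  proof eventually_elim
    case (elim t)
    have "u t \<in> sobolev s" "emb s (u t) = mul (\<lambda>n. weight (s - 1) n) (emb 1 (u t))"
      using sobolev_mono[of s 1 "u t"] s elim by auto
    then show ?case by (simp add: sobolev_norm_emb)
  qed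
  then show "((\<lambda>t. sobolev_norm s (u t)) \<longlongrightarrow> 0) at_top"
    by (rule Lim_transform_eventually[OF n])
qed

theorem theorem2:
  fixes \<omega> :: "real set" and a :: "real \<Rightarrow> real"
  assumes "torus_open \<omega>" and "\<omega> \<noteq> {}"
    and "torus_smooth a" and "\<forall>x. 0 \<le> a x" and "\<forall>x\<in>\<omega>. 0 < a x"
  shows
    "(\<forall>s\<ge>0.
        (\<forall>u0\<in>sobolev s. \<exists>T>0. \<exists>u. unique_bbm_solution a s T u0 u) \<and>
        (\<forall>R>0. \<exists>T>0.
           (\<forall>u0\<in>sobolev s. sobolev_norm s u0 \<le> R \<longrightarrow> (\<exists>u. unique_bbm_solution a s T u0 u)) \<and>
           (\<exists>L. \<forall>u0\<in>sobolev s. \<forall>w0\<in>sobolev s.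
              sobolev_norm s u0 \<le> R \<longrightarrow> sobolev_norm s w0 \<le> R \<longrightarrow>
              (\<forall>u w. bbm_solution a s T u0 u \<longrightarrow> bbm_solution a s T w0 w \<longrightarrow>
                 (\<forall>t\<in>{0..T}. sobolev_dist s (u t) (w t) \<le> L * sobolev_dist s u0 w0)))))
     \<and>
     (\<forall>u0\<in>sobolev 1. \<exists>u.
        (\<forall>T>0. unique_bbm_solution a 1 T u0 u) \<and>
        (\<forall>t1 t2. 0 \<le> t1 \<longrightarrow> t1 \<le> t2 \<longrightarrow> (sobolev_norm 1 (u t2))\<^sup>2 \<le> (sobolev_norm 1 (u t1))\<^sup>2))
     \<and>
     (\<forall>u0\<in>sobolev 1. \<forall>u. (\<forall>T>0. bbm_solution a 1 T u0 u) \<longrightarrow>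
        (\<forall>v0 tn. (\<forall>n. 0 \<le> tn n) \<longrightarrow> incseq tn \<longrightarrow> filterlim tn at_top sequentially \<longrightarrow>
           sobolev_weak_limit 1 (\<lambda>n. u (tn n)) v0 sequentially \<longrightarrow>
           (\<exists>v. (\<forall>T>0. unique_bbm_solution (\<lambda>_. 0) 1 T v0 v) \<and>
                (\<exists>T>0. vanishes_on \<omega> T v))))
     \<and>
     (UCP_conjecture \<longrightarrow>
        (\<forall>u0\<in>sobolev 1. \<forall>u. (\<forall>T>0. bbm_solution a 1 T u0 u) \<longrightarrow>
           (\<forall>v0 tn. (\<forall>n. 0 \<le> tn n) \<longrightarrow> incseq tn \<longrightarrow> filterlim tn at_top sequentially \<longrightarrow>
              sobolev_weak_limit 1 (\<lambda>n. u (tn n)) v0 sequentially \<longrightarrow>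
              (AE x in lborel. v0 x = 0)) \<and>
           sobolev_weak_limit 1 u (\<lambda>_. 0) at_top \<and>
           (\<forall>s<1. ((\<lambda>t. sobolev_norm s (u t)) \<longlongrightarrow> 0) at_top)))"
proof (intro conjI)
  have a: "torus_smooth a" "\<And>x. 0 \<le> a x" using assms by auto
  have pos: "\<And>x. x \<in> \<omega> \<Longrightarrow> 0 < a x" using assms(5) by blast
  note \<omega> = assms(1,2)
  show "\<forall>s\<ge>0.
        (\<forall>u0\<in>sobolev s. \<exists>T>0. \<exists>u. unique_bbm_solution a s T u0 u) \<and>
        (\<forall>R>0. \<exists>T>0.
           (\<forall>u0\<in>sobolev s. sobolev_norm s u0 \<le> R \<longrightarrow> (\<exists>u. unique_bbm_solution a s T u0 u)) \<and>
           (\<exists>L. \<forall>u0\<in>sobolev s. \<forall>w0\<in>sobolev s.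
              sobolev_norm s u0 \<le> R \<longrightarrow> sobolev_norm s w0 \<le> R \<longrightarrow>
              (\<forall>u w. bbm_solution a s T u0 u \<longrightarrow> bbm_solution a s T w0 w \<longrightarrow>
                 (\<forall>t\<in>{0..T}. sobolev_dist s (u t) (w t) \<le> L * sobolev_dist s u0 w0))))"
  proof (intro allI impI)
    fix s :: real assume s: "0 \<le> s"
    note wp = bbm_local_wellposed[OF s smooth_sobolev[OF a(1)]]
    have "\<exists>T>0. \<exists>u. unique_bbm_solution a s T u0 u" if u0: "u0 \<in> sobolev s" for u0
    proof -
      define R where "R = \<bar>sobolev_norm s u0\<bar> + 1"
      have R: "0 < R" "sobolev_norm s u0 \<le> R" unfolding R_def by linarith+
      obtain T where "0 < T" "\<forall>u0\<in>sobolev s. sobolev_norm s u0 \<le> R \<longrightarrow> (\<exists>u. unique_bbm_solution a s T u0 u)"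
        using wp[OF R(1)] by blast
      with R(2) u0 show ?thesis by blast
    qed
    with wp show "(\<forall>u0\<in>sobolev s. \<exists>T>0. \<exists>u. unique_bbm_solution a s T u0 u) \<and>
        (\<forall>R>0. \<exists>T>0.
           (\<forall>u0\<in>sobolev s. sobolev_norm s u0 \<le> R \<longrightarrow> (\<exists>u. unique_bbm_solution a s T u0 u)) \<and>
           (\<exists>L. \<forall>u0\<in>sobolev s. \<forall>w0\<in>sobolev s.
              sobolev_norm s u0 \<le> R \<longrightarrow> sobolev_norm s w0 \<le> R \<longrightarrow>
              (\<forall>u w. bbm_solution a s T u0 u \<longrightarrow> bbm_solution a s T w0 w \<longrightarrow>
                 (\<forall>t\<in>{0..T}. sobolev_dist s (u t) (w t) \<le> L * sobolev_dist s u0 w0))))"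
      by simp
  qed
  show "\<forall>u0\<in>sobolev 1. \<exists>u.
        (\<forall>T>0. unique_bbm_solution a 1 T u0 u) \<and>
        (\<forall>t1 t2. 0 \<le> t1 \<longrightarrow> t1 \<le> t2 \<longrightarrow> (sobolev_norm 1 (u t2))\<^sup>2 \<le> (sobolev_norm 1 (u t1))\<^sup>2)"
    by (rule ballI) (rule bbm_global_wellposed[OF a])
  show "\<forall>u0\<in>sobolev 1. \<forall>u. (\<forall>T>0. bbm_solution a 1 T u0 u) \<longrightarrow>
        (\<forall>v0 tn. (\<forall>n. 0 \<le> tn n) \<longrightarrow> incseq tn \<longrightarrow> filterlim tn at_top sequentially \<longrightarrow>
           sobolev_weak_limit 1 (\<lambda>n. u (tn n)) v0 sequentially \<longrightarrow>
           (\<exists>v. (\<forall>T>0. unique_bbm_solution (\<lambda>_. 0) 1 T v0 v) \<and>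
                (\<exists>T>0. vanishes_on \<omega> T v)))"
  proof (intro ballI allI impI)
    fix u0 u v0 and tn :: "nat \<Rightarrow> real"
    assume u0: "u0 \<in> sobolev 1" and u: "\<forall>T>0. bbm_solution a 1 T u0 u"
      and tn: "\<forall>n. 0 \<le> tn n" "filterlim tn at_top sequentially"
      and w: "sobolev_weak_limit 1 (\<lambda>n. u (tn n)) v0 sequentially"
    show "\<exists>v. (\<forall>T>0. unique_bbm_solution (\<lambda>_. 0) 1 T v0 v) \<and> (\<exists>T>0. vanishes_on \<omega> T v)"
      by (rule weak_limit_vanishes[OF a pos u0 u spec[OF tn(1)] tn(2) w])
  qed
  have zero: "AE x in lborel. v0 x = 0"
    if u0: "u0 \<in> sobolev 1" and u: "\<forall>T>0. bbm_solution a 1 T u0 u"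
      and tn: "\<forall>n. 0 \<le> tn n" "filterlim tn at_top sequentially"
      and w: "sobolev_weak_limit 1 (\<lambda>n. u (tn n)) v0 sequentially" for u0 u v0 and tn :: "nat \<Rightarrow> real"
  proof -
    have v0: "v0 \<in> sobolev 1" using w by (simp add: sobolev_weak_limit_def)
    have "emb 1 v0 = 0"
      by (rule omega_limit_zero[OF a \<omega> pos bbm_solution_flow(1)[OF smooth_sobolev[OF a(1)] u0 u] spec[OF tn(1)] tn(2) weak_limit_cf[OF w]])
    then show ?thesis using emb_eq_iff[OF v0 sobolev_zero] by (simp add: emb_zero)
  qed
  show "UCP_conjecture \<longrightarrow>
        (\<forall>u0\<in>sobolev 1. \<forall>u. (\<forall>T>0. bbm_solution a 1 T u0 u) \<longrightarrow>
           (\<forall>v0 tn. (\<forall>n. 0 \<le> tn n) \<longrightarrow> incseq tn \<longrightarrow> filterlim tn at_top sequentially \<longrightarrow>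
              sobolev_weak_limit 1 (\<lambda>n. u (tn n)) v0 sequentially \<longrightarrow>
              (AE x in lborel. v0 x = 0)) \<and>
           sobolev_weak_limit 1 u (\<lambda>_. 0) at_top \<and>
           (\<forall>s<1. ((\<lambda>t. sobolev_norm s (u t)) \<longlongrightarrow> 0) at_top))"
  proof (intro impI ballI allI conjI)
    fix u0 u v0 and tn :: "nat \<Rightarrow> real"
    assume u0: "u0 \<in> sobolev 1" and u: "\<forall>T>0. bbm_solution a 1 T u0 u"
    show "AE x in lborel. v0 x = 0"
      if "\<forall>n. 0 \<le> tn n" "filterlim tn at_top sequentially" "sobolev_weak_limit 1 (\<lambda>n. u (tn n)) v0 sequentially"
      by (rule zero[OF u0 u that])
    show "sobolev_weak_limit 1 u (\<lambda>_. 0) at_top"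
      by (rule bbm_weak_stabilization(1)[OF a \<omega> pos u0 u])
    show "((\<lambda>t. sobolev_norm s (u t)) \<longlongrightarrow> 0) at_top" if "s < 1" for s
      by (rule bbm_weak_stabilization(2)[OF a \<omega> pos u0 u that])
  qed
qed

end
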